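(* Assume that $(\mathcal X,\sim)$, $d$, $m$, $R$, $(R^k)_{k\ge1}$, $\mu_0$, $\mu_1$ satisfy all the standing assumptions listed in the context, and let $\mu=(\mu_t)_{t\in[0,1]}$ be the displacement interpolation between $\mu_0$ and $\mu_1$. There exists a unique change of time $\tau_o$ such that $\mu^{\tau_o}:=(\mu_{\tau_o(t)})_{t\in[0,1]}$ has a constant speed, i.e. $$W_1(\mu^{\tau_o}_s,\mu^{\tau_o}_t)=(t-s)\,W_1(\mu_0,\mu_1),\qquad\forall\,0\le s\le t\le1.$$
   Context: **Notation.** $\mathrm P(Y)$, $\mathrm M_+(Y)$: probability measures and positive measures on $Y$. The relative entropy is $H(p|r)=\int\log(dp/dr)\,dp$ if $p\ll r$, and $+\infty$ otherwise; for an unbounded $\sigma$-finite $r$ it is defined, for $p$ such that $\int W\,dp<\infty$ for some measurable $W\ge0$ with $z_W:=\int e^{-W}dr<\infty$, by $H(p|r)=H(p|z_W^{-1}e^{-W}r)-\int W\,dp-\log z_W$. **Graph and paths.** $\mathcal X$ is a countable set (discrete topology) with an undirected graph structure $\sim$ which is irreducible (connected), has no loop and is locally finite. $\Omega$ is the set of all right-continuous, left-limited, piecewise constant paths $\omega:[0,1]\to\mathcal X$ with finitely many jumps, left-continuous at $t=1$, such that $\omega_{t^-}\ne\omega_t$ implies $\omega_{t^-}\sim\omega_t$. It carries the Skorokhod topology and the $\sigma$-field generated by the canonical process $X_t(\omega)=\omega_t$; $\mathrm P(\Omega)$ carries the narrow topology. For $Q\in\mathrm M_+(\Omega)$: $Q_t=(X_t)_\#Q$,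 $Q_{01}=(X_0,X_1)_\#Q$, $Q^{xy}=Q(\cdot\mid X_0=x,X_1=y)$. **Standing assumptions.** - $d$ is a distance on $\mathcal X$ with $d(x,y)\ge1$ for $x\ne y$ and $d(x,y)=\inf\{\ell(\omega):\omega\in\Omega,\omega_0=x,\omega_1=y\}$, where $\ell(\omega)=\sum_{0<t<1}d(\omega_{t^-},\omega_t)$. - $R\in\mathrm M_+(\Omega)$ is Markov with forward jump kernel $J_{t,x}=\sum_{y\sim x}J_{t,x}(y)\delta_y$ (generator $L_tu(x)=\sum_{y\sim x}J_{t,x}(y)[u(y)-u(x)]$), where $J_{t,x}(y)>0$ for all $t\in[0,1]$ if and only if $x\sim y$ (and $J_{t,x}(y)=0$ for non-neighbours), and $\sup_{t,x}J_{t,x}(\mathcal X)<\infty$. - For $k\ge1$, $R^k\in\mathrm M_+(\Omega)$ is the Markov measure with forward jump kernel $J^k_{t,x}=\sum_{y\sim x}k^{-d(x,y)}J_{t,x}(y)\delta_y$ and initial measure $R^k_0=m\in\mathrm M_+(\mathcal X)$, $m_x>0$ for all $x$; $R=R^1$. - $\mu_0,\mu_1\in\mathrm P(\mathcal X)$ are such that there is $\pi^o\in\mathrm P(\mathcal X^2)$ with marginals $\mu_0,\mu_1$, $\int_{\mathcal X^2}E_{R^{xy}}(\ell)\,\pi^o(dxdy)<\infty$ and $H(\pi^o|R_{01})<\infty$. **Definitions.** $W_1(\alpha,\beta)=\inf\int_{\mathcal X^2}d\,d\pi$ over couplings $\pi$ of $\alpha,\beta\in\mathrm P(\mathcal X)$.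 For $k\ge2$, $\widehat P^k$ is the unique minimizer of $H(P|R^k)$ over $P\in\mathrm P(\Omega)$ with $P_0=\mu_0,P_1=\mu_1$; the displacement random walk $\widehat P$ is the narrow limit $\lim_{k\to\infty}\widehat P^k$ (it exists); the displacement interpolation is $\mu_t=\widehat P_t$. A change of time is an absolutely continuous function $\tau:[0,1]\to[0,1]$ with $\tau(0)=0$, $\tau(1)=1$ and nonnegative generalized derivative $\dot\tau\in L^1([0,1])$.
   Formalization: Uniqueness of the change of time is asserted only when μ_0 ≠ μ_1 (existence is asserted always), because for μ_0 = μ_1 the interpolation is constant, W_1(μ_0,μ_1)=0, and every change of time gives constant speed. *)

theory Defs
  imports "HOL-Probability.Probability"
begin

section \<open>The graph and its path space\<close>

text \<open>
  The countable state space is a type of class \<open>countable\<close> with its discrete topology and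
  sigma-field; the graph structure is a relation \<open>adj\<close> on it.
\<close>

definition good_graph :: "('a \<Rightarrow> 'a \<Rightarrow> bool) \<Rightarrow> bool" where
  "good_graph adj \<longleftrightarrow>
     (\<forall>x y. adj x y \<longrightarrow> adj y x) \<and>
     (\<forall>x. \<not> adj x x) \<and>
     (\<forall>x y. adj\<^sup>*\<^sup>* x y) \<and>
     (\<forall>x. finite {y. adj x y})"

text \<open>In a discrete space, convergence means being eventually equal to the limit.\<close>

definition left_lim :: "(real \<Rightarrow> 'a) \<Rightarrow> real \<Rightarrow> 'a" where
  "left_lim \<omega> t = (THE x. eventually (\<lambda>s. \<omega> s = x) (at_left t))"

definition jump_times :: "(real \<Rightarrow> 'a) \<Rightarrow> real set" where
  "jump_times \<omega> = {t \<in> {0<..<1}. left_lim \<omega> t \<noteq> \<omega> t}"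

text \<open>
  Paths are functions on \<open>[0,1]\<close>, extended by \<open>undefined\<close> outside. Piecewise constancy is the
  conjunction of one-sided local constancy and finiteness of the set of jumps.
\<close>

definition paths :: "('a \<Rightarrow> 'a \<Rightarrow> bool) \<Rightarrow> (real \<Rightarrow> 'a) set" where
  "paths adj = {\<omega> \<in> {0..1} \<rightarrow>\<^sub>E UNIV.
     (\<forall>t\<in>{0..<1}. eventually (\<lambda>s. \<omega> s = \<omega> t) (at_right t)) \<and>
     (\<forall>t\<in>{0<..1}. \<exists>x. eventually (\<lambda>s. \<omega> s = x) (at_left t)) \<and>
     eventually (\<lambda>s. \<omega> s = \<omega> 1) (at_left 1) \<and>
     finite (jump_times \<omega>) \<and>
     (\<forall>t\<in>jump_times \<omega>. adj (left_lim \<omega> t) (\<omega> t))}"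

definition path_length :: "('a \<Rightarrow> 'a \<Rightarrow> real) \<Rightarrow> (real \<Rightarrow> 'a) \<Rightarrow> real" where
  "path_length d \<omega> = (\<Sum>t\<in>jump_times \<omega>. d (left_lim \<omega> t) (\<omega> t))"

definition path_sigma :: "('a \<Rightarrow> 'a \<Rightarrow> bool) \<Rightarrow> real set \<Rightarrow> (real \<Rightarrow> 'a) measure" where
  "path_sigma adj I = sigma (paths adj) {{\<omega> \<in> paths adj. \<omega> s = x} | s x. s \<in> I}"

abbreviation path_space :: "('a \<Rightarrow> 'a \<Rightarrow> bool) \<Rightarrow> (real \<Rightarrow> 'a) measure" where
  "path_space adj \<equiv> path_sigma adj {0..1}"

subsection \<open>Skorokhod topology and narrow convergence\<close>

definition time_warps :: "(real \<Rightarrow> real) set" where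
  "time_warps = {\<theta>. strict_mono_on {0..1} \<theta> \<and> \<theta> ` {0..1} = {0..1}}"

text \<open>
  Skorokhod balls for the 0-1 metric on the state space: for radii at most 1, being uniformly
  close after a change of time means being equal after that change of time.
\<close>

definition skorokhod_ball ::
    "('a \<Rightarrow> 'a \<Rightarrow> bool) \<Rightarrow> (real \<Rightarrow> 'a) \<Rightarrow> real \<Rightarrow> (real \<Rightarrow> 'a) set" where
  "skorokhod_ball adj \<omega> e = {\<omega>' \<in> paths adj. \<exists>\<theta>\<in>time_warps.
     (\<forall>t\<in>{0..1}. \<bar>\<theta> t - t\<bar> < e) \<and> (\<forall>t\<in>{0..1}. \<omega>' (\<theta> t) = \<omega> t)}"

definition skorokhod_topology :: "('a \<Rightarrow> 'a \<Rightarrow> bool) \<Rightarrow> (real \<Rightarrow> 'a) topology" where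
  "skorokhod_topology adj =
     topology (\<lambda>U. U \<subseteq> paths adj \<and> (\<forall>\<omega>\<in>U. \<exists>e>0. skorokhod_ball adj \<omega> e \<subseteq> U))"

lemma openin_skorokhod_topology:
  "openin (skorokhod_topology adj) U \<longleftrightarrow>
     U \<subseteq> paths adj \<and> (\<forall>\<omega>\<in>U. \<exists>e>0. skorokhod_ball adj \<omega> e \<subseteq> U)"
proof -
  have mono: "skorokhod_ball adj \<omega> e \<subseteq> skorokhod_ball adj \<omega> e'" if "e \<le> e'" for \<omega> e e'
    using that unfolding skorokhod_ball_def by (blast intro: less_le_trans)
  have "istopology (\<lambda>U. U \<subseteq> paths adj \<and> (\<forall>\<omega>\<in>U. \<exists>e>0. skorokhod_ball adj \<omega> e \<subseteq> U))"
    unfolding istopology_def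
  proof (intro conjI allI impI; (elim conjE)?)
    fix S T
    assume S: "\<forall>\<omega>\<in>S. \<exists>e>0. skorokhod_ball adj \<omega> e \<subseteq> S"
      and T: "\<forall>\<omega>\<in>T. \<exists>e>0. skorokhod_ball adj \<omega> e \<subseteq> T"
    show "\<forall>\<omega>\<in>S \<inter> T. \<exists>e>0. skorokhod_ball adj \<omega> e \<subseteq> S \<inter> T"
    proof
      fix \<omega> assume "\<omega> \<in> S \<inter> T"
      then obtain e f where "e > 0" "skorokhod_ball adj \<omega> e \<subseteq> S"
        "f > 0" "skorokhod_ball adj \<omega> f \<subseteq> T"
        using S T by blast
      then have "min e f > 0" "skorokhod_ball adj \<omega> (min e f) \<subseteq> S \<inter> T"
        using mono[of "min e f" e \<omega>] mono[of "min e f" f \<omega>] by auto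
      then show "\<exists>e>0. skorokhod_ball adj \<omega> e \<subseteq> S \<inter> T" by blast
    qed
  next
    fix K :: "(real \<Rightarrow> 'a) set set"
    assume K: "\<forall>U\<in>K. U \<subseteq> paths adj \<and> (\<forall>\<omega>\<in>U. \<exists>e>0. skorokhod_ball adj \<omega> e \<subseteq> U)"
    show "\<forall>\<omega>\<in>\<Union>K. \<exists>e>0. skorokhod_ball adj \<omega> e \<subseteq> \<Union>K"
    proof
      fix \<omega> assume "\<omega> \<in> \<Union>K"
      then obtain U where U: "U \<in> K" "\<omega> \<in> U" by blast
      then obtain e where "e > 0" "skorokhod_ball adj \<omega> e \<subseteq> U" using K by blast
      then show "\<exists>e>0. skorokhod_ball adj \<omega> e \<subseteq> \<Union>K" using U(1) by blast
    qed
  qed blast+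
  then show ?thesis
    unfolding skorokhod_topology_def by (simp add: topology_inverse')
qed

definition narrow_limit ::
    "('a \<Rightarrow> 'a \<Rightarrow> bool) \<Rightarrow> (nat \<Rightarrow> (real \<Rightarrow> 'a) measure) \<Rightarrow> (real \<Rightarrow> 'a) measure \<Rightarrow> bool" where
  "narrow_limit adj P Q \<longleftrightarrow>
     (\<forall>f :: (real \<Rightarrow> 'a) \<Rightarrow> real.
        continuous_map (skorokhod_topology adj) euclideanreal f \<and> bounded (f ` paths adj) \<longrightarrow>
        (\<lambda>k. \<integral>\<omega>. f \<omega> \<partial>P k) \<longlonglongrightarrow> (\<integral>\<omega>. f \<omega> \<partial>Q))"

subsection \<open>Marginals and bridges\<close>

definition marginal :: "(real \<Rightarrow> 'a) measure \<Rightarrow> real \<Rightarrow> 'a measure" where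
  "marginal Q t = distr Q (count_space UNIV) (\<lambda>\<omega>. \<omega> t)"

definition endpoints :: "(real \<Rightarrow> 'a) measure \<Rightarrow> ('a \<times> 'a) measure" where
  "endpoints Q = distr Q (count_space UNIV) (\<lambda>\<omega>. (\<omega> 0, \<omega> 1))"

definition bridge :: "(real \<Rightarrow> 'a) measure \<Rightarrow> 'a \<Rightarrow> 'a \<Rightarrow> (real \<Rightarrow> 'a) measure" where
  "bridge Q x y = uniform_measure Q {\<omega> \<in> space Q. \<omega> 0 = x \<and> \<omega> 1 = y}"


section \<open>Relative entropy\<close>

text \<open>
  For a bounded reference measure the negative part of \<open>log (dp/dr)\<close> is always \<open>p\<close>-integrable, so
  that non-integrability means that the entropy is infinite.
\<close>

definition rel_entropy_bounded :: "'b measure \<Rightarrow> 'b measure \<Rightarrow> ereal" where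
  "rel_entropy_bounded p r =
     (if absolutely_continuous r p \<and> integrable p (entropy_density (exp 1) r p)
      then ereal (KL_divergence (exp 1) r p) else \<infinity>)"

definition entropy_weight :: "'b measure \<Rightarrow> 'b measure \<Rightarrow> ('b \<Rightarrow> real) \<Rightarrow> bool" where
  "entropy_weight p r W \<longleftrightarrow>
     W \<in> borel_measurable r \<and> (\<forall>x\<in>space r. 0 \<le> W x) \<and>
     integrable p W \<and> integrable r (\<lambda>x. exp (- W x))"

definition rel_entropy_weighted :: "'b measure \<Rightarrow> 'b measure \<Rightarrow> ('b \<Rightarrow> real) \<Rightarrow> ereal" where
  "rel_entropy_weighted p r W =
     (let z = (\<integral>x. exp (- W x) \<partial>r) in
      rel_entropy_bounded p (density r (\<lambda>x. ennreal (exp (- W x) / z)))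
        - ereal (\<integral>x. W x \<partial>p) - ereal (ln z))"

text \<open>
  For an unbounded reference measure the value does not depend on the choice of the weight. If no
  weight exists, the entropy is undefined in the literature; here it is \<open>\<infinity>\<close>, so that such a \<open>p\<close>
  neither satisfies \<open>H(p|r) < \<infinity>\<close> nor competes in a minimization.
\<close>

definition rel_entropy :: "'b measure \<Rightarrow> 'b measure \<Rightarrow> ereal" where
  "rel_entropy p r =
     (if emeasure r (space r) < \<infinity> then rel_entropy_bounded p r
      else if \<exists>W. entropy_weight p r W
      then rel_entropy_weighted p r (SOME W. entropy_weight p r W)
      else \<infinity>)"


section \<open>Markov measures with a given jump kernel\<close>

text \<open>
  \<open>Q(X\<^bsub>[t,1]\<^esub> \<in> B | X\<^bsub>[0,t]\<^esub>)\<close> is a function of \<open>X\<^sub>t\<close>, expressed through its value \<open>c\<close> on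
  \<open>{X\<^sub>t = x}\<close>, which makes sense for infinite measures as well.
\<close>

definition markov :: "('a \<Rightarrow> 'a \<Rightarrow> bool) \<Rightarrow> (real \<Rightarrow> 'a) measure \<Rightarrow> bool" where
  "markov adj Q \<longleftrightarrow>
     (\<forall>t\<in>{0..1}. \<forall>x. \<forall>B\<in>sets (path_sigma adj {t..1}). \<exists>c. \<forall>A\<in>sets (path_sigma adj {0..t}).
        emeasure Q (A \<inter> {\<omega> \<in> paths adj. \<omega> t = x} \<inter> B)
          = c * emeasure Q (A \<inter> {\<omega> \<in> paths adj. \<omega> t = x}))"

definition generator ::
    "('a \<Rightarrow> 'a \<Rightarrow> bool) \<Rightarrow> (real \<Rightarrow> 'a \<Rightarrow> 'a \<Rightarrow> real) \<Rightarrow> real \<Rightarrow> ('a \<Rightarrow> real) \<Rightarrow> 'a \<Rightarrow> real" where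
  "generator adj J t u x = (\<Sum>y | adj x y. J t x y * (u y - u x))"

text \<open>
  The forward jump kernel is characterized by the martingale problem for its generator: for bounded
  \<open>u\<close>, the process \<open>u(X\<^sub>t) - u(X\<^sub>0) - \<integral>\<^bsub>[0,t]\<^esub> L\<^sub>r u(X\<^sub>r) dr\<close> is a martingale. As \<open>Q\<close> may be unbounded, the
  martingale property is tested on past events of finite measure.
\<close>

definition has_jump_kernel ::
    "('a \<Rightarrow> 'a \<Rightarrow> bool) \<Rightarrow> (real \<Rightarrow> 'a \<Rightarrow> 'a \<Rightarrow> real) \<Rightarrow> (real \<Rightarrow> 'a) measure \<Rightarrow> bool" where
  "has_jump_kernel adj J Q \<longleftrightarrow>
     (\<forall>u s t A. bounded (range u) \<and> 0 \<le> s \<and> s \<le> t \<and> t \<le> 1 \<and>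
        A \<in> sets (path_sigma adj {0..s}) \<and> emeasure Q A < \<infinity> \<longrightarrow>
        (LINT \<omega>:A|Q. u (\<omega> t) - u (\<omega> s) - (LBINT r:{s..t}. generator adj J r u (\<omega> r))) = 0)"

definition markov_jump_measure ::
    "('a \<Rightarrow> 'a \<Rightarrow> bool) \<Rightarrow> ('a \<Rightarrow> real) \<Rightarrow> (real \<Rightarrow> 'a \<Rightarrow> 'a \<Rightarrow> real) \<Rightarrow> (real \<Rightarrow> 'a) measure \<Rightarrow> bool" where
  "markov_jump_measure adj m J Q \<longleftrightarrow>
     sets Q = sets (path_space adj) \<and>
     marginal Q 0 = point_measure UNIV (\<lambda>x. ennreal (m x)) \<and>
     markov adj Q \<and> has_jump_kernel adj J Q"


section \<open>Standing assumptions\<close>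

definition good_distance :: "('a \<Rightarrow> 'a \<Rightarrow> bool) \<Rightarrow> ('a \<Rightarrow> 'a \<Rightarrow> real) \<Rightarrow> bool" where
  "good_distance adj d \<longleftrightarrow>
     Metric_space UNIV d \<and>
     (\<forall>x y. x \<noteq> y \<longrightarrow> 1 \<le> d x y) \<and>
     (\<forall>x y. d x y = Inf {path_length d \<omega> | \<omega>. \<omega> \<in> paths adj \<and> \<omega> 0 = x \<and> \<omega> 1 = y})"

definition good_kernel ::
    "('a \<Rightarrow> 'a \<Rightarrow> bool) \<Rightarrow> (real \<Rightarrow> 'a \<Rightarrow> 'a \<Rightarrow> real) \<Rightarrow> bool" where
  "good_kernel adj J \<longleftrightarrow>
     (\<forall>x y. (\<lambda>t. J t x y) \<in> borel_measurable (restrict_space borel {0..1})) \<and>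
     (\<forall>t\<in>{0..1}. \<forall>x y. if adj x y then 0 < J t x y else J t x y = 0) \<and>
     (\<exists>C. \<forall>t\<in>{0..1}. \<forall>x. (\<Sum>y | adj x y. J t x y) \<le> C)"

definition slowed_kernel ::
    "('a \<Rightarrow> 'a \<Rightarrow> real) \<Rightarrow> (real \<Rightarrow> 'a \<Rightarrow> 'a \<Rightarrow> real) \<Rightarrow> nat \<Rightarrow> real \<Rightarrow> 'a \<Rightarrow> 'a \<Rightarrow> real" where
  "slowed_kernel d J k t x y = real k powr (- d x y) * J t x y"

definition couplings :: "'a measure \<Rightarrow> 'a measure \<Rightarrow> ('a \<times> 'a) measure set" where
  "couplings \<alpha> \<beta> = {\<pi> \<in> space (prob_algebra (count_space UNIV)).
     distr \<pi> (count_space UNIV) fst = \<alpha> \<and> distr \<pi> (count_space UNIV) snd = \<beta>}"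

definition good_marginals ::
    "('a \<Rightarrow> 'a \<Rightarrow> real) \<Rightarrow> (real \<Rightarrow> 'a) measure \<Rightarrow> 'a measure \<Rightarrow> 'a measure \<Rightarrow> bool" where
  "good_marginals d R \<mu>0 \<mu>1 \<longleftrightarrow>
     \<mu>0 \<in> space (prob_algebra (count_space UNIV)) \<and>
     \<mu>1 \<in> space (prob_algebra (count_space UNIV)) \<and>
     (\<exists>\<pi>\<in>couplings \<mu>0 \<mu>1.
        (\<integral>\<^sup>+z. (\<integral>\<^sup>+\<omega>. ennreal (path_length d \<omega>) \<partial>bridge R (fst z) (snd z)) \<partial>\<pi>) < \<infinity> \<and>
        rel_entropy \<pi> (endpoints R) < \<infinity>)"


section \<open>Displacement interpolations, Wasserstein distance, changes of time\<close>

definition W1 :: "('a \<Rightarrow> 'a \<Rightarrow> real) \<Rightarrow> 'a measure \<Rightarrow> 'a measure \<Rightarrow> ennreal" where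
  "W1 d \<alpha> \<beta> = (INF \<pi>\<in>couplings \<alpha> \<beta>. \<integral>\<^sup>+z. ennreal (d (fst z) (snd z)) \<partial>\<pi>)"

definition bridging_measures ::
    "('a \<Rightarrow> 'a \<Rightarrow> bool) \<Rightarrow> 'a measure \<Rightarrow> 'a measure \<Rightarrow> (real \<Rightarrow> 'a) measure set" where
  "bridging_measures adj \<mu>0 \<mu>1 =
     {P \<in> space (prob_algebra (path_space adj)). marginal P 0 = \<mu>0 \<and> marginal P 1 = \<mu>1}"

definition schrodinger_solution ::
    "('a \<Rightarrow> 'a \<Rightarrow> bool) \<Rightarrow> (real \<Rightarrow> 'a) measure \<Rightarrow> 'a measure \<Rightarrow> 'a measure \<Rightarrow>
      (real \<Rightarrow> 'a) measure \<Rightarrow> bool" where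
  "schrodinger_solution adj Q \<mu>0 \<mu>1 P \<longleftrightarrow>
     is_arg_min (\<lambda>P. rel_entropy P Q) (\<lambda>P. P \<in> bridging_measures adj \<mu>0 \<mu>1) P \<and>
     (\<forall>P'. is_arg_min (\<lambda>P. rel_entropy P Q) (\<lambda>P. P \<in> bridging_measures adj \<mu>0 \<mu>1) P' \<longrightarrow>
        P' = P)"

definition displacement_random_walk ::
    "('a \<Rightarrow> 'a \<Rightarrow> bool) \<Rightarrow> (nat \<Rightarrow> (real \<Rightarrow> 'a) measure) \<Rightarrow> 'a measure \<Rightarrow> 'a measure \<Rightarrow>
      (real \<Rightarrow> 'a) measure \<Rightarrow> bool" where
  "displacement_random_walk adj R \<mu>0 \<mu>1 Phat \<longleftrightarrow>
     Phat \<in> space (prob_algebra (path_space adj)) \<and>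
     (\<exists>P. (\<forall>k\<ge>2. schrodinger_solution adj (R k) \<mu>0 \<mu>1 (P k)) \<and> narrow_limit adj P Phat)"

definition displacement_interpolation ::
    "('a \<Rightarrow> 'a \<Rightarrow> bool) \<Rightarrow> (nat \<Rightarrow> (real \<Rightarrow> 'a) measure) \<Rightarrow> 'a measure \<Rightarrow> 'a measure \<Rightarrow>
      (real \<Rightarrow> 'a measure) \<Rightarrow> bool" where
  "displacement_interpolation adj R \<mu>0 \<mu>1 \<mu> \<longleftrightarrow>
     (\<exists>Phat. displacement_random_walk adj R \<mu>0 \<mu>1 Phat \<and> (\<forall>t\<in>{0..1}. \<mu> t = marginal Phat t))"

definition abs_continuous_fun :: "real \<Rightarrow> real \<Rightarrow> (real \<Rightarrow> real) \<Rightarrow> bool" where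
  "abs_continuous_fun l u f \<longleftrightarrow>
     (\<forall>\<epsilon>>0. \<exists>\<delta>>0. \<forall>(n::nat) a b.
        (\<forall>i<n. l \<le> a i \<and> a i \<le> b i \<and> b i \<le> u) \<and>
        (\<forall>i<n. \<forall>j<n. i \<noteq> j \<longrightarrow> {a i<..<b i} \<inter> {a j<..<b j} = {}) \<and>
        (\<Sum>i<n. b i - a i) < \<delta> \<longrightarrow>
        (\<Sum>i<n. \<bar>f (b i) - f (a i)\<bar>) < \<epsilon>)"

text \<open>
  The generalized derivative of an absolutely continuous function is the integrable function whose
  indefinite integral it is. Membership in the extensional function space makes equality of changes
  of time equality on \<open>[0,1]\<close>.
\<close>

definition change_of_time :: "(real \<Rightarrow> real) \<Rightarrow> bool" where
  "change_of_time \<tau> \<longleftrightarrow>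
     \<tau> \<in> {0..1} \<rightarrow>\<^sub>E {0..1} \<and> \<tau> 0 = 0 \<and> \<tau> 1 = 1 \<and>
     abs_continuous_fun 0 1 \<tau> \<and>
     (\<exists>g. set_integrable lborel {0..1} g \<and> (\<forall>t\<in>{0..1}. 0 \<le> g t) \<and>
        (\<forall>t\<in>{0..1}. \<tau> t = \<tau> 0 + (LBINT s:{0..t}. g s)))"

definition constant_speed ::
    "('a \<Rightarrow> 'a \<Rightarrow> real) \<Rightarrow> 'a measure \<Rightarrow> 'a measure \<Rightarrow> (real \<Rightarrow> 'a measure) \<Rightarrow> bool" where
  "constant_speed d \<mu>0 \<mu>1 \<nu> \<longleftrightarrow>
     (\<forall>s t. 0 \<le> s \<and> s \<le> t \<and> t \<le> 1 \<longrightarrow> W1 d (\<nu> s) (\<nu> t) = ennreal (t - s) * W1 d \<mu>0 \<mu>1)"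

end

theory Submission
  imports Defs
begin

text \<open>
  The Schrodinger minimizer \<open>P\<^sup>k\<close> has, on each set of paths from \<open>x\<close> to \<open>y\<close>, a constant density
  \<open>\<rho>\<^sup>k(x, y)\<close> with respect to \<open>R\<^sup>k\<close> (Jensen and uniqueness), and perturbing the mass of four such sets
  gives \<open>\<rho>\<^sup>k(x, y) \<rho>\<^sup>k(x', y') = \<rho>\<^sup>k(x, y') \<rho>\<^sup>k(x', y)\<close>. Since \<open>R\<^sup>k\<close> gives the set a mass of order \<open>k\<close> to
  the power \<open>- d(x, y)\<close>, this identity forces, as \<open>k\<close> tends to infinity, the endpoint coupling of the
  limit to be \<open>d\<close>-cyclically monotone; and comparing orders of magnitude, the limit random walk only
  follows geodesics. A Kantorovich potential of the endpoint coupling then increases along the walk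
  exactly by the distance travelled, so that \<open>W\<^sub>1(\<mu>\<^sub>s, \<mu>\<^sub>t)\<close> is the expected distance of \<open>X\<^sub>s\<close> and \<open>X\<^sub>t\<close>,
  which is additive in time. If \<open>\<psi>(t) = W\<^sub>1(\<mu>\<^sub>0, \<mu>\<^sub>t)\<close> is not identically zero, it is continuous (there
  are no fixed jump times) and, by a lower bound for the first jump of a geodesic bridge, its increments
  over \<open>[a, b]\<close> dominate a multiple of the integral of a jump rate \<open>J\<^sub>t(x, v) > 0\<close>, locally uniformly in
  \<open>[0, 1)\<close>. Hence \<open>\<psi>\<close> is strictly increasing and its inverse is absolutely continuous; the inverse,
  rescaled, is the only change of time with constant speed.
\<close>

section \<open>Inverting an increasing function\<close>

text \<open>Uniqueness is claimed for \<open>\<mu>0 \<noteq> \<mu>1\<close> only: if the ends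
  coincide, \<open>W1\<close> vanishes along the interpolation and every change of time has constant
  speed. All orders of magnitude need constants independent of \<open>k\<close>. From above,
  \<open>k powr d z v\<close> is a Lyapunov function of \<open>v\<close>: a jump from
  \<open>x\<close> to \<open>y\<close> multiplies it by at most \<open>k powr d x y\<close>, while
  the slowed rate carries the inverse factor. From below, the walk is made to follow one geodesic.
  Narrow convergence does not control the indicator of an event such as \<open>X t = x\<close>,
  which is not Skorokhod continuous. Estimates therefore pass to the limit through averages over a
  short time window, and right continuity removes the window. The measures \<open>R k\<close> may be
  infinite, so comparisons take place on the cells of paths with both ends fixed, which have finite
  mass. Absolute continuity of the inverse of \<psi> means that \<psi> maps no set of positive
  length to a null set; this is why a rate that is merely positive, with no positive lower bound, is
  enough.\<close>

lemma null_sets_if_intervals_dominated: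
  fixes \<alpha> :: "real measure"
  assumes [measurable_cong]: "sets \<alpha> = sets borel"
    and dom: "\<And>c d. c < d \<Longrightarrow> emeasure \<alpha> {c<..<d} \<le> ennreal (C * (d - c))"
    and N: "N \<in> null_sets lborel"
  shows "emeasure \<alpha> N = 0"
proof -
  define B where "B = max C 0"
  have B0: "0 \<le> B" by (simp add: B_def)
  have domB: "emeasure \<alpha> {c<..<d} \<le> ennreal (B * (d - c))" if "c < d" for c d
    by (rule order_trans[OF dom[OF that]]) (use that in \<open>auto simp: B_def intro!: ennreal_leI mult_right_mono\<close>)
  have point: "emeasure \<alpha> {x} = 0" for x
  proof -
    have "emeasure \<alpha> {x} \<le> 0 + ennreal e" if "0 < e" for e
    proof -
      \<comment> \<open>The \<open>+ 1\<close> covers the case \<open>B = 0\<close>.\<close>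
      define h where "h = e / (2 * (B + 1))"
      have h: "0 < h" using that B0 by (simp add: h_def)
      have "emeasure \<alpha> {x} \<le> emeasure \<alpha> {x - h<..<x + h}"
        by (rule emeasure_mono) (use h in auto)
      also have "\<dots> \<le> ennreal (B * (2 * h))" using domB[of "x - h" "x + h"] h by simp
      also have "\<dots> \<le> ennreal e"
      proof (rule ennreal_leI)
        have "B * (2 * h) = e * (B / (B + 1))" using B0 by (simp add: h_def divide_simps)
        also have "\<dots> \<le> e * 1" by (rule mult_left_mono) (use that B0 in auto)
        finally show "B * (2 * h) \<le> e" by simp
      qed
      finally show ?thesis by simp
    qed
    then have "emeasure \<alpha> {x} \<le> 0" by (rule ennreal_le_epsilon) auto
    then show ?thesis by simp
  qed
  have countable_null: "emeasure \<alpha> K = 0" if "countable K" for K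
  proof -
    have "K \<in> null_sets \<alpha>"
    proof -
      have "(\<Union>x\<in>K. {x}) \<in> null_sets \<alpha>"
        by (rule null_sets_UN') (use that point in \<open>auto simp: null_sets_def\<close>)
      then show ?thesis by simp
    qed
    then show ?thesis by auto
  qed
  \<comment> \<open>A bounded null set is covered by countably many nonoverlapping closed intervals
    of small total length. The hypothesis bounds the mass of their interiors; the endpoints left
    over are countable and carry no mass.\<close>
  have bounded: "emeasure \<alpha> (N \<inter> {-real n..real n}) = 0" for n :: nat
  proof -
    let ?S = "N \<inter> {-real n..real n}"
    have S: "?S \<in> null_sets lborel" using N by (intro null_set_Int2) auto
    then have Sb: "?S \<in> sets borel" by auto
    have nS: "?S \<in> null_sets lebesgue" using S null_sets_completionI by blast
    have lm: "?S \<in> lmeasurable" and m0: "measure lebesgue ?S = 0"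
      using nS by (auto simp: fmeasurable_def measure_eq_0_null_sets null_sets_def)
    have "emeasure \<alpha> ?S \<le> 0 + ennreal e" if "0 < e" for e
    proof -
      define \<delta> where "\<delta> = e / (B + 1)"
      have \<delta>: "0 < \<delta>" using that B0 by (simp add: \<delta>_def)
      have sub: "?S \<subseteq> cbox (- real n) (real n)" by auto
      obtain D where D: "countable D"
        "\<And>K. K \<in> D \<Longrightarrow> K \<subseteq> cbox (- real n) (real n) \<and> K \<noteq> {} \<and> (\<exists>c d. K = cbox c d)"
        "pairwise (\<lambda>A B. interior A \<inter> interior B = {}) D" "?S \<subseteq> \<Union> D"
        "\<Union> D \<in> lmeasurable" "measure lebesgue (\<Union> D) \<le> measure lebesgue ?S + \<delta>"
        using measurable_outer_intervals_bounded[OF lm sub \<delta>] by metis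
      have bd: "countable (K - interior K)" if K: "K \<in> D" for K
      proof -
        obtain c d where cd: "K = {c..d}" using D(2)[OF K] by (auto simp: box_real)
        then have "K - interior K \<subseteq> {c, d}" by auto
        then show ?thesis by (meson countable_finite countable_subset finite.intros)
      qed
      have iD[measurable]: "(\<Union>K\<in>D. interior K) \<in> sets borel" by (intro borel_open) auto
      have bD[measurable]: "(\<Union>K\<in>D. K - interior K) \<in> sets borel"
        by (rule sets.countable) (use D(1) bd in auto)
      have dj: "disjoint_family_on interior D"
        using D(3) by (auto simp: disjoint_family_on_def pairwise_def)
      have "?S \<subseteq> (\<Union>K\<in>D. interior K) \<union> (\<Union>K\<in>D. K - interior K)" using D(4) by auto
      then have "emeasure \<alpha> ?S \<le> emeasure \<alpha> ((\<Union>K\<in>D. interior K) \<union> (\<Union>K\<in>D. K - interior K))"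
        by (rule emeasure_mono) measurable
      also have "\<dots> \<le> emeasure \<alpha> (\<Union>K\<in>D. interior K) + emeasure \<alpha> (\<Union>K\<in>D. K - interior K)"
        by (rule emeasure_subadditive) measurable
      also have "emeasure \<alpha> (\<Union>K\<in>D. K - interior K) = 0"
        by (rule countable_null) (use D(1) bd in auto)
      also have "emeasure \<alpha> (\<Union>K\<in>D. interior K) = (\<integral>\<^sup>+K. emeasure \<alpha> (interior K) \<partial>count_space D)"
        by (rule emeasure_UN_countable) (use D(1) dj in auto)
      also have "\<dots> \<le> (\<integral>\<^sup>+K. ennreal B * emeasure lborel (interior K) \<partial>count_space D)"
      proof (rule nn_integral_mono)
        fix K assume "K \<in> space (count_space D)"
        then have "K \<in> D" by simp
        then obtain c d where cd: "K = {c..d}" "c \<le> d" using D(2)[of K] by (auto simp: box_real)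
        show "emeasure \<alpha> (interior K) \<le> ennreal B * emeasure lborel (interior K)"
          using domB[of c d] cd B0 by (cases "c = d") (auto simp: ennreal_mult')
      qed
      also have "\<dots> = ennreal B * (\<integral>\<^sup>+K. emeasure lborel (interior K) \<partial>count_space D)"
        by (rule nn_integral_cmult) auto
      also have "(\<integral>\<^sup>+K. emeasure lborel (interior K) \<partial>count_space D) = emeasure lborel (\<Union>K\<in>D. interior K)"
        by (rule emeasure_UN_countable[symmetric]) (use D(1) dj in auto)
      also have "\<dots> = emeasure lebesgue (\<Union>K\<in>D. interior K)"
        using iD by simp
      also have "\<dots> \<le> emeasure lebesgue (\<Union> D)"
        by (rule emeasure_mono) (use D(5) interior_subset in \<open>auto simp: fmeasurable_def\<close>)
      also have "\<dots> \<le> ennreal \<delta>"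
        using D(5,6) m0 by (simp add: emeasure_eq_measure2 ennreal_leI)
      finally have "emeasure \<alpha> ?S \<le> ennreal B * ennreal \<delta>" using B0 by (simp add: mult_left_mono)
      also have "\<dots> = ennreal (B * \<delta>)" using B0 by (simp add: ennreal_mult')
      also have "\<dots> \<le> ennreal e"
      proof (rule ennreal_leI)
        have "B * \<delta> = e * (B / (B + 1))" by (simp add: \<delta>_def)
        also have "\<dots> \<le> e * 1" by (rule mult_left_mono) (use that B0 in auto)
        finally show "B * \<delta> \<le> e" by simp
      qed
      finally show ?thesis by simp
    qed
    then have "emeasure \<alpha> ?S \<le> 0" by (rule ennreal_le_epsilon) auto
    then show ?thesis by simp
  qed
  have "N = (\<Union>n::nat. N \<inter> {-real n..real n})"
  proof (intro equalityI subsetI)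
    fix x assume "x \<in> N"
    moreover obtain n :: nat where "\<bar>x\<bar> \<le> real n" using real_arch_simple by blast
    ultimately show "x \<in> (\<Union>n::nat. N \<inter> {-real n..real n})" by (auto simp: abs_le_iff intro!: exI[of _ n])
  qed auto
  moreover have "(\<Union>n::nat. N \<inter> {-real n..real n}) \<in> null_sets \<alpha>"
    by (rule null_sets_UN) (use bounded N in \<open>auto simp: null_sets_def\<close>)
  ultimately show ?thesis by (metis null_setsD1)
qed

text \<open>Where \<open>g\<close> exceeds a high level \<open>n\<close>, its integral is below
  \<open>e / 2\<close>; elsewhere it contributes at most \<open>real n\<close> times the length of
  \<open>E\<close>. The absolute continuity of the inverse change of time takes its \<delta> from
  here.\<close>

lemma integral_uniformly_small:
  fixes g :: "real \<Rightarrow> real"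
  assumes g: "integrable lborel g" "\<And>x. 0 \<le> g x" and e: "0 < e"
  obtains \<delta> where "0 < \<delta>"
    "\<And>E. E \<in> sets borel \<Longrightarrow> emeasure lborel E < ennreal \<delta> \<Longrightarrow>
      emeasure (density lborel (\<lambda>x. ennreal (g x))) E < ennreal e"
proof -
  have [measurable]: "g \<in> borel_measurable borel" using g(1) by auto
  have "(\<lambda>n. \<integral>x. (if real n < g x then g x else 0) \<partial>lborel) \<longlonglongrightarrow> integral\<^sup>L lborel (\<lambda>x::real. 0)"
  proof (rule integral_dominated_convergence[of "\<lambda>_. 0" lborel _ g])
    show "AE x in lborel. (\<lambda>n. if real n < g x then g x else 0) \<longlonglongrightarrow> 0"
    proof (rule AE_I2)
      fix x
      obtain m :: nat where "g x \<le> real m" using real_arch_simple by blast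
      then show "(\<lambda>n. if real n < g x then g x else 0) \<longlonglongrightarrow> 0"
        by (intro tendsto_eventually eventually_sequentiallyI[of m]) force
    qed
  qed (use g in auto)
  then have "\<forall>\<^sub>F n in sequentially. (\<integral>x. (if real n < g x then g x else 0) \<partial>lborel) < e / 2"
    using e by (intro order_tendstoD) auto
  then obtain n :: nat where n: "(\<integral>x. (if real n < g x then g x else 0) \<partial>lborel) < e / 2"
    by (auto simp: eventually_sequentially)
  have int: "integrable lborel (\<lambda>x. if real n < g x then g x else 0)"
    by (rule Bochner_Integration.integrable_bound[OF g(1)]) (use g in auto)
  define \<delta> where "\<delta> = e / (2 * (real n + 1))"
  have \<delta>: "0 < \<delta>" using e by (simp add: \<delta>_def)
  have "emeasure (density lborel (\<lambda>x. ennreal (g x))) E < ennreal e"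
    if E: "E \<in> sets borel" "emeasure lborel E < ennreal \<delta>" for E
  proof -
    have [measurable]: "E \<in> sets borel" by fact
    have "emeasure (density lborel (\<lambda>x. ennreal (g x))) E = (\<integral>\<^sup>+x. ennreal (g x) * indicator E x \<partial>lborel)"
      by (simp add: emeasure_density)
    also have "\<dots> \<le> (\<integral>\<^sup>+x. ennreal (if real n < g x then g x else 0) + ennreal (real n) * indicator E x \<partial>lborel)"
      by (rule nn_integral_mono) (use g in \<open>auto split: split_indicator simp flip: ennreal_plus intro!: ennreal_leI\<close>)
    also have "\<dots> = (\<integral>\<^sup>+x. ennreal (if real n < g x then g x else 0) \<partial>lborel)
        + (\<integral>\<^sup>+x. ennreal (real n) * indicator E x \<partial>lborel)"
      by (rule nn_integral_add) auto
    also have "(\<integral>\<^sup>+x. ennreal (real n) * indicator E x \<partial>lborel) = ennreal (real n) * emeasure lborel E"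
      by (subst nn_integral_cmult_indicator) auto
    also have "(\<integral>\<^sup>+x. ennreal (if real n < g x then g x else 0) \<partial>lborel)
        = ennreal (\<integral>x. (if real n < g x then g x else 0) \<partial>lborel)"
      by (rule nn_integral_eq_integral[OF int]) (use g in auto)
    also have "ennreal (real n) * emeasure lborel E \<le> ennreal (real n) * ennreal \<delta>"
      using E by (intro mult_left_mono) auto
    also have "\<dots> = ennreal (real n * \<delta>)" by (simp add: ennreal_mult')
    also have "ennreal (\<integral>x. (if real n < g x then g x else 0) \<partial>lborel) + ennreal (real n * \<delta>)
       = ennreal ((\<integral>x. (if real n < g x then g x else 0) \<partial>lborel) + real n * \<delta>)"
      by (rule ennreal_plus[symmetric]) (use g \<delta> in \<open>auto intro!: integral_nonneg_AE\<close>)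
    also have "\<dots> < ennreal e"
    proof (rule ennreal_lessI[OF e])
      have "real n * \<delta> = e / 2 * (real n / (real n + 1))" by (simp add: \<delta>_def)
      also have "\<dots> \<le> e / 2 * 1" by (rule mult_left_mono) (use e in auto)
      finally show "(\<integral>x. (if real n < g x then g x else 0) \<partial>lborel) + real n * \<delta> < e" using n by simp
    qed
    finally show ?thesis by (simp add: add_left_mono)
  qed
  with \<delta> that show thesis by blast
qed

text \<open>The image \<nu> of Lebesgue measure on [0, 1] under \<Phi> has the inverse of \<Phi> as
  distribution function, so everything reduces to the absolute continuity of \<nu>, whose density is
  then the generalized derivative. By \<open>lower\<close>, \<Phi> grows at least like a measure
  with positive density, hence the image of that measure is dominated by length.\<close>

lemma inverse_change_of_time:
  fixes \<Phi> j :: "real \<Rightarrow> real"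
  assumes cont: "continuous_on {0..1} \<Phi>" and ends: "\<Phi> 0 = 0" "\<Phi> 1 = 1"
    and mono: "mono_on {0..1} \<Phi>"
    and j[measurable]: "j \<in> borel_measurable borel" and jpos: "\<And>t. 0 < j t"
    and lower: "\<And>\<eta>. 0 < \<eta> \<Longrightarrow> \<eta> < 1 \<Longrightarrow> \<exists>c>0. \<forall>a b. 0 \<le> a \<and> a \<le> b \<and> b \<le> 1 - \<eta> \<longrightarrow>
        ennreal c * emeasure (density lborel (\<lambda>t. ennreal (j t))) {a..b} \<le> ennreal (\<Phi> b - \<Phi> a)"
  shows "strict_mono_on {0..1} \<Phi>"
    and "\<exists>\<tau>. change_of_time \<tau> \<and> (\<forall>t\<in>{0..1}. \<Phi> (\<tau> t) = t)"
proof -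
  let ?\<kappa> = "density lborel (\<lambda>t. ennreal (j t))"
  have [simp]: "\<not> j t \<le> 0" for t using jpos[of t] by simp
  have \<kappa>_null: "E \<in> null_sets lborel" if "E \<in> sets borel" "emeasure ?\<kappa> E = 0" for E
  proof -
    have "E \<in> null_sets ?\<kappa>" using that by (auto simp: null_sets_def)
    then have "AE x\<in>E in lborel. ennreal (j x) = 0" by (subst (asm) null_sets_density_iff) auto
    then have "AE x in lborel. x \<notin> E" by eventually_elim (auto simp: ennreal_eq_0_iff)
    then show ?thesis using that(1) by (simp add: AE_iff_null_sets)
  qed
  have less: "\<Phi> a < \<Phi> b" if ab: "0 \<le> a" "a < b" "b < 1" for a b
  proof -
    obtain c where c: "c > 0" "ennreal c * emeasure ?\<kappa> {a..b} \<le> ennreal (\<Phi> b - \<Phi> a)"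
      using lower[of "1 - b"] ab by auto
    have "{a..b} \<notin> null_sets lborel" using ab by (auto simp: null_sets_def)
    then have "emeasure ?\<kappa> {a..b} \<noteq> 0" using \<kappa>_null by auto
    then have "ennreal c * emeasure ?\<kappa> {a..b} \<noteq> 0" using c(1) by auto
    then have "ennreal (\<Phi> b - \<Phi> a) \<noteq> 0" using c(2) by (metis le_zero_eq)
    then show ?thesis by (simp add: ennreal_eq_0_iff not_le)
  qed
  show sm: "strict_mono_on {0..1} \<Phi>"
  proof (rule strict_mono_onI)
    fix a b :: real assume ab: "a \<in> {0..1}" "b \<in> {0..1}" "a < b"
    show "\<Phi> a < \<Phi> b"
    proof (cases "b < 1")
      case False
      \<comment> \<open>Here \<open>b = 1\<close>, which \<open>lower\<close> does not reach: growth
        is strict up to the midpoint and monotonicity does the rest.\<close>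
      then have "\<Phi> a < \<Phi> ((a + b) / 2)" using ab by (intro less) auto
      also have "\<dots> \<le> \<Phi> b" using ab by (intro mono_onD[OF mono]) auto
      finally show ?thesis .
    qed (use ab less in auto)
  qed
  then have inj: "inj_on \<Phi> {0..1}" by (rule strict_mono_on_imp_inj_on)
  have range: "\<Phi> x \<in> {0..1}" if "x \<in> {0..1}" for x
    using mono_onD[OF mono, of 0 x] mono_onD[OF mono, of x 1] that ends by auto
  have img: "\<Phi> ` {0..1} = {0..1}"
  proof
    show "{0..1} \<subseteq> \<Phi> ` {0..1}"
      using IVT'[of \<Phi> 0 _ 1, OF _ _ _ cont] ends by (force simp: image_iff)
  qed (use range in auto)
  define \<tau> where "\<tau> t = (if t \<in> {0..1} then the_inv_into {0..1} \<Phi> t else undefined)" for t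
  have \<tau>: "\<Phi> (\<tau> t) = t" "\<tau> t \<in> {0..1}" if "t \<in> {0..1}" for t
    using that f_the_inv_into_f[OF inj, of t] the_inv_into_into[OF inj, of t "{0..1}"] img
    by (auto simp: \<tau>_def)
  have \<tau>\<Phi>: "\<tau> (\<Phi> s) = s" if "s \<in> {0..1}" for s
    using that range the_inv_into_f_f[OF inj that] by (auto simp: \<tau>_def)
  have le_iff: "\<Phi> s \<le> t \<longleftrightarrow> s \<le> \<tau> t" and ge_iff: "t \<le> \<Phi> s \<longleftrightarrow> \<tau> t \<le> s"
    and less_iff: "\<Phi> s < t \<longleftrightarrow> s < \<tau> t" and gr_iff: "t < \<Phi> s \<longleftrightarrow> \<tau> t < s"
    if "s \<in> {0..1}" "t \<in> {0..1}" for s t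
    using strict_mono_onD[OF sm, of s "\<tau> t"] strict_mono_onD[OF sm, of "\<tau> t" s] \<tau>[OF that(2)] that
    by (metis linorder_neqE_linordered_idom not_le order_le_less)+
  let ?M = "restrict_space lborel {0..1::real}"
  have [measurable]: "\<Phi> \<in> borel_measurable ?M"
    using borel_measurable_continuous_on_restrict[OF cont]
    by (simp cong: measurable_cong_sets add: sets_restrict_space)
  define \<nu> where "\<nu> = distr ?M borel \<Phi>"
  have sets_\<nu>[measurable_cong]: "sets \<nu> = sets borel" by (simp add: \<nu>_def)
  have em_\<nu>: "emeasure \<nu> B = emeasure lborel {s\<in>{0..1}. \<Phi> s \<in> B}" if [measurable]: "B \<in> sets borel" for B
  proof -
    have "emeasure \<nu> B = emeasure ?M (\<Phi> -` B \<inter> space ?M)"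
      unfolding \<nu>_def by (rule emeasure_distr) auto
    also have "\<Phi> -` B \<inter> space ?M = {s\<in>{0..1}. \<Phi> s \<in> B}" by (auto simp: space_restrict_space)
    also have "emeasure ?M \<dots> = emeasure lborel {s\<in>{0..1}. \<Phi> s \<in> B}"
      by (rule emeasure_restrict_space) auto
    finally show ?thesis .
  qed
  have total: "emeasure \<nu> UNIV = 1"
  proof -
    have "{s\<in>{0..1}. \<Phi> s \<in> UNIV} = {0..1}" by auto
    then show ?thesis using em_\<nu>[of UNIV] by simp
  qed
  have fin: "finite_measure \<nu>"
    by (rule finite_measureI) (simp add: total \<nu>_def[THEN arg_cong, of space])
  interpret \<nu>: finite_measure \<nu> by fact
  have ac: "absolutely_continuous lborel \<nu>"
    unfolding absolutely_continuous_def
  proof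
    fix N :: "real set" assume N: "N \<in> null_sets lborel"
    then have Nb[measurable]: "N \<in> sets borel" by auto
    have vim: "{s\<in>{0..1}. \<Phi> s \<in> B} \<in> sets borel" if [measurable]: "B \<in> sets borel" for B
    proof -
      have "\<Phi> -` B \<inter> space ?M \<in> sets ?M" by measurable
      moreover have "\<Phi> -` B \<inter> space ?M = {s\<in>{0..1}. \<Phi> s \<in> B}" by (auto simp: space_restrict_space)
      ultimately show ?thesis by (auto simp: sets_restrict_space)
    qed
    have small: "{s\<in>{0..1}. \<Phi> s \<in> N} \<inter> {0..1 - \<eta>} \<in> null_sets lborel" if \<eta>: "0 < \<eta>" "\<eta> < 1" for \<eta>
    proof -
      obtain c where c: "c > 0" "\<And>a b. 0 \<le> a \<Longrightarrow> a \<le> b \<Longrightarrow> b \<le> 1 - \<eta> \<Longrightarrow>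
          ennreal c * emeasure ?\<kappa> {a..b} \<le> ennreal (\<Phi> b - \<Phi> a)"
        using lower[OF \<eta>] by blast
      \<comment> \<open>On intervals this image is at most \<open>1 / c\<close> times the length, so
        it does not charge \<open>N\<close>. As \<open>j\<close> is positive, the part of the
        preimage of \<open>N\<close> in the window is then Lebesgue null as well.\<close>
      define \<alpha> where "\<alpha> = distr (restrict_space ?\<kappa> {0..1 - \<eta>}) borel \<Phi>"
      have cont': "continuous_on {0..1 - \<eta>} \<Phi>" by (rule continuous_on_subset[OF cont]) (use \<eta> in auto)
      have [measurable]: "\<Phi> \<in> borel_measurable (restrict_space ?\<kappa> {0..1 - \<eta>})"
        using borel_measurable_continuous_on_restrict[OF cont']
        by (simp cong: measurable_cong_sets add: sets_restrict_space)
      have em: "emeasure \<alpha> B = emeasure ?\<kappa> ({s\<in>{0..1}. \<Phi> s \<in> B} \<inter> {0..1 - \<eta>})" if [measurable]: "B \<in> sets borel" for B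
      proof -
        have "emeasure \<alpha> B = emeasure (restrict_space ?\<kappa> {0..1 - \<eta>}) (\<Phi> -` B \<inter> space (restrict_space ?\<kappa> {0..1 - \<eta>}))"
          unfolding \<alpha>_def by (rule emeasure_distr) auto
        also have "\<Phi> -` B \<inter> space (restrict_space ?\<kappa> {0..1 - \<eta>}) = {s\<in>{0..1}. \<Phi> s \<in> B} \<inter> {0..1 - \<eta>}"
          using \<eta> by (auto simp: space_restrict_space)
        also have "emeasure (restrict_space ?\<kappa> {0..1 - \<eta>}) \<dots> = emeasure ?\<kappa> ({s\<in>{0..1}. \<Phi> s \<in> B} \<inter> {0..1 - \<eta>})"
          by (rule emeasure_restrict_space) auto
        finally show ?thesis .
      qed
      have "emeasure \<alpha> N = 0"
      proof (rule null_sets_if_intervals_dominated[OF _ _ N, where C = "1 / c"])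
        fix p q :: real assume pq: "p < q"
        \<comment> \<open>The interval is cut to the range [0, 1] of \<Phi>, where \<tau> inverts
          it, and further down \<open>b\<close> is cut to the window in which \<open>lower\<close>
          is available.\<close>
        define p' where "p' = max p 0"
        define q' where "q' = min q 1"
        show "emeasure \<alpha> {p<..<q} \<le> ennreal (1 / c * (q - p))"
        proof (cases "p' \<le> q' \<and> \<tau> p' \<le> 1 - \<eta>")
          case True
          then have p': "p' \<in> {0..1}" "q' \<in> {0..1}" by (auto simp: p'_def q'_def)
          have t: "\<tau> p' \<le> \<tau> q'" using ge_iff[of "\<tau> q'" p'] \<tau> p' True by auto
          define b where "b = min (\<tau> q') (1 - \<eta>)"
          have b: "\<tau> p' \<le> b" "b \<le> 1 - \<eta>" "0 \<le> \<tau> p'" "b \<in> {0..1}"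
            using True t p' \<tau>[of p'] \<tau>[of q'] \<eta> by (auto simp: b_def)
          have "{s\<in>{0..1}. \<Phi> s \<in> {p<..<q}} \<inter> {0..1 - \<eta>} \<subseteq> {\<tau> p'..b}"
          proof
            fix s assume s: "s \<in> {s\<in>{0..1}. \<Phi> s \<in> {p<..<q}} \<inter> {0..1 - \<eta>}"
            then have "p' \<le> \<Phi> s" "\<Phi> s \<le> q'" using range[of s] by (auto simp: p'_def q'_def)
            then show "s \<in> {\<tau> p'..b}" using s ge_iff[of s p'] le_iff[of s q'] p' by (auto simp: b_def)
          qed
          then have "emeasure \<alpha> {p<..<q} \<le> emeasure ?\<kappa> {\<tau> p'..b}"
            by (subst em) (auto intro!: emeasure_mono)
          also have "\<dots> = ennreal (1 / c) * (ennreal c * emeasure ?\<kappa> {\<tau> p'..b})"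
            using c(1) by (simp add: mult.assoc[symmetric] ennreal_mult'[symmetric])
          also have "\<dots> \<le> ennreal (1 / c) * ennreal (\<Phi> b - \<Phi> (\<tau> p'))"
            by (intro mult_left_mono c(2)) (use b in auto)
          also have "\<dots> \<le> ennreal (1 / c) * ennreal (q - p)"
          proof (intro mult_left_mono ennreal_leI)
            have "\<Phi> b \<le> q'" using le_iff[OF b(4) p'(2)] by (simp add: b_def)
            moreover have "q' \<le> q" "p \<le> p'" by (auto simp: p'_def q'_def)
            ultimately show "\<Phi> b - \<Phi> (\<tau> p') \<le> q - p" using \<tau>[OF p'(1)] by linarith
          qed auto
          also have "\<dots> = ennreal (1 / c * (q - p))" using c(1) pq by (simp add: ennreal_mult'[symmetric])
          finally show ?thesis .
        next
          case False
          have "{s\<in>{0..1}. \<Phi> s \<in> {p<..<q}} \<inter> {0..1 - \<eta>} = {}"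
          proof (rule ccontr)
            assume "\<not> ?thesis"
            then obtain s where "s \<in> {s\<in>{0..1}. \<Phi> s \<in> {p<..<q}} \<inter> {0..1 - \<eta>}" by blast
            then have s: "s \<in> {0..1}" "p < \<Phi> s" "\<Phi> s < q" "s \<le> 1 - \<eta>" by auto
            have "p' \<le> \<Phi> s" "\<Phi> s \<le> q'" using range[OF s(1)] s by (auto simp: p'_def q'_def)
            moreover have "p' \<in> {0..1}" using calculation range[OF s(1)] by (auto simp: p'_def)
            ultimately show False using False ge_iff[OF s(1), of p'] s(4) by auto
          qed
          then show ?thesis by (subst em) auto
        qed
      qed (simp add: \<alpha>_def)
      then show ?thesis using vim[OF Nb] by (simp add: em[OF Nb] \<kappa>_null)
    qed
    \<comment> \<open>The windows exhaust [0, 1] except for the point 1, which is itself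
      null.\<close>
    have "{s\<in>{0..1}. \<Phi> s \<in> N} \<subseteq> (\<Union>n::nat. {s\<in>{0..1}. \<Phi> s \<in> N} \<inter> {0..1 - 1 / (real n + 2)}) \<union> {1}"
    proof
      fix s assume s: "s \<in> {s\<in>{0..1}. \<Phi> s \<in> N}"
      show "s \<in> (\<Union>n::nat. {s\<in>{0..1}. \<Phi> s \<in> N} \<inter> {0..1 - 1 / (real n + 2)}) \<union> {1}"
      proof (cases "s = 1")
        case False
        then have "0 < 1 - s" using s by auto
        then obtain n :: nat where n: "1 / (1 - s) < real n" using reals_Archimedean2 by blast
        have "1 / (real n + 2) \<le> 1 - s" using n \<open>0 < 1 - s\<close> by (simp add: field_simps)
        then have "s \<in> {0..1 - 1 / (real n + 2)}" using s by auto
        then show ?thesis using s by blast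
      qed auto
    qed
    moreover have "\<dots> \<in> null_sets lborel"
      by (intro null_sets.Un null_sets_UN small) (auto simp: null_sets_def field_simps)
    ultimately have "{s\<in>{0..1}. \<Phi> s \<in> N} \<in> null_sets lborel"
      by (rule null_sets_subset[rotated -1]) (use vim[OF Nb] in simp)
    then have "emeasure lborel {s\<in>{0..1}. \<Phi> s \<in> N} = 0" by auto
    then show "N \<in> null_sets \<nu>" by (auto simp: null_sets_def em_\<nu>)
  qed
  obtain D where D: "D \<in> borel_measurable lborel" "AE x in lborel. RN_deriv lborel \<nu> x = ennreal (D x)" "\<And>x. 0 \<le> D x"
    by (rule sigma_finite_measure.real_RN_deriv[OF lborel.sigma_finite_measure_axioms fin ac]) (auto simp: sets_\<nu>)
  have \<nu>D: "\<nu> = density lborel (\<lambda>x. ennreal (D x))"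
  proof -
    have "\<nu> = density lborel (RN_deriv lborel \<nu>)"
      using sigma_finite_measure.density_RN_deriv[OF lborel.sigma_finite_measure_axioms ac] sets_\<nu> by simp
    also have "\<dots> = density lborel (\<lambda>x. ennreal (D x))"
      by (rule density_cong) (use D in auto)
    finally show ?thesis .
  qed
  have intD: "integrable lborel D"
  proof (rule integrableI_nonneg)
    have "emeasure \<nu> UNIV = (\<integral>\<^sup>+x. ennreal (D x) \<partial>lborel)"
      unfolding \<nu>D using D by (subst emeasure_density) auto
    then show "(\<integral>\<^sup>+x. ennreal (D x) \<partial>lborel) < \<infinity>" using total by simp
  qed (use D in auto)
  have \<nu>_interval: "emeasure \<nu> {a..b} = ennreal (\<tau> b - \<tau> a)" "emeasure \<nu> {a<..<b} = ennreal (\<tau> b - \<tau> a)"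
    if "0 \<le> a" "a \<le> b" "b \<le> 1" for a b
  proof -
    have ab: "a \<in> {0..1}" "b \<in> {0..1}" using that by auto
    have t: "\<tau> a \<le> \<tau> b" using ge_iff[of "\<tau> b" a] \<tau> ab that by auto
    have "{s \<in> {0..1}. \<Phi> s \<in> {a..b}} = {\<tau> a..\<tau> b}"
      using \<tau>(2)[OF ab(1)] \<tau>(2)[OF ab(2)] ge_iff[OF _ ab(1)] le_iff[OF _ ab(2)] by force
    then show "emeasure \<nu> {a..b} = ennreal (\<tau> b - \<tau> a)" using t by (subst em_\<nu>) auto
    have "{s \<in> {0..1}. \<Phi> s \<in> {a<..<b}} = {\<tau> a<..<\<tau> b}"
      using \<tau>(2)[OF ab(1)] \<tau>(2)[OF ab(2)] gr_iff[OF _ ab(1)] less_iff[OF _ ab(2)] by force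
    then show "emeasure \<nu> {a<..<b} = ennreal (\<tau> b - \<tau> a)" using t by (subst em_\<nu>) auto
  qed
  have \<tau>0: "\<tau> 0 = 0" and \<tau>1: "\<tau> 1 = 1" using \<tau>\<Phi>[of 0] \<tau>\<Phi>[of 1] ends by auto
  have mono_\<tau>: "\<tau> a \<le> \<tau> b" if "0 \<le> a" "a \<le> b" "b \<le> 1" for a b
    using ge_iff[of "\<tau> b" a] \<tau>[of b] that by auto
  have "change_of_time \<tau>"
    unfolding change_of_time_def
  proof (intro conjI exI[of _ D])
    show "\<tau> \<in> {0..1} \<rightarrow>\<^sub>E {0..1}"
      using \<tau>(2) by (auto simp: \<tau>_def PiE_def extensional_def)
    show "abs_continuous_fun 0 1 \<tau>"
      unfolding abs_continuous_fun_def
    proof (intro allI impI)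
      fix e :: real assume e: "0 < e"
      obtain \<delta> where \<delta>: "0 < \<delta>" "\<And>E. E \<in> sets borel \<Longrightarrow> emeasure lborel E < ennreal \<delta> \<Longrightarrow> emeasure \<nu> E < ennreal e"
        using integral_uniformly_small[OF intD D(3) e] unfolding \<nu>D by metis
      show "\<exists>\<delta>>0. \<forall>(n::nat) a b. (\<forall>i<n. 0 \<le> a i \<and> a i \<le> b i \<and> b i \<le> 1) \<and>
         (\<forall>i<n. \<forall>j<n. i \<noteq> j \<longrightarrow> {a i<..<b i} \<inter> {a j<..<b j} = {}) \<and> (\<Sum>i<n. b i - a i) < \<delta> \<longrightarrow>
         (\<Sum>i<n. \<bar>\<tau> (b i) - \<tau> (a i)\<bar>) < e"
      proof (intro exI[of _ \<delta>] conjI allI impI; (elim conjE)?)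
        fix n :: nat and a b :: "nat \<Rightarrow> real"
        assume ab: "\<forall>i<n. 0 \<le> a i \<and> a i \<le> b i \<and> b i \<le> 1"
          and dj: "\<forall>i<n. \<forall>j<n. i \<noteq> j \<longrightarrow> {a i<..<b i} \<inter> {a j<..<b j} = {}"
          and s: "(\<Sum>i<n. b i - a i) < \<delta>"
        have djf: "disjoint_family_on (\<lambda>i. {a i<..<b i}) {..<n}"
          using dj by (auto simp: disjoint_family_on_def)
        have "emeasure lborel (\<Union>i<n. {a i<..<b i}) = (\<Sum>i<n. emeasure lborel {a i<..<b i})"
          by (rule sum_emeasure[symmetric]) (use djf in auto)
        also have "\<dots> = (\<Sum>i<n. ennreal (b i - a i))" using ab by (intro sum.cong) auto
        also have "\<dots> = ennreal (\<Sum>i<n. b i - a i)" using ab by (intro sum_ennreal) auto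
        also have "\<dots> < ennreal \<delta>" using s \<delta>(1) by (intro ennreal_lessI)
        finally have "emeasure \<nu> (\<Union>i<n. {a i<..<b i}) < ennreal e" by (intro \<delta>(2)) auto
        also have "emeasure \<nu> (\<Union>i<n. {a i<..<b i}) = (\<Sum>i<n. emeasure \<nu> {a i<..<b i})"
          by (rule sum_emeasure[symmetric]) (use djf in auto)
        also have "\<dots> = (\<Sum>i<n. ennreal (\<tau> (b i) - \<tau> (a i)))"
          using ab by (intro sum.cong \<nu>_interval) auto
        also have "\<dots> = ennreal (\<Sum>i<n. \<tau> (b i) - \<tau> (a i))"
          using ab mono_\<tau> by (intro sum_ennreal) auto
        also have "(\<Sum>i<n. \<tau> (b i) - \<tau> (a i)) = (\<Sum>i<n. \<bar>\<tau> (b i) - \<tau> (a i)\<bar>)"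
          using ab mono_\<tau> by (intro sum.cong) auto
        finally show "(\<Sum>i<n. \<bar>\<tau> (b i) - \<tau> (a i)\<bar>) < e"
          by (subst (asm) ennreal_less_iff) (auto intro!: sum_nonneg)
      qed (fact \<delta>(1))
    qed
    show "set_integrable lborel {0..1} D"
      using integrable_mult_indicator[OF _ intD, of "{0..1}"] by (auto simp: set_integrable_def)
    show "\<forall>t\<in>{0..1}. \<tau> t = \<tau> 0 + (LBINT s:{0..t}. D s)"
    proof
      fix t :: real assume t: "t \<in> {0..1}"
      have i: "integrable lborel (\<lambda>s. indicator {0..t} s *\<^sub>R D s)"
        by (rule integrable_mult_indicator) (use intD in auto)
      have "ennreal (\<tau> t) = emeasure \<nu> {0..t}" using \<nu>_interval(1)[of 0 t] \<tau>0 t by simp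
      also have "\<dots> = (\<integral>\<^sup>+s. ennreal (D s) * indicator {0..t} s \<partial>lborel)"
        unfolding \<nu>D using D(1) by (subst emeasure_density) auto
      also have "\<dots> = (\<integral>\<^sup>+s. ennreal (indicator {0..t} s *\<^sub>R D s) \<partial>lborel)"
        by (rule nn_integral_cong) (auto split: split_indicator)
      also have "\<dots> = ennreal (LBINT s:{0..t}. D s)"
        unfolding set_lebesgue_integral_def by (rule nn_integral_eq_integral[OF i]) (use D(3) in auto)
      finally show "\<tau> t = \<tau> 0 + (LBINT s:{0..t}. D s)"
        using \<tau>(2)[OF t] D(3) \<tau>0
        by (subst (asm) ennreal_inj) (auto simp: set_lebesgue_integral_def intro!: integral_nonneg_AE)
    qed
  qed (use \<tau>0 \<tau>1 D(3) in auto)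
  then show "\<exists>\<tau>. change_of_time \<tau> \<and> (\<forall>t\<in>{0..1}. \<Phi> (\<tau> t) = t)" using \<tau> by blast
qed

section \<open>Relative entropy of densities\<close>

lemma rel_entropy_bounded_density:
  assumes r: "sigma_finite_measure r" and \<rho>[measurable]: "\<rho> \<in> borel_measurable r"
    and \<rho>0: "\<And>x. 0 \<le> \<rho> x" and p: "p = density r (\<lambda>x. ennreal (\<rho> x))"
  shows "rel_entropy_bounded p r =
    (if integrable p (\<lambda>x. ln (\<rho> x)) then ereal (\<integral>x. ln (\<rho> x) \<partial>p) else \<infinity>)"
proof -
  interpret r: sigma_finite_measure r by fact
  have [measurable_cong]: "sets p = sets r" by (simp add: p)
  have ac: "absolutely_continuous r p" unfolding p by (rule absolutely_continuousI_density) measurable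
  have "AE x in r. ennreal (\<rho> x) = RN_deriv r p x"
    by (rule r.RN_deriv_unique) (auto simp: p)
  then have "AE x in r. entropy_density (exp 1) r p x = ln (\<rho> x)"
  proof eventually_elim
    case (elim x)
    then show ?case using \<rho>0[of x] by (simp add: entropy_density_def log_def flip: elim)
  qed
  then have eq: "AE x in p. entropy_density (exp 1) r p x = ln (\<rho> x)"
    unfolding p by (subst AE_density) (auto elim: eventually_mono)
  have [measurable]: "entropy_density (exp 1) r p \<in> borel_measurable r"
    unfolding entropy_density_def comp_def by measurable
  have i: "integrable p (entropy_density (exp 1) r p) \<longleftrightarrow> integrable p (\<lambda>x. ln (\<rho> x))"
    by (rule integrable_cong_AE) (use eq in \<open>auto\<close>)
  have "KL_divergence (exp 1) r p = (\<integral>x. ln (\<rho> x) \<partial>p)"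
    unfolding KL_divergence_def by (rule integral_cong_AE) (use eq in auto)
  with i ac show ?thesis by (simp add: rel_entropy_bounded_def)
qed

text \<open>The normalizing constant is positive because \<open>r\<close> dominates the probability
  measure \<open>p\<close> and so cannot vanish.\<close>

lemma entropy_weight_reference:
  assumes p: "prob_space p" "p = density r (\<lambda>x. ennreal (\<rho> x))" and \<rho>[measurable]: "\<rho> \<in> borel_measurable r"
    and W: "entropy_weight p r W"
  defines "z \<equiv> \<integral>x. exp (- W x) \<partial>r"
  shows "0 < z" and "sigma_finite_measure (density r (\<lambda>x. ennreal (exp (- W x) / z)))"
proof -
  have [measurable]: "W \<in> borel_measurable r" and int: "integrable r (\<lambda>x. exp (- W x))"
    using W by (auto simp: entropy_weight_def)
  show z: "0 < z"
  proof -
    have "z \<noteq> 0"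
    proof
      assume "z = 0"
      then have "AE x in r. exp (- W x) = 0"
        unfolding z_def by (subst (asm) integral_nonneg_eq_0_iff_AE[OF int]) auto
      then have "AE x in r. False" by eventually_elim simp
      then have "AE x in p. False" unfolding p(2) by (subst AE_density) auto
      then show False using prob_space.AE_const[OF p(1), of False] by simp
    qed
    moreover have "0 \<le> z" unfolding z_def by (rule integral_nonneg_AE) auto
    ultimately show ?thesis by simp
  qed
  have "finite_measure (density r (\<lambda>x. ennreal (exp (- W x) / z)))"
  proof (rule finite_measureI)
    have "emeasure (density r (\<lambda>x. ennreal (exp (- W x) / z))) (space r) = (\<integral>\<^sup>+x. ennreal (exp (- W x) / z) \<partial>r)"
      by (subst emeasure_density) (auto intro!: nn_integral_cong)
    also have "\<dots> = ennreal (\<integral>x. exp (- W x) / z \<partial>r)"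
      by (rule nn_integral_eq_integral) (use int z in auto)
    finally show "emeasure (density r (\<lambda>x. ennreal (exp (- W x) / z)))
       (space (density r (\<lambda>x. ennreal (exp (- W x) / z)))) \<noteq> \<infinity>" by simp
  qed
  then show "sigma_finite_measure (density r (\<lambda>x. ennreal (exp (- W x) / z)))"
    by (simp add: finite_measure_def)
qed

text \<open>Passing to the weighted reference multiplies the density by
  \<open>z * exp (W x)\<close>, so its logarithm gains the integrable term
  \<open>ln z + W x\<close>, which is what the definition subtracts again. The value is thus free of
  the weight that \<open>SOME\<close> selects.\<close>

lemma rel_entropy_density:
  assumes r: "sigma_finite_measure r" and \<rho>[measurable]: "\<rho> \<in> borel_measurable r"
    and \<rho>0: "\<And>x. 0 \<le> \<rho> x" and p: "p = density r (\<lambda>x. ennreal (\<rho> x))" "prob_space p"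
    and weight: "emeasure r (space r) < \<infinity> \<or> (\<exists>W. entropy_weight p r W)"
  shows "rel_entropy p r =
    (if integrable p (\<lambda>x. ln (\<rho> x)) then ereal (\<integral>x. ln (\<rho> x) \<partial>p) else \<infinity>)"
proof (cases "emeasure r (space r) < \<infinity>")
  case True
  then show ?thesis using rel_entropy_bounded_density[OF r \<rho> \<rho>0 p(1)] by (simp add: rel_entropy_def)
next
  case False
  define W where "W = (SOME W. entropy_weight p r W)"
  have W: "entropy_weight p r W" unfolding W_def by (rule someI_ex[of "entropy_weight p r"]) (use weight False in auto)
  then have [measurable]: "W \<in> borel_measurable r" and Wp: "integrable p W" by (auto simp: entropy_weight_def)
  define z where "z = (\<integral>x. exp (- W x) \<partial>r)"
  note z = entropy_weight_reference[OF p(2,1) \<rho> W, folded z_def]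
  interpret p: prob_space p by fact
  let ?r = "density r (\<lambda>x. ennreal (exp (- W x) / z))"
  let ?\<rho> = "\<lambda>x. \<rho> x * z * exp (W x)"
  have [measurable_cong]: "sets p = sets r" by (simp add: p)
  have p': "p = density ?r (\<lambda>x. ennreal (?\<rho> x))"
    by (subst density_density_eq)
      (use z(1) \<rho>0 in \<open>auto simp: p(1) ennreal_mult'[symmetric] exp_minus field_simps intro!: arg_cong2[where f=density]\<close>)
  have b: "rel_entropy_bounded p ?r =
    (if integrable p (\<lambda>x. ln (?\<rho> x)) then ereal (\<integral>x. ln (?\<rho> x) \<partial>p) else \<infinity>)"
    by (rule rel_entropy_bounded_density[OF z(2) _ _ p']) (use z(1) \<rho>0 in auto)
  have "AE x in p. 0 < \<rho> x" unfolding p(1) by (subst AE_density) auto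
  then have eq: "AE x in p. ln (?\<rho> x) = ln (\<rho> x) + (ln z + W x)"
    by eventually_elim (use z(1) in \<open>simp add: ln_mult\<close>)
  have Wz: "integrable p (\<lambda>x. ln z + W x)" using Wp by simp
  have i: "integrable p (\<lambda>x. ln (?\<rho> x)) \<longleftrightarrow> integrable p (\<lambda>x. ln (\<rho> x))"
  proof -
    have "integrable p (\<lambda>x. ln (?\<rho> x)) \<longleftrightarrow> integrable p (\<lambda>x. ln (\<rho> x) + (ln z + W x))"
      by (rule integrable_cong_AE) (use eq in auto)
    also have "\<dots> \<longleftrightarrow> integrable p (\<lambda>x. ln (\<rho> x))"
    proof
      assume "integrable p (\<lambda>x. ln (\<rho> x) + (ln z + W x))"
      from Bochner_Integration.integrable_diff[OF this Wz] show "integrable p (\<lambda>x. ln (\<rho> x))" by simp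
    qed (rule Bochner_Integration.integrable_add[OF _ Wz])
    finally show ?thesis .
  qed
  have v: "(\<integral>x. ln (?\<rho> x) \<partial>p) = (\<integral>x. ln (\<rho> x) \<partial>p) + ln z + (\<integral>x. W x \<partial>p)" if "integrable p (\<lambda>x. ln (\<rho> x))"
  proof -
    have "(\<integral>x. ln (?\<rho> x) \<partial>p) = (\<integral>x. ln (\<rho> x) + (ln z + W x) \<partial>p)"
      by (rule integral_cong_AE) (use eq in auto)
    also have "\<dots> = (\<integral>x. ln (\<rho> x) \<partial>p) + (\<integral>x. ln z + W x \<partial>p)"
      by (rule Bochner_Integration.integral_add[OF that Wz])
    also have "(\<integral>x. ln z + W x \<partial>p) = ln z + (\<integral>x. W x \<partial>p)"
      using Wp p.prob_space by (subst Bochner_Integration.integral_add) auto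
    finally show ?thesis by simp
  qed
  have "rel_entropy p r = rel_entropy_weighted p r W"
    using False weight by (auto simp: rel_entropy_def W_def)
  also have "\<dots> = rel_entropy_bounded p ?r - ereal (\<integral>x. W x \<partial>p) - ereal (ln z)"
    by (simp add: rel_entropy_weighted_def z_def Let_def)
  finally show ?thesis using b i v by simp
qed

lemma rel_entropy_finiteE:
  assumes r: "sigma_finite_measure r" and p: "prob_space p" "sets p = sets r"
    and fin: "rel_entropy p r \<noteq> \<infinity>"
  obtains \<rho> where "\<rho> \<in> borel_measurable r" "\<And>x. 0 \<le> \<rho> x" "p = density r (\<lambda>x. ennreal (\<rho> x))"
    "emeasure r (space r) < \<infinity> \<or> (\<exists>W. entropy_weight p r W)" "integrable p (\<lambda>x. ln (\<rho> x))"
proof -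
  interpret p: prob_space p by fact
  have weight: "emeasure r (space r) < \<infinity> \<or> (\<exists>W. entropy_weight p r W)"
    using fin by (auto simp: rel_entropy_def split: if_splits)
  have ac: "absolutely_continuous r p"
  proof (cases "emeasure r (space r) < \<infinity>")
    case True
    then show ?thesis using fin by (auto simp: rel_entropy_def rel_entropy_bounded_def split: if_splits)
  next
    case False
    define W where "W = (SOME W. entropy_weight p r W)"
    have W: "entropy_weight p r W" unfolding W_def by (rule someI_ex[of "entropy_weight p r"]) (use weight False in auto)
    define z where "z = (\<integral>x. exp (- W x) \<partial>r)"
    let ?r = "density r (\<lambda>x. ennreal (exp (- W x) / z))"
    have [measurable]: "W \<in> borel_measurable r" using W by (auto simp: entropy_weight_def)
    have "rel_entropy p r = rel_entropy_bounded p ?r - ereal (\<integral>x. W x \<partial>p) - ereal (ln z)"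
      using False weight by (auto simp: rel_entropy_def W_def rel_entropy_weighted_def z_def Let_def)
    then have "rel_entropy_bounded p ?r \<noteq> \<infinity>" using fin by auto
    then have "absolutely_continuous ?r p" by (auto simp: rel_entropy_bounded_def split: if_splits)
    moreover have "absolutely_continuous r ?r" by (rule absolutely_continuousI_density) measurable
    ultimately show ?thesis by (auto simp: absolutely_continuous_def)
  qed
  obtain D where D: "D \<in> borel_measurable r" "AE x in r. RN_deriv r p x = ennreal (D x)" "\<And>x. 0 \<le> D x"
    by (rule sigma_finite_measure.real_RN_deriv[OF r p.finite_measure_axioms ac p(2)]) auto
  have pD: "p = density r (\<lambda>x. ennreal (D x))"
  proof -
    have "p = density r (RN_deriv r p)"
      using sigma_finite_measure.density_RN_deriv[OF r ac p(2)] by simp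
    also have "\<dots> = density r (\<lambda>x. ennreal (D x))"
      by (rule density_cong) (use D in auto)
    finally show ?thesis .
  qed
  have "integrable p (\<lambda>x. ln (D x))"
    using rel_entropy_density[OF r D(1,3) pD p(1) weight] fin by (auto split: if_splits)
  with that D pD weight show thesis by blast
qed

text \<open>A crude bound that makes \<open>g * ln g\<close> integrable on a set of finite mass as
  soon as \<open>g\<close> is bounded.\<close>

lemma abs_mult_ln_le: "\<bar>t * ln t\<bar> \<le> 1 + t\<^sup>2" if "0 \<le> t" for t :: real
proof (cases "t = 0 \<or> t \<ge> 1")
  case True
  then show ?thesis
  proof
    assume t: "t \<ge> 1"
    then have "t * ln t \<le> t * t" using ln_le_minus_one[of t] by (intro mult_left_mono) auto
    moreover have "0 \<le> t * ln t" using t by simp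
    ultimately show ?thesis by (simp add: power2_eq_square)
  qed auto
next
  case False
  then have t: "0 < t" "t < 1" using that by auto
  have "ln (1 / t) \<le> 1 / t - 1" using t by (intro ln_le_minus_one) auto
  then have "t * (- ln t) \<le> t * (1 / t - 1)" using t by (intro mult_left_mono) (auto simp: ln_div)
  then have "- (t * ln t) \<le> 1" using t by (simp add: algebra_simps)
  moreover have "t * ln t \<le> 0" using t by (simp add: mult_nonneg_nonpos)
  ultimately have "\<bar>t * ln t\<bar> \<le> 1" by linarith
  then show ?thesis using zero_le_power2[of t] by linarith
qed

text \<open>For comparing a minimizer with a competitor that differs from it on a set
  \<open>C\<close> of finite mass: both entropies are finite and differ by an integral over
  \<open>C\<close> alone.\<close>

lemma rel_entropy_replace_density:
  assumes r: "sigma_finite_measure r" and \<rho>[measurable]: "\<rho> \<in> borel_measurable r"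
    and \<rho>0: "\<And>x. 0 \<le> \<rho> x" and p: "p = density r (\<lambda>x. ennreal (\<rho> x))" "prob_space p"
    and weight: "emeasure r (space r) < \<infinity> \<or> (\<exists>W. entropy_weight p r W)"
    and int: "integrable p (\<lambda>x. ln (\<rho> x))"
    and C[measurable]: "C \<in> sets r" and finC: "emeasure r C < \<infinity>"
    and g[measurable]: "g \<in> borel_measurable r" and gB: "\<And>x. 0 \<le> g x" "\<And>x. g x \<le> B"
    and p': "p' = density r (\<lambda>x. ennreal (if x \<in> C then g x else \<rho> x))" "prob_space p'"
  shows "rel_entropy p r = ereal (\<integral>x. ln (\<rho> x) \<partial>p)"
    and "set_integrable r C (\<lambda>x. \<rho> x * ln (\<rho> x))"
    and "rel_entropy p' r = ereal ((\<integral>x. ln (\<rho> x) \<partial>p)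
        - (LINT x:C|r. \<rho> x * ln (\<rho> x)) + (LINT x:C|r. g x * ln (g x)))"
proof -
  let ?\<rho> = "\<lambda>x. if x \<in> C then g x else \<rho> x"
  show "rel_entropy p r = ereal (\<integral>x. ln (\<rho> x) \<partial>p)"
    using rel_entropy_density[OF r \<rho> \<rho>0 p weight] int by simp
  have i\<rho>: "integrable r (\<lambda>x. \<rho> x * ln (\<rho> x))"
    using int unfolding p(1) by (subst (asm) integrable_density) (use \<rho>0 in auto)
  have iC: "integrable r (\<lambda>x. indicator C x *\<^sub>R (\<rho> x * ln (\<rho> x)))"
    by (rule integrable_mult_indicator[OF C i\<rho>])
  then show "set_integrable r C (\<lambda>x. \<rho> x * ln (\<rho> x))" by (simp add: set_integrable_def)
  have ig: "integrable r (\<lambda>x. indicator C x *\<^sub>R (g x * ln (g x)))"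
  proof (rule Bochner_Integration.integrable_bound)
    show "integrable r (\<lambda>x. indicator C x *\<^sub>R (1 + B\<^sup>2))"
      by (rule integrable_scaleR_left) (use finC in \<open>auto simp: integrable_indicator_iff\<close>)
    have "\<bar>g x * ln (g x)\<bar> \<le> 1 + B\<^sup>2" for x
      by (rule order_trans[OF abs_mult_ln_le[OF gB(1)]]) (use gB[of x] in \<open>simp add: power_mono\<close>)
    then show "AE x in r. norm (indicator C x *\<^sub>R (g x * ln (g x))) \<le> norm (indicator C x *\<^sub>R (1 + B\<^sup>2))"
      by (auto split: split_indicator intro!: AE_I2 intro: order_trans)
  qed measurable
  have eq: "?\<rho> x * ln (?\<rho> x) = \<rho> x * ln (\<rho> x) - indicator C x *\<^sub>R (\<rho> x * ln (\<rho> x)) + indicator C x *\<^sub>R (g x * ln (g x))" for x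
    by (auto split: split_indicator)
  have i': "integrable r (\<lambda>x. ?\<rho> x * ln (?\<rho> x))"
    unfolding eq using i\<rho> iC ig by (intro Bochner_Integration.integrable_add Bochner_Integration.integrable_diff)
  have int': "integrable p' (\<lambda>x. ln (?\<rho> x))"
    unfolding p'(1) by (subst integrable_density) (use \<rho>0 gB i' in auto)
  have weight': "emeasure r (space r) < \<infinity> \<or> (\<exists>W. entropy_weight p' r W)"
    using weight
  proof
    assume "\<exists>W. entropy_weight p r W"
    then obtain W where W: "entropy_weight p r W" by blast
    then have [measurable]: "W \<in> borel_measurable r" and W0: "\<And>x. x \<in> space r \<Longrightarrow> 0 \<le> W x"
      and Wp: "integrable p W" and We: "integrable r (\<lambda>x. exp (- W x))"
      by (auto simp: entropy_weight_def)
    \<comment> \<open>A weight for \<open>p\<close> becomes one for \<open>p'\<close> when it is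
      switched off on \<open>C\<close>: there it costs nothing under \<open>p'\<close>, and
      \<open>exp (- W)\<close> grows by at most the finite mass of \<open>C\<close>.\<close>
    let ?W = "\<lambda>x. if x \<in> C then 0 else W x"
    have "entropy_weight p' r ?W"
      unfolding entropy_weight_def
    proof (intro conjI)
      have iW: "integrable r (\<lambda>x. \<rho> x * W x)"
        using Wp unfolding p(1) by (subst (asm) integrable_density) (use \<rho>0 in auto)
      have "integrable r (\<lambda>x. ?\<rho> x * ?W x)"
        by (rule Bochner_Integration.integrable_bound[OF iW]) auto
      then show "integrable p' ?W"
        unfolding p'(1) by (subst integrable_density) (use \<rho>0 gB in auto)
      have "integrable r (\<lambda>x. exp (- W x) + indicator C x)"
        using We finC by (intro Bochner_Integration.integrable_add) (auto simp: integrable_indicator_iff)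
      then show "integrable r (\<lambda>x. exp (- ?W x))"
        by (rule Bochner_Integration.integrable_bound) (auto split: split_indicator)
    qed (use W0 in auto)
    then show ?thesis by blast
  qed auto
  have "rel_entropy p' r = ereal (\<integral>x. ln (?\<rho> x) \<partial>p')"
    using rel_entropy_density[OF r _ _ p' weight'] int' \<rho>0 gB by simp
  also have "(\<integral>x. ln (?\<rho> x) \<partial>p') = (\<integral>x. ?\<rho> x * ln (?\<rho> x) \<partial>r)"
    unfolding p'(1) by (subst integral_density) (use \<rho>0 gB in auto)
  also have "\<dots> = (\<integral>x. \<rho> x * ln (\<rho> x) \<partial>r) - (LINT x:C|r. \<rho> x * ln (\<rho> x)) + (LINT x:C|r. g x * ln (g x))"
    unfolding eq set_lebesgue_integral_def using i\<rho> iC ig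
    by (subst Bochner_Integration.integral_add, simp, simp, subst Bochner_Integration.integral_diff) auto
  also have "(\<integral>x. \<rho> x * ln (\<rho> x) \<partial>r) = (\<integral>x. ln (\<rho> x) \<partial>p)"
    unfolding p(1) by (subst integral_density) (use \<rho>0 in auto)
  finally show "rel_entropy p' r = ereal ((\<integral>x. ln (\<rho> x) \<partial>p)
        - (LINT x:C|r. \<rho> x * ln (\<rho> x)) + (LINT x:C|r. g x * ln (g x)))" .
qed

section \<open>Paths and geodesics\<close>

lemma left_limI:
  fixes t :: real
  assumes "eventually (\<lambda>s. \<omega> s = x) (at_left t)"
  shows "left_lim \<omega> t = x"
  unfolding left_lim_def
proof (rule the_equality)
  fix y assume "eventually (\<lambda>s. \<omega> s = y) (at_left t)"
  with assms have "eventually (\<lambda>s. y = x) (at_left t)" by eventually_elim simp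
  then show "y = x" by simp
qed (fact assms)

lemma left_lim_cong:
  assumes "eventually (\<lambda>s. \<omega> s = \<omega>' s) (at_left t)"
  shows "left_lim \<omega> t = left_lim \<omega>' t"
proof -
  have "eventually (\<lambda>s. \<omega> s = x) (at_left t) \<longleftrightarrow> eventually (\<lambda>s. \<omega>' s = x) (at_left t)" for x
    by (rule eventually_cong[OF assms]) auto
  then show ?thesis by (simp add: left_lim_def)
qed

lemma pathD:
  assumes "\<omega> \<in> paths adj"
  shows "0 \<le> t \<Longrightarrow> t < 1 \<Longrightarrow> eventually (\<lambda>s. \<omega> s = \<omega> t) (at_right t)"
    and "0 < t \<Longrightarrow> t \<le> 1 \<Longrightarrow> eventually (\<lambda>s. \<omega> s = left_lim \<omega> t) (at_left t)"
    and "left_lim \<omega> 1 = \<omega> 1"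
    and "finite (jump_times \<omega>)"
    and "t \<in> jump_times \<omega> \<Longrightarrow> adj (left_lim \<omega> t) (\<omega> t)"
    and "t \<notin> {0..1} \<Longrightarrow> \<omega> t = undefined"
proof -
  show "0 < t \<Longrightarrow> t \<le> 1 \<Longrightarrow> eventually (\<lambda>s. \<omega> s = left_lim \<omega> t) (at_left t)"
  proof -
    assume "0 < t" "t \<le> 1"
    then have "\<exists>x. eventually (\<lambda>s. \<omega> s = x) (at_left t)" using assms by (simp add: paths_def)
    then obtain x where x: "eventually (\<lambda>s. \<omega> s = x) (at_left t)" ..
    with left_limI[OF x] show ?thesis by simp
  qed
  show "left_lim \<omega> 1 = \<omega> 1" by (rule left_limI) (use assms in \<open>simp add: paths_def\<close>)
qed (use assms in \<open>auto simp: paths_def PiE_def extensional_def\<close>)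

lemma eventually_at_path:
  assumes \<omega>: "\<omega> \<in> paths adj" and t: "0 < t" "t < 1" "t \<notin> jump_times \<omega>"
  shows "eventually (\<lambda>s. \<omega> s = \<omega> t) (at t)"
proof -
  have "left_lim \<omega> t = \<omega> t" using t by (auto simp: jump_times_def)
  then show ?thesis
    using pathD(1)[OF \<omega>, of t] pathD(2)[OF \<omega>, of t] t by (simp add: eventually_at_split)
qed

text \<open>A path is locally constant away from its jumps, and the half-open interval is connected.
  At \<open>a\<close> the neighbourhood is one-sided, so a jump at \<open>a\<close> itself does no
  harm.\<close>

lemma path_const_between:
  assumes \<omega>: "\<omega> \<in> paths adj" and ab: "0 \<le> a" "b \<le> 1" and nj: "jump_times \<omega> \<inter> {a<..<b} = {}"
    and s: "a \<le> s" "s < b"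
  shows "\<omega> s = \<omega> a"
proof (rule connected_local_const[of "{a..<b}"])
  show "\<forall>t\<in>{a..<b}. eventually (\<lambda>u. \<omega> t = \<omega> u) (at t within {a..<b})"
  proof
    fix t assume t: "t \<in> {a..<b}"
    show "eventually (\<lambda>u. \<omega> t = \<omega> u) (at t within {a..<b})"
    proof (cases "t = a")
      case True
      have "eventually (\<lambda>u. \<omega> u = \<omega> a) (at_right a)" using pathD(1)[OF \<omega>, of a] ab t by auto
      moreover have "at a within {a..<b} \<le> at_right a"
        unfolding at_within_def by (intro inf_mono) auto
      ultimately have "eventually (\<lambda>u. \<omega> u = \<omega> a) (at a within {a..<b})" using filter_leD by blast
      then show ?thesis unfolding True by (rule eventually_mono) simp
    next
      case False
      have "eventually (\<lambda>u. \<omega> u = \<omega> t) (at t)"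
        by (rule eventually_at_path[OF \<omega>]) (use False t nj ab in auto)
      moreover have "at t within {a..<b} \<le> at t" by (rule at_le) simp
      ultimately have "eventually (\<lambda>u. \<omega> u = \<omega> t) (at t within {a..<b})" using filter_leD by blast
      then show ?thesis by (rule eventually_mono) simp
    qed
  qed
qed (use s in \<open>auto simp: connected_Ico\<close>)

text \<open>At time \<open>c\<close> the second path already holds, which keeps the splice right
  continuous. The left limit at \<open>c\<close> comes from the first path, so \<open>c\<close> is
  the only time at which a new jump can appear.\<close>

definition path_splice :: "real \<Rightarrow> (real \<Rightarrow> 'a) \<Rightarrow> (real \<Rightarrow> 'a) \<Rightarrow> real \<Rightarrow> 'a" where
  "path_splice c \<omega> \<omega>' t = (if t < c then \<omega> t else \<omega>' t)"

lemma left_lim_path_splice: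
  "left_lim (path_splice c \<omega> \<omega>') t = (if t \<le> c then left_lim \<omega> t else left_lim \<omega>' t)"
proof (cases "t \<le> c")
  case True
  have "eventually (\<lambda>s. path_splice c \<omega> \<omega>' s = \<omega> s) (at_left t)"
    unfolding eventually_at_left_field using True by (auto simp: path_splice_def intro!: exI[of _ "t - 1"])
  then show ?thesis using True by (simp add: left_lim_cong)
next
  case False
  then have "eventually (\<lambda>s. path_splice c \<omega> \<omega>' s = \<omega>' s) (at_left t)"
    unfolding eventually_at_left_field by (auto simp: path_splice_def intro!: exI[of _ c])
  then show ?thesis using False by (simp add: left_lim_cong)
qed

lemma jump_times_path_splice:
  assumes "0 < c" "c < 1"
  shows "jump_times (path_splice c \<omega> \<omega>') = (jump_times \<omega> \<inter> {..<c}) \<union> (jump_times \<omega>' \<inter> {c<..})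
    \<union> (if left_lim \<omega> c \<noteq> \<omega>' c then {c} else {})"
  using assms by (auto simp: jump_times_def left_lim_path_splice path_splice_def split: if_splits)

lemma path_splice_in_paths:
  assumes \<omega>: "\<omega> \<in> paths adj" and \<omega>': "\<omega>' \<in> paths adj" and c: "0 < c" "c < 1"
    and link: "left_lim \<omega> c \<noteq> \<omega>' c \<Longrightarrow> adj (left_lim \<omega> c) (\<omega>' c)"
  shows "path_splice c \<omega> \<omega>' \<in> paths adj"
  unfolding paths_def
proof (intro CollectI conjI ballI)
  show "path_splice c \<omega> \<omega>' \<in> {0..1} \<rightarrow>\<^sub>E UNIV"
    using pathD(6)[OF \<omega>] pathD(6)[OF \<omega>'] by (auto simp: PiE_def extensional_def path_splice_def)
  show "eventually (\<lambda>s. path_splice c \<omega> \<omega>' s = path_splice c \<omega> \<omega>' t) (at_right t)" if t: "t \<in> {0..<1}" for t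
  proof (cases "t < c")
    case True
    have "eventually (\<lambda>s. s < c) (at_right t)"
      unfolding eventually_at_right_field using True by auto
    with pathD(1)[OF \<omega>, of t] t show ?thesis
      using True by (auto simp: path_splice_def elim: eventually_elim2)
  next
    case False
    have "eventually (\<lambda>s. t < s) (at_right t)" by (simp add: eventually_at_filter)
    with pathD(1)[OF \<omega>', of t] t show ?thesis
      using False by (auto simp: path_splice_def elim: eventually_elim2)
  qed
  have left: "eventually (\<lambda>s. path_splice c \<omega> \<omega>' s = left_lim (path_splice c \<omega> \<omega>') t) (at_left t)" if t: "t \<in> {0<..1}" for t
  proof (cases "t \<le> c")
    case True
    have "eventually (\<lambda>s. s < t) (at_left t)" by (simp add: eventually_at_filter)
    with pathD(2)[OF \<omega>, of t] t show ?thesis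
      using True by (auto simp: path_splice_def left_lim_path_splice elim: eventually_elim2)
  next
    case False
    then have "eventually (\<lambda>s. c < s) (at_left t)" unfolding eventually_at_left_field by (auto intro!: exI[of _ c])
    with pathD(2)[OF \<omega>', of t] t show ?thesis
      using False by (auto simp: path_splice_def left_lim_path_splice elim: eventually_elim2)
  qed
  then show "\<exists>x. eventually (\<lambda>s. path_splice c \<omega> \<omega>' s = x) (at_left t)" if "t \<in> {0<..1}" for t
    using that by blast
  show "eventually (\<lambda>s. path_splice c \<omega> \<omega>' s = path_splice c \<omega> \<omega>' 1) (at_left 1)"
    using left[of 1] c pathD(3)[OF \<omega>'] by (simp add: left_lim_path_splice) (simp add: path_splice_def)
  show "finite (jump_times (path_splice c \<omega> \<omega>'))"
    using pathD(4)[OF \<omega>] pathD(4)[OF \<omega>'] c by (simp add: jump_times_path_splice)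
  show "adj (left_lim (path_splice c \<omega> \<omega>') t) (path_splice c \<omega> \<omega>' t)" if "t \<in> jump_times (path_splice c \<omega> \<omega>')" for t
    using that pathD(5)[OF \<omega>, of t] pathD(5)[OF \<omega>', of t] link c
    by (auto simp: jump_times_path_splice left_lim_path_splice path_splice_def split: if_splits)
qed

definition const_path :: "'a \<Rightarrow> real \<Rightarrow> 'a" where
  "const_path x = (\<lambda>t\<in>{0..1}. x)"

lemma left_lim_const_path: "0 < t \<Longrightarrow> t \<le> 1 \<Longrightarrow> left_lim (const_path x) t = x"
  by (rule left_limI) (auto simp: const_path_def eventually_at_left_field intro!: exI[of _ 0])

lemma jump_times_const_path [simp]: "jump_times (const_path x) = {}"
  using left_lim_const_path[of _ x] by (auto simp: jump_times_def) (auto simp: const_path_def)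

lemma const_path_in_paths: "const_path x \<in> paths adj"
proof -
  have 1: "eventually (\<lambda>s. const_path x s = x) (at_left t)" if "0 < t" "t \<le> 1" for t
    using that by (auto simp: const_path_def eventually_at_left_field intro!: exI[of _ 0])
  have 2: "eventually (\<lambda>s. const_path x s = x) (at_right t)" if "0 \<le> t" "t < 1" for t
    using that by (auto simp: const_path_def eventually_at_right_field intro!: exI[of _ 1])
  have 3: "const_path x t = x" if "0 \<le> t" "t \<le> 1" for t using that by (simp add: const_path_def)
  have "const_path x \<in> {0..1} \<rightarrow>\<^sub>E UNIV" by (auto simp: const_path_def)
  then show ?thesis unfolding paths_def
    by (intro CollectI conjI ballI exI[of _ x]) (use 1 2 in \<open>auto simp: 3\<close>)
qed

lemma const_path_simps [simp]: "0 \<le> t \<Longrightarrow> t \<le> 1 \<Longrightarrow> const_path x t = x"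
  by (simp add: const_path_def)

lemma path_const_start:
  assumes \<omega>: "\<omega> \<in> paths adj"
  obtains e where "0 < e" "e < 1" "\<And>s. 0 \<le> s \<Longrightarrow> s < e \<Longrightarrow> \<omega> s = \<omega> 0"
proof -
  obtain b where b: "0 < b" "\<And>s. 0 < s \<Longrightarrow> s < b \<Longrightarrow> \<omega> s = \<omega> 0"
    using pathD(1)[OF \<omega>, of 0] by (auto simp: eventually_at_right_field)
  show thesis
  proof (rule that[of "min b (1/2)"])
    show "\<omega> s = \<omega> 0" if "0 \<le> s" "s < min b (1/2)" for s
      using b(2)[of s] that by (cases "s = 0") auto
  qed (use b in auto)
qed

text \<open>The edges of a walk in the graph are prepended one by one, each during the time for
  which the path built so far rests at its starting point.\<close>

lemma ex_path:
  assumes "good_graph adj"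
  obtains \<omega> where "\<omega> \<in> paths adj" "\<omega> 0 = x" "\<omega> 1 = y"
proof -
  have "adj\<^sup>*\<^sup>* x y" using assms by (simp add: good_graph_def)
  then have "\<exists>\<omega>\<in>paths adj. \<omega> 0 = x \<and> \<omega> 1 = y"
  proof (induction rule: converse_rtranclp_induct)
    case base
    then show ?case by (intro bexI[of _ "const_path y"]) (simp_all add: const_path_in_paths)
  next
    case (step x z)
    then obtain \<omega> where \<omega>: "\<omega> \<in> paths adj" "\<omega> 0 = z" "\<omega> 1 = y" by blast
    obtain e where e: "0 < e" "e < 1" "\<And>s. 0 \<le> s \<Longrightarrow> s < e \<Longrightarrow> \<omega> s = \<omega> 0"
      using path_const_start[OF \<omega>(1)] by blast
    have "path_splice (e / 2) (const_path x) \<omega> \<in> paths adj"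
      by (rule path_splice_in_paths[OF const_path_in_paths \<omega>(1)])
        (use e step \<omega> in \<open>auto simp: left_lim_const_path\<close>)
    then show ?case
      by (rule rev_bexI) (use e \<omega> in \<open>auto simp: path_splice_def\<close>)
  qed
  then show thesis using that by blast
qed

text \<open>Two paths with the same ends that an observation at one time tells apart. The second
  makes an excursion from \<open>x\<close> to \<open>v\<close> and back, at \<open>e / 3\<close> and
  \<open>2 * e / 3\<close>, while the first still rests at \<open>x\<close>; both are observed at
  \<open>e / 2\<close>.\<close>

lemma ex_two_paths:
  assumes g: "good_graph adj" and xv: "adj x v"
  obtains \<gamma> \<gamma>' s where "\<gamma> \<in> paths adj" "\<gamma>' \<in> paths adj" "\<gamma> 0 = x" "\<gamma> 1 = y" "\<gamma>' 0 = x" "\<gamma>' 1 = y"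
    "s \<in> {0..1}" "\<gamma> s = x" "\<gamma>' s = v" 
proof -
  obtain \<gamma> where \<gamma>: "\<gamma> \<in> paths adj" "\<gamma> 0 = x" "\<gamma> 1 = y" using ex_path[OF g] by blast
  obtain e where e: "0 < e" "e < 1" "\<And>s. 0 \<le> s \<Longrightarrow> s < e \<Longrightarrow> \<gamma> s = \<gamma> 0"
    using path_const_start[OF \<gamma>(1)] by blast
  let ?a = "path_splice (e / 3) (const_path x) (const_path v)"
  have a: "?a \<in> paths adj"
    by (rule path_splice_in_paths[OF const_path_in_paths const_path_in_paths])
      (use e xv in \<open>auto simp: left_lim_const_path\<close>)
  have sp: "path_splice (2 * e / 3) ?a \<gamma> \<in> paths adj"
  proof (rule path_splice_in_paths[OF a \<gamma>(1)])
    have "left_lim ?a (2 * e / 3) = v" "\<gamma> (2 * e / 3) = x"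
      using e \<gamma> by (auto simp: left_lim_path_splice left_lim_const_path)
    then show "adj (left_lim ?a (2 * e / 3)) (\<gamma> (2 * e / 3))" using g xv by (auto simp: good_graph_def)
  qed (use e in auto)
  have "\<gamma> (e / 2) = x" using e(1) e(3)[of "e / 2"] \<gamma>(2) by simp
  moreover have "path_splice (2 * e / 3) ?a \<gamma> 0 = x" "path_splice (2 * e / 3) ?a \<gamma> 1 = y"
    "path_splice (2 * e / 3) ?a \<gamma> (e / 2) = v"
    using e(1,2) \<gamma>(3) by (simp_all add: path_splice_def)
  ultimately show thesis
    by (intro that[of \<gamma> "path_splice (2 * e / 3) ?a \<gamma>" "e / 2"]) (use \<gamma> sp e(1,2) in simp_all)
qed

lemma good_distanceD:
  assumes "good_distance adj d"
  shows "0 \<le> d x y" "d x x = 0" "d x y = 0 \<longleftrightarrow> x = y" "d x y = d y x" "d x z \<le> d x y + d y z"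
    "x \<noteq> y \<Longrightarrow> 1 \<le> d x y"
    "d x y = Inf {path_length d \<omega> | \<omega>. \<omega> \<in> paths adj \<and> \<omega> 0 = x \<and> \<omega> 1 = y}"
proof -
  interpret Metric_space UNIV d using assms by (simp add: good_distance_def)
  show "0 \<le> d x y" "d x x = 0" "d x y = 0 \<longleftrightarrow> x = y" "d x y = d y x" "d x z \<le> d x y + d y z"
    using triangle by (auto simp: commute)
qed (use assms in \<open>unfold good_distance_def, blast+\<close>)

lemma path_length_nonneg: "good_distance adj d \<Longrightarrow> 0 \<le> path_length d \<omega>"
  unfolding path_length_def by (rule sum_nonneg) (erule good_distanceD(1))

lemma distance_le_path_length:
  assumes d: "good_distance adj d" and \<omega>: "\<omega> \<in> paths adj"
  shows "d (\<omega> 0) (\<omega> 1) \<le> path_length d \<omega>"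
  unfolding good_distanceD(7)[OF d, of "\<omega> 0" "\<omega> 1"]
  by (rule cInf_lower) (use \<omega> path_length_nonneg[OF d] in \<open>auto intro!: bdd_belowI[of _ 0]\<close>)

text \<open>The distance is nearly attained by a path, whose part after its first jump is again a path.\<close>

lemma ex_geodesic_neighbour:
  assumes g: "good_graph adj" and d: "good_distance adj d" and xy: "x \<noteq> y"
  obtains v where "adj x v" "d x y = d x v + d v y"
proof -
  have approx: "\<exists>v. adj x v \<and> d x v + d v y < d x y + e" if e: "0 < e" for e
  proof -
    let ?S = "{path_length d \<omega> | \<omega>. \<omega> \<in> paths adj \<and> \<omega> 0 = x \<and> \<omega> 1 = y}"
    have "?S \<noteq> {}" using ex_path[OF g, of x y] by blast
    moreover have "Inf ?S < d x y + e" using e good_distanceD(7)[OF d, of x y] by simp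
    ultimately obtain \<omega> where \<omega>: "\<omega> \<in> paths adj" "\<omega> 0 = x" "\<omega> 1 = y" "path_length d \<omega> < d x y + e"
      using cInf_lessD[of ?S] by blast
    have fin: "finite (jump_times \<omega>)" by (rule pathD(4)[OF \<omega>(1)])
    have ne: "jump_times \<omega> \<noteq> {}"
    proof
      assume nj: "jump_times \<omega> = {}"
      have "eventually (\<lambda>s. \<omega> s = x) (at_left 1)"
        unfolding eventually_at_left_field
        using path_const_between[OF \<omega>(1), of 0 1] nj \<omega>(2) by (auto intro!: exI[of _ 0])
      then show False using left_limI[of \<omega> x 1] pathD(3)[OF \<omega>(1)] \<omega>(3) xy by simp
    qed
    define t where "t = Min (jump_times \<omega>)"
    have t: "t \<in> jump_times \<omega>" unfolding t_def by (rule Min_in[OF fin ne])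
    then have t01: "0 < t" "t < 1" by (auto simp: jump_times_def)
    have below: "jump_times \<omega> \<inter> {0<..<t} = {}" using Min_le[OF fin] by (force simp: t_def)
    have start: "\<omega> s = x" if "0 \<le> s" "s < t" for s
      using path_const_between[OF \<omega>(1) _ _ below] that t01 \<omega>(2) by auto
    have ll: "left_lim \<omega> t = x"
      by (rule left_limI) (use start t01 in \<open>auto simp: eventually_at_left_field intro!: exI[of _ 0]\<close>)
    define v where "v = \<omega> t"
    have xv: "adj x v" using pathD(5)[OF \<omega>(1) t] ll by (simp add: v_def)
    \<comment> \<open>Waiting at \<open>v\<close> from the start removes exactly the first jump, so
      the length drops by \<open>d x v\<close>.\<close>
    let ?\<omega> = "path_splice t (const_path v) \<omega>"
    have \<omega>': "?\<omega> \<in> paths adj"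
      by (rule path_splice_in_paths[OF const_path_in_paths \<omega>(1)]) (use t01 in \<open>auto simp: left_lim_const_path v_def\<close>)
    have jt: "jump_times ?\<omega> = jump_times \<omega> - {t}"
      using t01 below by (auto simp: jump_times_path_splice left_lim_const_path v_def) (auto simp: jump_times_def)
    have "path_length d ?\<omega> = (\<Sum>s\<in>jump_times \<omega> - {t}. d (left_lim \<omega> s) (\<omega> s))"
      unfolding path_length_def jt
    proof (rule sum.cong)
      fix s assume s: "s \<in> jump_times \<omega> - {t}"
      then have "t < s" using below by (force simp: jump_times_def)
      then show "d (left_lim ?\<omega> s) (?\<omega> s) = d (left_lim \<omega> s) (\<omega> s)" by (simp add: left_lim_path_splice path_splice_def)
    qed simp
    then have "path_length d \<omega> = d x v + path_length d ?\<omega>"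
      unfolding path_length_def[of d \<omega>] using fin t ll by (simp add: sum.remove[OF fin t] v_def)
    moreover have "d v y \<le> path_length d ?\<omega>"
      using distance_le_path_length[OF d \<omega>'] t01 \<omega>(3) by (simp add: path_splice_def)
    ultimately show ?thesis using xv \<omega>(4) by (intro exI[of _ v]) linarith
  qed
  \<comment> \<open>So far the neighbour depends on the error \<open>e\<close>. As \<open>x\<close>
    has finitely many neighbours, a best one serves all \<open>e\<close> at once.\<close>
  have fin: "finite {v. adj x v}" using g by (simp add: good_graph_def)
  moreover have "{v. adj x v} \<noteq> {}" using approx[of 1] by auto
  ultimately obtain v where "is_arg_min (\<lambda>v. d x v + d v y) (\<lambda>v. v \<in> {v. adj x v}) v"
    using ex_is_arg_min_if_finite by blast
  then have v: "adj x v" "\<And>w. adj x w \<Longrightarrow> d x v + d v y \<le> d x w + d w y"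
    by (auto simp: is_arg_min_linorder)
  have "d x v + d v y \<le> d x y + e" if "0 < e" for e
    using approx[OF that] v(2) by fastforce
  then have "d x v + d v y \<le> d x y" by (rule field_le_epsilon)
  then show thesis using that[OF v(1)] good_distanceD(5)[OF d, of x y v] by simp
qed

section \<open>Random walks with bounded jump rates\<close>

lemma space_path_sigma [simp]: "space (path_sigma adj I) = paths adj"
  by (auto simp: path_sigma_def space_measure_of_conv)

lemma sets_path_sigma: "sets (path_sigma adj I) = sigma_sets (paths adj) {{\<omega> \<in> paths adj. \<omega> s = x} | s x. s \<in> I}"
  unfolding path_sigma_def by (rule sets_measure_of) auto

lemma sets_path_sigma_mono: "I \<subseteq> I' \<Longrightarrow> sets (path_sigma adj I) \<subseteq> sets (path_sigma adj I')"
  unfolding sets_path_sigma by (rule sigma_sets_mono') auto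

lemma coordinate_event: "s \<in> I \<Longrightarrow> {\<omega> \<in> paths adj. \<omega> s = x} \<in> sets (path_sigma adj I)"
  unfolding sets_path_sigma by (rule sigma_sets.Basic) auto

lemma measurable_coordinate:
  fixes adj :: "'a::countable \<Rightarrow> 'a \<Rightarrow> bool"
  assumes "s \<in> I"
  shows "(\<lambda>\<omega>. \<omega> s) \<in> path_sigma adj I \<rightarrow>\<^sub>M count_space UNIV"
proof (subst measurable_count_space_eq2_countable)
  have "(\<lambda>\<omega>. \<omega> s) -` {a} \<inter> space (path_sigma adj I) = {\<omega> \<in> paths adj. \<omega> s = a}" for a by auto
  then show "(\<lambda>\<omega>. \<omega> s) \<in> space (path_sigma adj I) \<rightarrow> UNIV \<and>
    (\<forall>a\<in>UNIV. (\<lambda>\<omega>. \<omega> s) -` {a} \<inter> space (path_sigma adj I) \<in> sets (path_sigma adj I))"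
    using coordinate_event[OF assms, of adj] by simp
qed

text \<open>Paths are \<open>undefined\<close> outside [0, 1]. This retraction lets time range over
  the whole line, as Fubini with \<open>lborel\<close> requires.\<close>

definition clamp01 :: "real \<Rightarrow> real" where
  "clamp01 r = max 0 (min 1 r)"

lemma clamp01_in [simp]: "clamp01 r \<in> {0..1}" by (auto simp: clamp01_def)
lemma clamp01_bounds [simp]: "0 \<le> clamp01 r" "clamp01 r \<le> 1" by (auto simp: clamp01_def)
lemma clamp01_eq [simp]: "0 \<le> r \<Longrightarrow> r \<le> 1 \<Longrightarrow> clamp01 r = r" by (auto simp: clamp01_def)

lemma measurable_clamp01 [measurable]: "clamp01 \<in> borel_measurable borel"
  unfolding clamp01_def[abs_def] by measurable

lemma measurable_clamp01_restrict: "clamp01 \<in> borel \<rightarrow>\<^sub>M restrict_space borel {0..1}"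
  by (rule measurable_restrict_space2) auto

text \<open>Joint measurability: a right-continuous path is the limit of its values at grid points to the right.\<close>

lemma measurable_evaluation:
  fixes adj :: "'a::countable \<Rightarrow> 'a \<Rightarrow> bool"
  shows "(\<lambda>(\<omega>, r). \<omega> (clamp01 r)) \<in> path_space adj \<Otimes>\<^sub>M borel \<rightarrow>\<^sub>M count_space UNIV"
proof -
  let ?M = "path_space adj \<Otimes>\<^sub>M (borel :: real measure)"
  \<comment> \<open>The \<open>+ 1\<close> puts the grid point strictly to the right of the time,
    where right continuity applies; the cut at 1 makes it exact at time 1.\<close>
  define q :: "nat \<Rightarrow> int \<Rightarrow> real" where "q n i = max 0 (min 1 ((of_int i + 1) / (real n + 1)))" for n i
  define \<rho> where "\<rho> n r = q n \<lfloor>clamp01 r * (real n + 1)\<rfloor>" for n r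
  \<comment> \<open>Coding states by \<open>to_nat\<close> turns eventual equality of states into
    convergence of real functions.\<close>
  have "(\<lambda>p. real (to_nat ((fst p) (clamp01 (snd p))))) \<in> borel_measurable ?M"
  proof (rule borel_measurable_LIMSEQ_real)
    fix n
    have "(\<lambda>\<omega>. \<omega> (q n i)) \<in> path_space adj \<rightarrow>\<^sub>M count_space UNIV" for i
      by (rule measurable_coordinate) (auto simp: q_def)
    then have "(\<lambda>p. real (to_nat ((fst p) (q n i)))) \<in> borel_measurable ?M" for i
      by measurable
    moreover have "(\<lambda>p. \<lfloor>clamp01 (snd p) * (real n + 1)\<rfloor>) \<in> ?M \<rightarrow>\<^sub>M count_space UNIV"
      by measurable
    ultimately show "(\<lambda>p. real (to_nat ((fst p) (\<rho> n (snd p))))) \<in> borel_measurable ?M"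
      unfolding \<rho>_def by (rule measurable_compose_countable)
  next
    fix p assume "p \<in> space ?M"
    then obtain \<omega> r where p: "p = (\<omega>, r)" "\<omega> \<in> paths adj" by (auto simp: space_pair_measure)
    define c where "c = clamp01 r"
    have c: "0 \<le> c" "c \<le> 1" by (auto simp: c_def)
    have "\<forall>\<^sub>F n in sequentially. \<omega> (\<rho> n r) = \<omega> c"
    proof (cases "c = 1")
      case True
      have "\<rho> n r = 1" for n
        using True c_def by (simp add: \<rho>_def q_def)
      then show ?thesis using True by simp
    next
      case False
      then have c1: "c < 1" using c by simp
      obtain b where b: "c < b" "\<And>s. c < s \<Longrightarrow> s < b \<Longrightarrow> \<omega> s = \<omega> c"
        using pathD(1)[OF p(2) c(1) c1] by (auto simp: eventually_at_right_field)
      define e where "e = min b 1 - c"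
      have e: "0 < e" using b c1 by (simp add: e_def)
      then obtain m :: nat where m: "1 / e < real m" using reals_Archimedean2 by blast
      have "\<omega> (\<rho> n r) = \<omega> c" if "m \<le> n" for n
      proof -
        let ?i = "\<lfloor>c * (real n + 1)\<rfloor>"
        have n: "0 < real n + 1" by simp
        have 1: "c < (of_int ?i + 1) / (real n + 1)"
          by (subst pos_less_divide_eq[OF n]) linarith
        have "(of_int ?i + 1) / (real n + 1) \<le> (c * (real n + 1) + 1) / (real n + 1)"
          by (rule divide_right_mono) auto
        also have "\<dots> = c + 1 / (real n + 1)" using n by (simp add: field_simps)
        also have "1 / (real n + 1) < e"
        proof -
          have "1 / e < real n + 1" using m that by linarith
          then show ?thesis using e n by (simp add: field_simps)
        qed
        finally have 2: "(of_int ?i + 1) / (real n + 1) < min b 1" by (simp add: e_def)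
        then have "\<rho> n r = (of_int ?i + 1) / (real n + 1)"
          using 1 c by (simp add: \<rho>_def q_def c_def)
        then show ?thesis using 1 2 by (intro b(2)) auto
      qed
      then show ?thesis by (rule eventually_sequentiallyI)
    qed
    then have "\<forall>\<^sub>F n in sequentially. real (to_nat ((fst p) (\<rho> n (snd p)))) = real (to_nat ((fst p) (clamp01 (snd p))))"
      by eventually_elim (simp add: p c_def)
    then show "(\<lambda>n. real (to_nat ((fst p) (\<rho> n (snd p))))) \<longlonglongrightarrow> real (to_nat ((fst p) (clamp01 (snd p))))"
      by (rule tendsto_eventually)
  qed
  then have m: "(\<lambda>p. real (to_nat ((fst p) (clamp01 (snd p))))) -` {real (to_nat a)} \<inter> space ?M \<in> sets ?M" for a :: 'a
    by (rule measurable_sets) auto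
  have "(\<lambda>(\<omega>, r). \<omega> (clamp01 r)) -` {a} \<inter> space ?M =
    (\<lambda>p. real (to_nat ((fst p) (clamp01 (snd p))))) -` {real (to_nat a)} \<inter> space ?M" for a :: 'a
    by auto
  then show ?thesis using m by (subst measurable_count_space_eq2_countable) auto
qed

lemma measurable_evaluation_dependent:
  fixes adj :: "'a::countable \<Rightarrow> 'a \<Rightarrow> bool"
  assumes "\<And>x. (\<lambda>r. h r x) \<in> borel_measurable borel"
  shows "(\<lambda>(\<omega>, r). h r (\<omega> (clamp01 r)) :: real) \<in> borel_measurable (path_space adj \<Otimes>\<^sub>M borel)"
proof -
  have "(\<lambda>p. h (snd p) ((\<lambda>(\<omega>, r). \<omega> (clamp01 r)) p)) \<in> borel_measurable (path_space adj \<Otimes>\<^sub>M borel)"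
  proof (rule measurable_compose_countable[OF _ measurable_evaluation])
    show "(\<lambda>p. h (snd p) i) \<in> borel_measurable (path_space adj \<Otimes>\<^sub>M borel)" for i
      using assms[of i] by measurable
  qed
  then show ?thesis by (simp add: case_prod_beta)
qed

section \<open>Gronwall estimates by iteration over short intervals\<close>

lemma set_integral_const_Icc:
  fixes a b c :: real
  shows "set_integrable lborel {a..b} (\<lambda>_. c)" and "a \<le> b \<Longrightarrow> (LBINT r:{a..b}. c) = c * (b - a)"
proof -
  show "set_integrable lborel {a..b} (\<lambda>_. c)"
    unfolding set_integrable_def
    by (rule integrable_scaleR_left) (auto simp: integrable_indicator_iff emeasure_lborel_Icc_eq)
qed (simp add: set_lebesgue_integral_def)

text \<open>Splits off a last piece of length at most \<delta> and recurses; this one induction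
  serves the estimates in both directions.\<close>

lemma gronwall_iterate:
  fixes f :: "real \<Rightarrow> real"
  assumes step: "\<And>a b. s \<le> a \<Longrightarrow> a \<le> b \<Longrightarrow> b \<le> t \<Longrightarrow> b - a \<le> \<delta> \<Longrightarrow> P a b"
    and trans: "\<And>a c b m n. s \<le> a \<Longrightarrow> a \<le> c \<Longrightarrow> c \<le> b \<Longrightarrow> b \<le> t \<Longrightarrow> R n a c \<Longrightarrow> P c b \<Longrightarrow> R (Suc n) a b"
    and refl: "\<And>a. R 0 a a" and \<delta>: "0 \<le> \<delta>"
  shows "s \<le> a \<Longrightarrow> a \<le> b \<Longrightarrow> b \<le> t \<Longrightarrow> b - a \<le> real n * \<delta> \<Longrightarrow> R n a b"
proof (induction n arbitrary: b)
  case 0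
  then show ?case using refl[of a] by simp
next
  case (Suc n)
  let ?c = "max a (b - \<delta>)"
  have "R n a ?c"
    by (rule Suc.IH) (use Suc.prems \<delta> in \<open>auto simp: algebra_simps\<close>)
  moreover have "P ?c b" by (rule step) (use Suc.prems \<delta> in auto)
  ultimately show ?case by (rule trans[rotated 4]) (use Suc.prems \<delta> in auto)
qed

text \<open>Growth is tested against any bound \<open>M\<close> of \<open>f\<close>. With
  \<open>M\<close> the supremum over an interval of length at most \<open>1 / (2 * c)\<close> this
  gives \<open>M \<le> f a + M / 2\<close>, so \<open>f\<close> at most doubles there;
  \<open>n \<ge> 2 * c\<close> such intervals cover [s, t].\<close>

lemma gronwall_upper:
  fixes f :: "real \<Rightarrow> real"
  assumes f0: "\<And>r. s \<le> r \<Longrightarrow> r \<le> t \<Longrightarrow> 0 \<le> f r" and fB: "\<And>r. s \<le> r \<Longrightarrow> r \<le> t \<Longrightarrow> f r \<le> B"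
    and c: "0 < c" and st: "s \<le> t" "t - s \<le> 1" and n: "2 * c \<le> real n"
    and growth: "\<And>a b M. s \<le> a \<Longrightarrow> a \<le> b \<Longrightarrow> b \<le> t \<Longrightarrow> (\<And>r. a \<le> r \<Longrightarrow> r \<le> b \<Longrightarrow> f r \<le> M)
      \<Longrightarrow> f b - f a \<le> c * M * (b - a)"
  shows "f t \<le> 2 ^ n * f s"
proof -
  have step: "f b \<le> 2 * f a" if ab: "s \<le> a" "a \<le> b" "b \<le> t" "b - a \<le> 1 / (2 * c)" for a b
  proof -
    define M where "M = Sup (f ` {a..b})"
    have bdd: "bdd_above (f ` {a..b})" using fB ab by (intro bdd_aboveI[of _ B]) auto
    have le: "f r \<le> M" if "a \<le> r" "r \<le> b" for r
      unfolding M_def by (rule cSup_upper[OF _ bdd]) (use that in auto)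
    have M0: "0 \<le> M" using le[of a] f0[of a] ab by auto
    have "f r \<le> f a + M / 2" if r: "a \<le> r" "r \<le> b" for r
    proof -
      have "f r - f a \<le> c * M * (r - a)" by (rule growth) (use r ab le in auto)
      also have "\<dots> \<le> c * M * (1 / (2 * c))" using r ab c M0 by (intro mult_left_mono) auto
      also have "\<dots> = M / 2" using c by simp
      finally show ?thesis by simp
    qed
    then have "M \<le> f a + M / 2" unfolding M_def using ab by (intro cSup_least) auto
    then show ?thesis using le[of b] ab by simp
  qed
  have len: "t - s \<le> real n * (1 / (2 * c))"
  proof -
    have "(t - s) * (2 * c) \<le> 1 * (2 * c)" by (rule mult_right_mono) (use st c in auto)
    then have "(t - s) * (2 * c) \<le> real n" using n by simp
    then show ?thesis using c by (simp add: pos_le_divide_eq)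
  qed
  show "f t \<le> 2 ^ n * f s"
  proof (rule gronwall_iterate[of s t "1 / (2 * c)" "\<lambda>a b. f b \<le> 2 * f a" "\<lambda>n a b. f b \<le> 2 ^ n * f a"])
    fix a m b :: real and k :: nat
    assume "f m \<le> 2 ^ k * f a" "f b \<le> 2 * f m"
    then show "f b \<le> 2 ^ Suc k * f a" by simp
  qed (use step c st len in auto)
qed

text \<open>\<open>H\<close> is a cumulated inflow, and the outflow has rate at most
  \<open>c * f\<close>. On a short interval the supremum argument leaves at least half of what was
  present or came in; the factors 2 accumulate.\<close>

lemma gronwall_lower:
  fixes f H :: "real \<Rightarrow> real"
  assumes f0: "\<And>r. s \<le> r \<Longrightarrow> r \<le> t \<Longrightarrow> 0 \<le> f r" and fB: "\<And>r. s \<le> r \<Longrightarrow> r \<le> t \<Longrightarrow> f r \<le> B"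
    and c: "0 < c" and st: "s \<le> t" "t - s \<le> 1" and n: "2 * c \<le> real n"
    and H: "\<And>a b. s \<le> a \<Longrightarrow> a \<le> b \<Longrightarrow> b \<le> t \<Longrightarrow> H a \<le> H b"
    and growth: "\<And>a b M. s \<le> a \<Longrightarrow> a \<le> b \<Longrightarrow> b \<le> t \<Longrightarrow> (\<And>r. a \<le> r \<Longrightarrow> r \<le> b \<Longrightarrow> f r \<le> M)
      \<Longrightarrow> H b - H a - c * M * (b - a) \<le> f b - f a"
  shows "f s + (H t - H s) \<le> 2 ^ n * f t"
proof -
  have step: "f a + (H b - H a) \<le> 2 * f b" if ab: "s \<le> a" "a \<le> b" "b \<le> t" "b - a \<le> 1 / (2 * c)" for a b
  proof -
    define M where "M = Sup (f ` {a..b})"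
    have bdd: "bdd_above (f ` {a..b})" using fB ab by (intro bdd_aboveI[of _ B]) auto
    have le: "f r \<le> M" if "a \<le> r" "r \<le> b" for r
      unfolding M_def by (rule cSup_upper[OF _ bdd]) (use that in auto)
    have M0: "0 \<le> M" using le[of a] f0[of a] ab by auto
    have dec: "H b - H r - M / 2 \<le> f b - f r" if r: "a \<le> r" "r \<le> b" for r
    proof -
      have "H b - H r - c * M * (b - r) \<le> f b - f r" by (rule growth) (use r ab le in auto)
      moreover have "c * M * (b - r) \<le> c * M * (1 / (2 * c))" using r ab c M0 by (intro mult_left_mono) auto
      moreover have "c * M * (1 / (2 * c)) = M / 2" using c by simp
      ultimately show ?thesis by simp
    qed
    have "f r \<le> f b + M / 2" if "a \<le> r" "r \<le> b" for r using dec[OF that] H[of r b] that ab by simp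
    then have "M \<le> f b + M / 2" unfolding M_def using ab by (intro cSup_least) auto
    then show ?thesis using dec[of a] ab by simp
  qed
  have len: "t - s \<le> real n * (1 / (2 * c))"
  proof -
    have "(t - s) * (2 * c) \<le> 1 * (2 * c)" by (rule mult_right_mono) (use st c in auto)
    then have "(t - s) * (2 * c) \<le> real n" using n by simp
    then show ?thesis using c by (simp add: pos_le_divide_eq)
  qed
  show "f s + (H t - H s) \<le> 2 ^ n * f t"
  proof (rule gronwall_iterate[of s t "1 / (2 * c)" "\<lambda>a b. f a + (H b - H a) \<le> 2 * f b"
        "\<lambda>n a b. f a + (H b - H a) \<le> 2 ^ n * f b"])
    fix a m b :: real and n k :: nat
    assume m: "s \<le> a" "a \<le> m" "m \<le> b" "b \<le> t" "f a + (H m - H a) \<le> 2 ^ n * f m" "f m + (H b - H m) \<le> 2 * f b"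
    have "H b - H m \<le> 2 ^ n * (H b - H m)"
      using H[of m b] m mult_right_mono[of 1 "2 ^ n :: real" "H b - H m"] by simp
    then have "f a + (H b - H a) \<le> 2 ^ n * f m + 2 ^ n * (H b - H m)" using m by linarith
    also have "\<dots> = 2 ^ n * (f m + (H b - H m))" by (simp add: algebra_simps)
    also have "\<dots> \<le> 2 ^ n * (2 * f b)" by (rule mult_left_mono) (use m in auto)
    finally show "f a + (H b - H a) \<le> 2 ^ Suc n * f b" by simp
  qed (use step c st len in auto)
qed

text \<open>\<open>N\<close> stands for a walk restricted to an event of its past up to
  \<open>s\<close>. It is not normalized, so it can be cut out of an infinite measure, and only the
  martingale problem after \<open>s\<close> is recorded, because restrictions of this kind preserve
  it.\<close>

locale jump_law = finite_measure N
  for adj :: "'a::countable \<Rightarrow> 'a \<Rightarrow> bool" and K :: "real \<Rightarrow> 'a \<Rightarrow> 'a \<Rightarrow> real" and lam s :: real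
    and N :: "(real \<Rightarrow> 'a) measure" +
  assumes fin_adj: "finite {y. adj x y}"
    and K_measurable: "(\<lambda>t. K t x y) \<in> borel_measurable (restrict_space borel {0..1})"
    and K_nonneg: "t \<in> {0..1} \<Longrightarrow> 0 \<le> K t x y"
    and K_bound: "t \<in> {0..1} \<Longrightarrow> (\<Sum>y | adj x y. K t x y) \<le> lam"
    and sets_N: "sets N = sets (path_space adj)"
    and s0: "0 \<le> s" and lam0: "0 < lam"
    and mart: "bounded (range u) \<Longrightarrow> s \<le> a \<Longrightarrow> a \<le> b \<Longrightarrow> b \<le> 1 \<Longrightarrow>
      (\<integral>\<omega>. u (\<omega> b) - u (\<omega> a) - (LBINT r:{a..b}. generator adj K r u (\<omega> r)) \<partial>N) = 0"
begin

lemma space_N: "space N = paths adj"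
  using sets_eq_imp_space_eq[OF sets_N] by simp

lemma N_coord [measurable]: "t \<in> {0..1} \<Longrightarrow> (\<lambda>\<omega>. \<omega> t) \<in> N \<rightarrow>\<^sub>M count_space UNIV"
  by (simp add: measurable_cong_sets[OF sets_N refl] measurable_coordinate)

lemma integrable_coord:
  assumes "t \<in> {0..1}" "\<And>x. \<bar>h x\<bar> \<le> B"
  shows "integrable N (\<lambda>\<omega>. h (\<omega> t) :: real)"
proof (rule integrable_const_bound)
  show "(\<lambda>\<omega>. h (\<omega> t)) \<in> borel_measurable N"
    by (rule measurable_compose[OF N_coord[OF assms(1)]]) simp
qed (use assms in auto)

lemma K_clamp [measurable]: "(\<lambda>r. K (clamp01 r) x y) \<in> borel_measurable borel"
  using measurable_compose[OF measurable_clamp01_restrict K_measurable] by simp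

lemma generator_bound:
  assumes "r \<in> {0..1}" "\<And>x. \<bar>u x\<bar> \<le> B"
  shows "\<bar>generator adj K r u x\<bar> \<le> lam * (2 * B)"
proof -
  have B0: "0 \<le> B" using assms(2)[of x] by simp
  have "\<bar>generator adj K r u x\<bar> \<le> (\<Sum>y | adj x y. \<bar>K r x y * (u y - u x)\<bar>)"
    unfolding generator_def by (rule sum_abs)
  also have "\<dots> \<le> (\<Sum>y | adj x y. K r x y * (2 * B))"
  proof (rule sum_mono)
    fix y
    have "\<bar>u y - u x\<bar> \<le> 2 * B" using assms(2)[of x] assms(2)[of y] by linarith
    then show "\<bar>K r x y * (u y - u x)\<bar> \<le> K r x y * (2 * B)"
      using K_nonneg[OF assms(1), of x y] by (simp add: abs_mult mult_left_mono)
  qed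
  also have "\<dots> = (\<Sum>y | adj x y. K r x y) * (2 * B)" by (simp add: sum_distrib_right)
  also have "\<dots> \<le> lam * (2 * B)" using K_bound[OF assms(1), of x] B0 by (intro mult_right_mono) auto
  finally show ?thesis .
qed

text \<open>Fubini turns the martingale property into the forward equation for expectations, in
  integrated form.\<close>

lemma dynkin:
  assumes u: "\<And>x. \<bar>u x\<bar> \<le> B" and ab: "s \<le> a" "a \<le> b" "b \<le> 1"
  defines "e \<equiv> \<lambda>r. \<integral>\<omega>. generator adj K (clamp01 r) u (\<omega> (clamp01 r)) \<partial>N"
  shows "set_integrable lborel {a..b} e"
    and "(\<integral>\<omega>. u (\<omega> b) \<partial>N) - (\<integral>\<omega>. u (\<omega> a) \<partial>N) = (LBINT r:{a..b}. e r)"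
proof -
  have P: "pair_sigma_finite N lborel"
    by (simp add: pair_sigma_finite_def sigma_finite_measure_axioms lborel.sigma_finite_measure_axioms)
  interpret P: pair_sigma_finite N "lborel :: real measure" by (rule P)
  define G where "G \<omega> r = indicator {a..b} r *\<^sub>R generator adj K (clamp01 r) u (\<omega> (clamp01 r))" for \<omega> r
  have [measurable]: "(\<lambda>(\<omega>, r). generator adj K (clamp01 r) u (\<omega> (clamp01 r))) \<in> borel_measurable (N \<Otimes>\<^sub>M lborel)"
  proof -
    have "(\<lambda>(\<omega>, r). generator adj K (clamp01 r) u (\<omega> (clamp01 r))) \<in> borel_measurable (path_space adj \<Otimes>\<^sub>M borel)"
      by (rule measurable_evaluation_dependent) (simp add: generator_def)
    then show ?thesis by (simp add: sets_N cong: measurable_cong_sets sets_pair_measure_cong)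
  qed
  have int: "integrable (N \<Otimes>\<^sub>M lborel) (\<lambda>(\<omega>, r). G \<omega> r)"
  proof (rule integrableI_bounded_set[where A = "space N \<times> {a..b}" and B = "lam * (2 * B)"])
    show "emeasure (N \<Otimes>\<^sub>M lborel) (space N \<times> {a..b}) < \<infinity>"
      using ab by (subst lborel.emeasure_pair_measure_Times) (auto simp: ennreal_mult_less_top emeasure_eq_measure)
    show "AE x in N \<Otimes>\<^sub>M lborel. x \<in> space N \<times> {a..b} \<longrightarrow> norm (case x of (\<omega>, r) \<Rightarrow> G \<omega> r) \<le> lam * (2 * B)"
      by (rule AE_I2) (use generator_bound[OF clamp01_in u] in \<open>auto simp: G_def\<close>)
    show "AE x in N \<Otimes>\<^sub>M lborel. x \<notin> space N \<times> {a..b} \<longrightarrow> (case x of (\<omega>, r) \<Rightarrow> G \<omega> r) = 0"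
      by (rule AE_I2) (auto simp: G_def space_pair_measure indicator_def)
    show "(\<lambda>(\<omega>, r). G \<omega> r) \<in> borel_measurable (N \<Otimes>\<^sub>M lborel)"
      unfolding G_def by measurable
  qed measurable
  have Ge: "(\<integral>\<omega>. G \<omega> r \<partial>N) = indicator {a..b} r *\<^sub>R e r" for r
    by (simp add: G_def e_def)
  show "set_integrable lborel {a..b} e"
    unfolding set_integrable_def Ge[symmetric] by (rule P.integrable_snd[OF int])
  have inner: "(LBINT r:{a..b}. generator adj K r u (\<omega> r)) = (\<integral>r. G \<omega> r \<partial>lborel)" for \<omega>
    unfolding set_lebesgue_integral_def G_def
    by (rule Bochner_Integration.integral_cong) (use ab s0 in \<open>auto split: split_indicator\<close>)
  have iI: "integrable N (\<lambda>\<omega>. \<integral>r. G \<omega> r \<partial>lborel)" by (rule P.integrable_fst[OF int])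
  have ub: "integrable N (\<lambda>\<omega>. u (\<omega> b))" "integrable N (\<lambda>\<omega>. u (\<omega> a))"
    using u ab s0 by (auto intro!: integrable_coord)
  have bu: "bounded (range u)" using u by (auto simp: bounded_iff)
  have "(\<integral>\<omega>. u (\<omega> b) \<partial>N) - (\<integral>\<omega>. u (\<omega> a) \<partial>N) = (\<integral>\<omega>. \<integral>r. G \<omega> r \<partial>lborel \<partial>N)"
    using mart[OF bu ab] ub iI unfolding inner by simp
  also have "\<dots> = (\<integral>r. \<integral>\<omega>. G \<omega> r \<partial>N \<partial>lborel)"
    by (rule P.Fubini_integral[OF int, symmetric])
  also have "\<dots> = (LBINT r:{a..b}. e r)" by (simp add: Ge set_lebesgue_integral_def)
  finally show "(\<integral>\<omega>. u (\<omega> b) \<partial>N) - (\<integral>\<omega>. u (\<omega> a) \<partial>N) = (LBINT r:{a..b}. e r)" .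
qed

lemma dynkin_mono:
  assumes u: "\<And>x. \<bar>u x\<bar> \<le> B" and ab: "s \<le> a" "a \<le> b" "b \<le> 1" and W: "set_integrable lborel {a..b} W"
  shows "(\<And>r. a \<le> r \<Longrightarrow> r \<le> b \<Longrightarrow> W r \<le> (\<integral>\<omega>. generator adj K r u (\<omega> r) \<partial>N)) \<Longrightarrow>
      (LBINT r:{a..b}. W r) \<le> (\<integral>\<omega>. u (\<omega> b) \<partial>N) - (\<integral>\<omega>. u (\<omega> a) \<partial>N)"
    and "(\<And>r. a \<le> r \<Longrightarrow> r \<le> b \<Longrightarrow> (\<integral>\<omega>. generator adj K r u (\<omega> r) \<partial>N) \<le> W r) \<Longrightarrow>
      (\<integral>\<omega>. u (\<omega> b) \<partial>N) - (\<integral>\<omega>. u (\<omega> a) \<partial>N) \<le> (LBINT r:{a..b}. W r)"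
proof -
  have cl: "clamp01 r = r" if "a \<le> r" "r \<le> b" for r using that ab s0 by simp
  show "(LBINT r:{a..b}. W r) \<le> (\<integral>\<omega>. u (\<omega> b) \<partial>N) - (\<integral>\<omega>. u (\<omega> a) \<partial>N)"
    if "\<And>r. a \<le> r \<Longrightarrow> r \<le> b \<Longrightarrow> W r \<le> (\<integral>\<omega>. generator adj K r u (\<omega> r) \<partial>N)"
    using set_integral_mono[OF W dynkin(1)[of u B a b, OF u ab]] that cl
    by (simp add: dynkin(2)[of u B a b, OF u ab])
  show "(\<integral>\<omega>. u (\<omega> b) \<partial>N) - (\<integral>\<omega>. u (\<omega> a) \<partial>N) \<le> (LBINT r:{a..b}. W r)"
    if "\<And>r. a \<le> r \<Longrightarrow> r \<le> b \<Longrightarrow> (\<integral>\<omega>. generator adj K r u (\<omega> r) \<partial>N) \<le> W r"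
    using set_integral_mono[OF dynkin(1)[of u B a b, OF u ab] W] that cl
    by (simp add: dynkin(2)[of u B a b, OF u ab])
qed

text \<open>Gronwall for functions with \<open>L u \<le> lam * u\<close>. Inserting the first bound
  into the growth estimate gives the second, of first order in \<open>t - s\<close>; it is the one
  that later excludes jumps at fixed times.\<close>

lemma expectation_growth:
  assumes u: "\<And>x. \<bar>u x\<bar> \<le> B" "\<And>x. 0 \<le> u x" and t: "s \<le> t" "t \<le> 1"
    and gen: "\<And>r x. r \<in> {0..1} \<Longrightarrow> generator adj K r u x \<le> lam * u x"
    and n: "2 * lam \<le> real n"
  shows "(\<integral>\<omega>. u (\<omega> t) \<partial>N) \<le> 2 ^ n * (\<integral>\<omega>. u (\<omega> s) \<partial>N)"
    and "(\<integral>\<omega>. u (\<omega> t) \<partial>N) - (\<integral>\<omega>. u (\<omega> s) \<partial>N) \<le> lam * (2 ^ n * (\<integral>\<omega>. u (\<omega> s) \<partial>N)) * (t - s)"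
proof -
  let ?f = "\<lambda>r. \<integral>\<omega>. u (\<omega> r) \<partial>N"
  have iu: "integrable N (\<lambda>\<omega>. u (\<omega> r))" if "r \<in> {0..1}" for r using integrable_coord[OF that u(1)] .
  have growth: "?f b - ?f a \<le> lam * M * (b - a)"
    if ab: "s \<le> a" "a \<le> b" "b \<le> 1" and M: "\<And>r. a \<le> r \<Longrightarrow> r \<le> b \<Longrightarrow> ?f r \<le> M" for a b M
  proof -
    have "?f b - ?f a \<le> (LBINT r:{a..b}. lam * M)"
    proof (rule dynkin_mono(2)[OF u(1) ab])
      fix r assume r: "a \<le> r" "r \<le> b"
      then have r01: "r \<in> {0..1}" using ab s0 by auto
      have "(\<integral>\<omega>. generator adj K r u (\<omega> r) \<partial>N) \<le> (\<integral>\<omega>. lam * u (\<omega> r) \<partial>N)"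
      proof (rule integral_mono)
        show "integrable N (\<lambda>\<omega>. generator adj K r u (\<omega> r))"
          by (rule integrable_coord[OF r01 generator_bound[OF r01 u(1)]])
        show "integrable N (\<lambda>\<omega>. lam * u (\<omega> r))" using iu[OF r01] by simp
      qed (rule gen[OF r01])
      also have "\<dots> = lam * ?f r" by simp
      also have "\<dots> \<le> lam * M" using M[OF r] lam0 by (intro mult_left_mono) auto
      finally show "(\<integral>\<omega>. generator adj K r u (\<omega> r) \<partial>N) \<le> lam * M" .
    qed (rule set_integral_const_Icc)
    also have "\<dots> = lam * M * (b - a)" using ab by (simp add: set_integral_const_Icc)
    finally show ?thesis .
  qed
  have f0: "0 \<le> ?f r" for r by (rule integral_nonneg_AE) (use u in auto)
  have fB: "?f r \<le> B * measure N (space N)" if "s \<le> r" "r \<le> 1" for r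
  proof -
    have "?f r \<le> (\<integral>\<omega>. B \<partial>N)"
      by (rule integral_mono) (use iu[of r] u(1) that s0 abs_le_D1 in auto)
    then show ?thesis by (simp add: mult.commute)
  qed
  have up: "?f r \<le> 2 ^ n * ?f s" if "s \<le> r" "r \<le> 1" for r
    by (rule gronwall_upper[of s r ?f "B * measure N (space N)" lam])
      (use f0 fB lam0 that s0 n growth in auto)
  show "?f t \<le> 2 ^ n * ?f s" using up t by simp
  show "?f t - ?f s \<le> lam * (2 ^ n * ?f s) * (t - s)"
    by (rule growth) (use t up in auto)
qed

lemma coord_prob: "t \<in> {0..1} \<Longrightarrow> (\<integral>\<omega>. indicator {x} (\<omega> t) \<partial>N) = measure N {\<omega>\<in>paths adj. \<omega> t = x}"
proof -
  assume t: "t \<in> {0..1}"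
  have "(\<integral>\<omega>. indicator {x} (\<omega> t) \<partial>N) = (\<integral>\<omega>. indicator {\<omega>\<in>paths adj. \<omega> t = x} \<omega> \<partial>N)"
    by (rule Bochner_Integration.integral_cong) (auto simp: space_N split: split_indicator)
  also have "\<dots> = measure N ({\<omega>\<in>paths adj. \<omega> t = x} \<inter> space N)"
    by (rule Bochner_Integration.integral_indicator)
  also have "{\<omega>\<in>paths adj. \<omega> t = x} \<inter> space N = {\<omega>\<in>paths adj. \<omega> t = x}" by (auto simp: space_N)
  finally show ?thesis .
qed

text \<open>A balance of mass at \<open>v\<close>: outflow at total rate at most \<open>lam\<close>,
  and inflow at least from the neighbour \<open>z\<close>.\<close>

lemma generator_indicator_lower:
  assumes r: "r \<in> {0..1}"
  shows "- lam * indicator {v} x \<le> generator adj K r (indicator {v}) x"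
    and "adj z v \<Longrightarrow> z \<noteq> v \<Longrightarrow>
      K r z v * indicator {z} x - lam * indicator {v} x \<le> generator adj K r (indicator {v}) x"
proof -
  have lower: "- lam * indicator {v} x \<le> generator adj K r (indicator {v}) x" for x
  proof (cases "x = v")
    case True
    have "(\<Sum>y | adj v y. K r v y * (indicator {v} y - 1)) \<ge> (\<Sum>y | adj v y. - K r v y)"
      by (rule sum_mono) (use K_nonneg[OF r, of v] in \<open>auto split: split_indicator\<close>)
    then show ?thesis using K_bound[OF r, of v] True by (simp add: generator_def sum_negf)
  next
    case False
    then show ?thesis unfolding generator_def
      by (auto intro!: sum_nonneg mult_nonneg_nonneg K_nonneg[OF r])
  qed
  then show "- lam * indicator {v} x \<le> generator adj K r (indicator {v}) x" .
  assume zv: "adj z v" "z \<noteq> v"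
  show "K r z v * indicator {z} x - lam * indicator {v} x \<le> generator adj K r (indicator {v}) x"
  proof (cases "x = z")
    case True
    have "K r z v = K r z v * (indicator {v} v - indicator {v} z)" using zv by simp
    also have "\<dots> \<le> (\<Sum>y | adj z y. K r z y * (indicator {v} y - indicator {v} z))"
      by (rule member_le_sum) (use zv fin_adj[of z] K_nonneg[OF r, of z] in auto)
    finally show ?thesis using True zv by (simp add: generator_def)
  next
    case False
    then show ?thesis using lower[of x] by simp
  qed
qed

text \<open>Gronwall from below, used twice: at least the fraction \<open>1 / 2 ^ n\<close> of the
  mass at \<open>z\<close> is still there at every later time; this mass feeds \<open>v\<close>, and
  of the inflow again such a fraction is left at time \<open>t\<close>.\<close>

lemma prob_lower:
  assumes t: "s \<le> t" "t \<le> 1" and n: "2 * lam \<le> real n"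
  shows "measure N {\<omega>\<in>paths adj. \<omega> s = z} \<le> 2 ^ n * measure N {\<omega>\<in>paths adj. \<omega> t = z}" (is ?stay)
    and "adj z v \<Longrightarrow> z \<noteq> v \<Longrightarrow> measure N {\<omega>\<in>paths adj. \<omega> s = z} * (LBINT r:{s..t}. K r z v)
      \<le> 2 ^ n * 2 ^ n * measure N {\<omega>\<in>paths adj. \<omega> t = v}" (is "PROP ?jump")
proof -
  define q where "q r x = measure N {\<omega>\<in>paths adj. \<omega> r = x}" for r x
  have q: "(\<integral>\<omega>. indicator {x} (\<omega> r) \<partial>N) = q r x" if "r \<in> {0..1}" for r x
    using coord_prob[OF that] by (simp add: q_def)
  have iq: "integrable N (\<lambda>\<omega>. indicator {x} (\<omega> r) :: real)" if "r \<in> {0..1}" for r x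
    by (rule integrable_coord[OF that, where B = 1]) (auto split: split_indicator)
  have ig: "integrable N (\<lambda>\<omega>. generator adj K r (indicator {x}) (\<omega> r))" if "r \<in> {0..1}" for r x
    by (rule integrable_coord[OF that generator_bound[OF that, where B = 1]]) (auto split: split_indicator)
  have q0: "0 \<le> q r x" and qB: "q r x \<le> measure N (space N)" for r x
    by (auto simp: q_def bounded_measure)
  have stay: "q s z \<le> 2 ^ n * q r z" if r: "s \<le> r" "r \<le> 1" for r
  proof -
    have "q s z + (0 - 0) \<le> 2 ^ n * q r z"
    proof (rule gronwall_lower[where H = "\<lambda>_. 0" and c = lam, OF q0 qB lam0 r(1) _ n])
      fix a b M assume ab: "s \<le> a" "a \<le> b" "b \<le> r" and M: "\<And>r. a \<le> r \<Longrightarrow> r \<le> b \<Longrightarrow> q r z \<le> M"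
      have "(LBINT r:{a..b}. - lam * M) \<le> (\<integral>\<omega>. indicator {z} (\<omega> b) \<partial>N) - (\<integral>\<omega>. indicator {z} (\<omega> a) \<partial>N)"
      proof (rule dynkin_mono(1)[where B = 1])
        fix r' assume r': "a \<le> r'" "r' \<le> b"
        then have r01: "r' \<in> {0..1}" using ab r s0 by auto
        have "- lam * M \<le> - lam * q r' z" using M[OF r'] lam0 by simp
        also have "\<dots> = (\<integral>\<omega>. - lam * indicator {z} (\<omega> r') \<partial>N)" by (simp add: q[OF r01])
        also have "\<dots> \<le> (\<integral>\<omega>. generator adj K r' (indicator {z}) (\<omega> r') \<partial>N)"
          by (rule integral_mono) (use generator_indicator_lower(1)[OF r01] iq[OF r01] ig[OF r01] in auto)
        finally show "- lam * M \<le> (\<integral>\<omega>. generator adj K r' (indicator {z}) (\<omega> r') \<partial>N)" .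
      qed (use ab r in \<open>auto simp: set_integral_const_Icc split: split_indicator\<close>)
      then show "0 - 0 - lam * M * (b - a) \<le> q b z - q a z"
        using ab r s0 by (simp add: set_integral_const_Icc q)
    qed (use r s0 in auto)
    then show ?thesis by simp
  qed
  then show ?stay using t by (simp add: q_def)
  show "PROP ?jump"
  proof -
    assume zv: "adj z v" "z \<noteq> v"
    define \<kappa> where "\<kappa> r = K (clamp01 r) z v" for r
    have \<kappa>0: "0 \<le> \<kappa> r" for r by (simp add: \<kappa>_def K_nonneg)
    have \<kappa>B: "\<kappa> r \<le> lam" for r
      unfolding \<kappa>_def using member_le_sum[of v "{y. adj z y}" "K (clamp01 r) z"] zv fin_adj[of z] K_nonneg K_bound[of "clamp01 r" z]
      by (smt (verit) clamp01_in mem_Collect_eq)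
    have [measurable]: "\<kappa> \<in> borel_measurable borel" by (simp add: \<kappa>_def[abs_def])
    have i\<kappa>: "set_integrable lborel {a..b} \<kappa>" for a b
      unfolding set_integrable_def
      by (rule integrableI_bounded_set_indicator[where B = lam]) (use \<kappa>0 \<kappa>B in \<open>auto simp: emeasure_lborel_Icc_eq\<close>)
    \<comment> \<open>By \<open>stay\<close>, a lower bound for the mass at \<open>z\<close> during
      the whole of [s, t].\<close>
    define p where "p = q s z / 2 ^ n"
    have p0: "0 \<le> p" by (simp add: p_def q0)
    define H where "H r = p * (LBINT r:{s..r}. \<kappa> r)" for r
    have Hdiff: "H b - H a = p * (LBINT r:{a..b}. \<kappa> r)" if "s \<le> a" "a \<le> b" for a b
    proof -
      have "(LBINT r:{s..b}. \<kappa> r) = (LBINT r:{s..a}. \<kappa> r) + (LBINT r:{a<..b}. \<kappa> r)"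
      proof -
        have "{s..b} = {s..a} \<union> {a<..b}" using that by auto
        moreover have "set_integrable lborel {a<..b} \<kappa>" by (rule set_integrable_subset[OF i\<kappa>[of a b]]) auto
        moreover have "{s..a} \<inter> {a<..b} = {}" by auto
        ultimately show ?thesis using i\<kappa>[of s a] set_integral_Un[of "{s..a}" "{a<..b}" lborel \<kappa>] by simp
      qed
      moreover have "(LBINT r:{a<..b}. \<kappa> r) = (LBINT r:{a..b}. \<kappa> r)"
        unfolding set_lebesgue_integral_def
        by (rule integral_cong_AE) (auto intro!: AE_I[where N = "{a}"] split: split_indicator)
      ultimately show ?thesis by (simp add: H_def algebra_simps)
    qed
    have "q s v + (H t - H s) \<le> 2 ^ n * q t v"
    proof (rule gronwall_lower[where c = lam, OF q0 qB lam0 t(1) _ n])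
      show "H a \<le> H b" if "s \<le> a" "a \<le> b" for a b
      proof -
        have "0 \<le> (LBINT r:{a..b}. \<kappa> r)" unfolding set_lebesgue_integral_def by (rule integral_nonneg_AE) (use \<kappa>0 in auto)
        then show ?thesis using Hdiff[OF that] p0 by (metis diff_ge_0_iff_ge mult_nonneg_nonneg)
      qed
      fix a b M assume ab: "s \<le> a" "a \<le> b" "b \<le> t" and M: "\<And>r. a \<le> r \<Longrightarrow> r \<le> b \<Longrightarrow> q r v \<le> M"
      have i1: "set_integrable lborel {a..b} (\<lambda>r. p * \<kappa> r)" by (rule set_integrable_mult_right) (rule i\<kappa>)
      have i2: "set_integrable lborel {a..b} (\<lambda>r. lam * M)" by (rule set_integral_const_Icc)
      have "(LBINT r:{a..b}. p * \<kappa> r - lam * M) \<le> (\<integral>\<omega>. indicator {v} (\<omega> b) \<partial>N) - (\<integral>\<omega>. indicator {v} (\<omega> a) \<partial>N)"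
      proof (rule dynkin_mono(1)[where B = 1])
        fix r assume r: "a \<le> r" "r \<le> b"
        then have r01: "r \<in> {0..1}" using ab t s0 by auto
        have "p \<le> q r z" using stay[of r] r ab t by (simp add: p_def field_simps)
        then have "p * \<kappa> r \<le> q r z * \<kappa> r" by (rule mult_right_mono) (rule \<kappa>0)
        moreover have "lam * q r v \<le> lam * M" using M[OF r] lam0 by simp
        ultimately have "p * \<kappa> r - lam * M \<le> K r z v * q r z - lam * q r v"
          using r01 by (simp add: \<kappa>_def mult.commute)
        also have "\<dots> = (\<integral>\<omega>. K r z v * indicator {z} (\<omega> r) - lam * indicator {v} (\<omega> r) \<partial>N)"
          using iq[OF r01] by (simp add: q[OF r01])
        also have "\<dots> \<le> (\<integral>\<omega>. generator adj K r (indicator {v}) (\<omega> r) \<partial>N)"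
          by (rule integral_mono) (use generator_indicator_lower(2)[OF r01 zv] iq[OF r01] ig[OF r01] in auto)
        finally show "p * \<kappa> r - lam * M \<le> (\<integral>\<omega>. generator adj K r (indicator {v}) (\<omega> r) \<partial>N)" .
      next
        show "set_integrable lborel {a..b} (\<lambda>r. p * \<kappa> r - lam * M)"
          by (rule set_integral_diff(1)[OF i1 i2])
      qed (use ab t in \<open>auto split: split_indicator\<close>)
      moreover have "(LBINT r:{a..b}. p * \<kappa> r - lam * M) = p * (LBINT r:{a..b}. \<kappa> r) - lam * M * (b - a)"
        using ab by (simp add: set_integral_diff(2)[OF i1 i2] set_integral_const_Icc)
      ultimately show "H b - H a - lam * M * (b - a) \<le> q b v - q a v"
        using ab t s0 by (simp add: Hdiff q)
    qed (use t s0 in auto)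
    moreover have "H t - H s = p * (LBINT r:{s..t}. K r z v)"
    proof -
      have "(LBINT r:{s..t}. \<kappa> r) = (LBINT r:{s..t}. K r z v)"
        by (rule set_lebesgue_integral_cong) (use s0 t in \<open>auto simp: \<kappa>_def\<close>)
      then show ?thesis using Hdiff[of s t] t by simp
    qed
    ultimately have "p * (LBINT r:{s..t}. K r z v) \<le> 2 ^ n * q t v" using q0[of s v] by linarith
    then have "2 ^ n * (p * (LBINT r:{s..t}. K r z v)) \<le> 2 ^ n * (2 ^ n * q t v)" by simp
    then show ?thesis by (simp add: p_def q_def mult.assoc)
  qed
qed

end

section \<open>Slowed down random walks\<close>

locale walk_setting =
  fixes adj :: "'a::countable \<Rightarrow> 'a \<Rightarrow> bool" and d :: "'a \<Rightarrow> 'a \<Rightarrow> real" and m :: "'a \<Rightarrow> real"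
    and J :: "real \<Rightarrow> 'a \<Rightarrow> 'a \<Rightarrow> real" and lam :: real
  assumes graph: "good_graph adj" and dist: "good_distance adj d" and m_pos: "0 < m x"
    and J_measurable: "(\<lambda>t. J t x y) \<in> borel_measurable (restrict_space borel {0..1})"
    and J_pos: "t \<in> {0..1} \<Longrightarrow> adj x y \<Longrightarrow> 0 < J t x y"
    and J_zero: "t \<in> {0..1} \<Longrightarrow> \<not> adj x y \<Longrightarrow> J t x y = 0"
    and J_bound: "t \<in> {0..1} \<Longrightarrow> (\<Sum>y | adj x y. J t x y) \<le> lam"
    and lam_pos: "0 < lam"
begin

abbreviation slowed :: "nat \<Rightarrow> (real \<Rightarrow> 'a) measure \<Rightarrow> bool" where
  "slowed k Q \<equiv> markov_jump_measure adj m (slowed_kernel d J k) Q"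

text \<open>The Gronwall constant of a unit of time. It serves every \<open>k \<ge> 1\<close>,
  because \<open>lam\<close> bounds the total rate of each slowed kernel.\<close>

definition growth :: real where
  "growth = 2 ^ nat \<lceil>2 * lam\<rceil>"

lemma growth_pos: "0 < growth"
  by (simp add: growth_def)

lemma growth_exponent: "2 * lam \<le> real (nat \<lceil>2 * lam\<rceil>)"
  by linarith

lemma J_nonneg: "t \<in> {0..1} \<Longrightarrow> 0 \<le> J t x y"
  using J_pos[of t x y] J_zero[of t x y] by (cases "adj x y") auto

lemma J_le: "t \<in> {0..1} \<Longrightarrow> J t x y \<le> lam"
proof (cases "adj x y")
  case True
  assume t: "t \<in> {0..1}"
  have "J t x y \<le> (\<Sum>y | adj x y. J t x y)"
    by (rule member_le_sum) (use True graph J_nonneg[OF t] in \<open>auto simp: good_graph_def\<close>)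
  then show ?thesis using J_bound[OF t, of x] by simp
qed (use J_zero lam_pos in auto)

lemma measurable_J_clamp [measurable]: "(\<lambda>r. J (clamp01 r) x y) \<in> borel_measurable borel"
  using measurable_compose[OF measurable_clamp01_restrict J_measurable] by simp

lemma J_integrable: "set_integrable lborel {a..b} (\<lambda>r. J (clamp01 r) x y)"
  unfolding set_integrable_def
  by (rule integrableI_bounded_set_indicator[where B = lam])
    (use J_nonneg J_le in \<open>auto simp: emeasure_lborel_Icc_eq\<close>)

lemma J_integral_clamp: "0 \<le> a \<Longrightarrow> b \<le> 1 \<Longrightarrow> (LBINT r:{a..b}. J r x y) = (LBINT r:{a..b}. J (clamp01 r) x y)"
  by (rule set_lebesgue_integral_cong) auto

lemma J_integral_nonneg: "0 \<le> a \<Longrightarrow> b \<le> 1 \<Longrightarrow> 0 \<le> (LBINT r:{a..b}. J r x y)"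
  using J_nonneg by (simp add: J_integral_clamp) (simp add: set_lebesgue_integral_def integral_nonneg_AE)

lemma J_integral_pos:
  assumes xy: "adj x y" and ab: "0 \<le> a" "a < b" "b \<le> 1"
  shows "0 < (LBINT r:{a..b}. J r x y)"
proof -
  have "(LBINT r:{a..b}. J r x y) \<noteq> 0"
  proof
    assume zero: "(LBINT r:{a..b}. J r x y) = 0"
    have int: "integrable lborel (\<lambda>r. indicator {a..b} r *\<^sub>R J (clamp01 r) x y)"
      using J_integrable[of a b x y] by (simp add: set_integrable_def)
    have nn: "AE r in lborel. 0 \<le> indicator {a..b} r *\<^sub>R J (clamp01 r) x y"
      using J_nonneg by auto
    have "AE r in lborel. indicator {a..b} r *\<^sub>R J (clamp01 r) x y = 0"
      using zero[unfolded J_integral_clamp[OF ab(1,3)]] unfolding set_lebesgue_integral_def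
        integral_nonneg_eq_0_iff_AE[OF int nn] .
    then have "AE r in lborel. r \<notin> {a..b}"
    proof eventually_elim
      case (elim r)
      then show ?case using J_pos[OF clamp01_in xy, of r] by (auto split: split_indicator_asm)
    qed
    then have "{a..b} \<in> null_sets lborel" by (subst AE_iff_null_sets) auto
    then show False using ab by (auto simp: null_sets_def)
  qed
  then show ?thesis using J_integral_nonneg[of a b x y] ab by simp
qed

lemma powr_distance_le_1: "1 \<le> k \<Longrightarrow> real k powr (- d x y) \<le> 1"
  using good_distanceD(1)[OF dist, of x y] by (simp add: powr_minus_divide ge_one_powr_ge_zero)

text \<open>\<open>has_jump_kernel\<close> is tested on past events of finite mass, and
  \<open>A\<close> lies in the past of every time after \<open>s\<close>; hence the martingale
  identities survive the restriction to \<open>A\<close>.\<close>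

lemma jump_law_restrict:
  assumes k: "1 \<le> k" and Q: "slowed k Q" and s: "0 \<le> s" and A: "A \<in> sets (path_sigma adj {0..s})"
    and s1: "s \<le> 1" and fin: "emeasure Q A < \<infinity>"
  shows "jump_law adj (slowed_kernel d J k) lam s (density Q (indicator A))"
    and "A \<in> sets Q"
proof -
  have sQ: "sets Q = sets (path_space adj)" and jk: "has_jump_kernel adj (slowed_kernel d J k) Q"
    using Q by (auto simp: markov_jump_measure_def)
  show AQ: "A \<in> sets Q" using A sets_path_sigma_mono[of "{0..s}" "{0..1}" adj] s1 unfolding sQ by auto
  let ?K = "slowed_kernel d J k" and ?N = "density Q (indicator A)"
  have finN: "finite_measure ?N"
    by (rule finite_measureI) (use fin AQ sets.sets_into_space[OF AQ] in \<open>simp add: emeasure_restricted Int_absorb2\<close>)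
  interpret finite_measure ?N by (rule finN)
  show "jump_law adj ?K lam s ?N"
  proof
    show "finite {y. adj x y}" for x using graph by (simp add: good_graph_def)
    show "(\<lambda>t. ?K t x y) \<in> borel_measurable (restrict_space borel {0..1})" for x y
      unfolding slowed_kernel_def using J_measurable[of x y] by measurable
    show "0 \<le> ?K t x y" if "t \<in> {0..1}" for t x y
      using J_nonneg[OF that] by (simp add: slowed_kernel_def)
    show "(\<Sum>y | adj x y. ?K t x y) \<le> lam" if t: "t \<in> {0..1}" for t x
    proof -
      have "(\<Sum>y | adj x y. ?K t x y) \<le> (\<Sum>y | adj x y. J t x y)"
        unfolding slowed_kernel_def
        by (rule sum_mono) (use powr_distance_le_1[OF k] J_nonneg[OF t] mult_right_mono[of _ 1] in fastforce)
      then show ?thesis using J_bound[OF t, of x] by simp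
    qed
    show "sets ?N = sets (path_space adj)" by (simp add: sQ)
    show "0 \<le> s" "0 < lam" by (rule s lam_pos)+
    fix u :: "'a \<Rightarrow> real" and a b assume u: "bounded (range u)" and ab: "s \<le> a" "a \<le> b" "b \<le> 1"
    let ?I = "\<lambda>\<omega>. LBINT r:{a..b}. generator adj ?K r u (\<omega> r)"
    have K_clamp: "(\<lambda>r. ?K (clamp01 r) x y) \<in> borel_measurable borel" for x y
      by (simp add: slowed_kernel_def)
    have "(\<lambda>(\<omega>, r). generator adj ?K (clamp01 r) u (\<omega> (clamp01 r))) \<in> borel_measurable (path_space adj \<Otimes>\<^sub>M borel)"
      by (rule measurable_evaluation_dependent) (use K_clamp in \<open>simp add: generator_def\<close>)
    then have [measurable]: "(\<lambda>(\<omega>, r). generator adj ?K (clamp01 r) u (\<omega> (clamp01 r))) \<in> borel_measurable (Q \<Otimes>\<^sub>M lborel)"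
      by (simp add: sQ cong: measurable_cong_sets sets_pair_measure_cong)
    have "(\<lambda>\<omega>. \<integral>r. indicator {a..b} r *\<^sub>R generator adj ?K (clamp01 r) u (\<omega> (clamp01 r)) \<partial>lborel) \<in> borel_measurable Q"
      by (rule lborel.borel_measurable_lebesgue_integral) measurable
    moreover have "?I = (\<lambda>\<omega>. \<integral>r. indicator {a..b} r *\<^sub>R generator adj ?K (clamp01 r) u (\<omega> (clamp01 r)) \<partial>lborel)"
      unfolding set_lebesgue_integral_def
      by (intro ext Bochner_Integration.integral_cong) (use ab s in \<open>auto split: split_indicator\<close>)
    ultimately have I: "?I \<in> borel_measurable Q" by simp
    have co: "(\<lambda>\<omega>. u (\<omega> t)) \<in> borel_measurable Q" if "t \<in> {0..1}" for t
    proof -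
      have "(\<lambda>\<omega>. \<omega> t) \<in> Q \<rightarrow>\<^sub>M count_space UNIV"
        using that by (simp add: measurable_cong_sets[OF sQ refl] measurable_coordinate)
      then show ?thesis by (rule measurable_compose) simp
    qed
    let ?f = "\<lambda>\<omega>. u (\<omega> b) - u (\<omega> a) - ?I \<omega>"
    have f: "?f \<in> borel_measurable Q"
      by (intro borel_measurable_diff I co) (use ab s in auto)
    have "(\<integral>\<omega>. ?f \<omega> \<partial>density Q (\<lambda>\<omega>. ennreal (indicator A \<omega>))) = (LINT \<omega>:A|Q. ?f \<omega>)"
      unfolding set_lebesgue_integral_def[of Q] by (rule integral_density[OF f]) (use AQ in auto)
    also have "\<dots> = 0"
    proof -
      have "A \<in> sets (path_sigma adj {0..a})" using A sets_path_sigma_mono[of "{0..s}" "{0..a}" adj] ab by auto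
      then show ?thesis
        using jk u ab s fin unfolding has_jump_kernel_def by (meson order_trans)
    qed
    finally show "(\<integral>\<omega>. ?f \<omega> \<partial>?N) = 0" unfolding ennreal_indicator .
  qed
qed

section \<open>Transition estimates given an event of the past\<close>

context
  fixes k Q s A z
  assumes k: "1 \<le> k" and Q: "slowed k Q" and s: "0 \<le> s" "s \<le> 1" and A: "A \<in> sets (path_sigma adj {0..s})"
    and fin: "emeasure Q A < \<infinity>" and Az: "\<And>\<omega>. \<omega> \<in> A \<Longrightarrow> \<omega> s = z"
begin

lemma restricted_measure:
  assumes "t \<in> {0..1}"
  shows "measure (density Q (indicator A)) {\<omega>\<in>paths adj. \<omega> t = w} = measure Q (A \<inter> {\<omega>\<in>paths adj. \<omega> t = w})"
    and "measure (density Q (indicator A)) (space Q) = measure Q A"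
proof -
  have AQ: "A \<in> sets Q" by (rule jump_law_restrict(2)[OF k Q s(1) A s(2) fin])
  have "{\<omega>\<in>paths adj. \<omega> t = w} \<in> sets Q"
    using Q coordinate_event[OF assms, of adj w] by (simp add: markov_jump_measure_def)
  then show "measure (density Q (indicator A)) {\<omega>\<in>paths adj. \<omega> t = w} = measure Q (A \<inter> {\<omega>\<in>paths adj. \<omega> t = w})"
    using AQ by (simp add: measure_def emeasure_restricted)
  show "measure (density Q (indicator A)) (space Q) = measure Q A"
    using AQ sets.sets_into_space[OF AQ] by (simp add: measure_def emeasure_restricted Int_absorb2)
qed

lemma restricted_measure_start:
  "measure (density Q (indicator A)) {\<omega>\<in>paths adj. \<omega> s = z} = measure Q A"
proof -
  have "A \<inter> {\<omega>\<in>paths adj. \<omega> s = z} = A" using sets.sets_into_space[OF A] Az by auto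
  then show ?thesis using restricted_measure(1)[of s z] s by simp
qed

text \<open>The Lyapunov function \<open>u v = k powr min (d z v) D\<close> with
  \<open>D = d z w\<close>: a jump from \<open>x\<close> to \<open>y\<close> multiplies
  \<open>u\<close> by at most \<open>k powr d x y\<close>, which the slowed rate cancels, so
  \<open>L u \<le> lam * u\<close> for all \<open>k\<close>. The cut at \<open>D\<close> keeps
  \<open>u\<close> bounded. As \<open>u\<close> is 1 at \<open>z\<close> and \<open>k powr D\<close>
  at \<open>w\<close>, Markov's inequality concludes.\<close>

lemma transition_upper:
  assumes t: "s \<le> t" "t \<le> 1"
  shows "measure Q (A \<inter> {\<omega>\<in>paths adj. \<omega> t = w}) \<le> growth * real k powr (- d z w) * measure Q A"
    and "z \<noteq> w \<Longrightarrow> 2 \<le> k \<Longrightarrow> measure Q (A \<inter> {\<omega>\<in>paths adj. \<omega> t = w})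
      \<le> 2 * lam * growth * (t - s) * real k powr (- d z w) * measure Q A"
proof -
  let ?N = "density Q (indicator A)"
  interpret L: jump_law adj "slowed_kernel d J k" lam s ?N
    by (rule jump_law_restrict[OF k Q s(1) A s(2) fin])
  define D where "D = d z w"
  note dd = good_distanceD[OF dist]
  have k1: "1 \<le> real k" using k by simp
  have t01: "t \<in> {0..1}" "s \<in> {0..1}" using t s by auto
  define u where "u v = real k powr (min (d z v) D)" for v
  have u1: "1 \<le> u v" for v
    unfolding u_def using k1 dd(1) by (intro ge_one_powr_ge_zero) (auto simp: D_def)
  have uB: "u v \<le> real k powr D" for v unfolding u_def using k1 by (intro powr_mono) auto
  have abs_u: "\<bar>u v\<bar> \<le> real k powr D" for v using u1[of v] uB[of v] by simp
  have gen: "generator adj (slowed_kernel d J k) r u x \<le> lam * u x" if r: "r \<in> {0..1}" for r x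
  proof -
    have "generator adj (slowed_kernel d J k) r u x \<le> (\<Sum>y | adj x y. J r x y * u x)"
      unfolding generator_def
    proof (rule sum_mono)
      fix y
      have "min (d z y) D \<le> min (d z x) D + d x y"
        using dd(5)[of z y x] dd(1)[of x y] by (auto simp: min_def)
      then have "real k powr (- d x y) * u y \<le> real k powr (- d x y) * real k powr (min (d z x) D + d x y)"
        unfolding u_def using k1 by (intro mult_left_mono powr_mono) auto
      also have "\<dots> = u x" using k1 by (simp add: u_def flip: powr_add)
      finally have "real k powr (- d x y) * (u y - u x) \<le> u x"
        using u1[of x] by (simp add: algebra_simps) (smt (verit) powr_ge_zero mult_nonneg_nonneg)
      then show "slowed_kernel d J k r x y * (u y - u x) \<le> J r x y * u x"
        unfolding slowed_kernel_def using mult_left_mono[OF _ J_nonneg[OF r, of x y]] by (metis mult.assoc mult.commute)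
    qed
    also have "\<dots> = (\<Sum>y | adj x y. J r x y) * u x" by (simp add: sum_distrib_right)
    also have "\<dots> \<le> lam * u x" using J_bound[OF r, of x] u1[of x] by (intro mult_right_mono) auto
    finally show ?thesis .
  qed
  have u0: "0 \<le> u v" for v using u1[of v] by simp
  have iu: "integrable ?N (\<lambda>\<omega>. u (\<omega> r))" if "r \<in> {0..1}" for r by (rule L.integrable_coord[OF that abs_u])
  let ?q = "measure Q (A \<inter> {\<omega>\<in>paths adj. \<omega> t = w})"
  have Eq: "(\<integral>\<omega>. indicator {w} (\<omega> t) \<partial>?N) = ?q"
    using L.coord_prob[OF t01(1)] restricted_measure(1)[OF t01(1)] by simp
  have iw: "integrable ?N (\<lambda>\<omega>. indicator {w} (\<omega> t) :: real)"
    by (rule L.integrable_coord[OF t01(1), where B = 1]) (auto split: split_indicator)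
  have Es: "(\<integral>\<omega>. u (\<omega> s) \<partial>?N) = measure Q A"
  proof -
    have "AE \<omega> in ?N. \<omega> s = z"
    proof -
      have "A \<in> sets Q" by (rule jump_law_restrict(2)[OF k Q s(1) A s(2) fin])
      then show ?thesis by (subst AE_density) (auto simp: Az split: split_indicator_asm)
    qed
    then have "AE \<omega> in ?N. u (\<omega> s) = 1"
      by eventually_elim (use k1 dd(1)[of z w] in \<open>simp add: u_def dd(2) D_def\<close>)
    then have "(\<integral>\<omega>. u (\<omega> s) \<partial>?N) = (\<integral>\<omega>. 1 \<partial>?N)"
      by (rule integral_cong_AE[rotated 2]) (use iu[OF t01(2)] in auto)
    then show ?thesis using restricted_measure(2)[OF t01(1)] by simp
  qed
  have "real k powr D * ?q = (\<integral>\<omega>. real k powr D * indicator {w} (\<omega> t) \<partial>?N)" by (simp add: Eq)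
  also have "\<dots> \<le> (\<integral>\<omega>. u (\<omega> t) \<partial>?N)"
    by (rule integral_mono) (use iu[OF t01(1)] iw u0 in \<open>auto simp: u_def D_def split: split_indicator\<close>)
  also have "\<dots> \<le> growth * measure Q A"
    using L.expectation_growth(1)[OF abs_u u0 t gen growth_exponent] Es by (simp add: growth_def)
  finally show "?q \<le> growth * real k powr (- d z w) * measure Q A"
    using k1 by (simp add: D_def powr_minus field_simps)
  assume zw: "z \<noteq> w" and k2: "2 \<le> k"
  \<comment> \<open>For the bound linear in \<open>t - s\<close>, \<open>u - 1\<close> replaces
    \<open>u\<close>: it vanishes at the start, and at \<open>w\<close> it is still at least half of
    \<open>k powr D\<close> because \<open>k \<ge> 2\<close> and \<open>D \<ge> 1\<close>.\<close>
  have "2 \<le> real k powr D"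
  proof -
    have "2 \<le> real k powr 1" using k2 by simp
    also have "\<dots> \<le> real k powr D" by (rule powr_mono) (use dd(6)[OF zw] k1 in \<open>auto simp: D_def\<close>)
    finally show ?thesis .
  qed
  then have "real k powr D / 2 \<le> real k powr D - 1" by simp
  then have "real k powr D / 2 * ?q \<le> (real k powr D - 1) * ?q" by (rule mult_right_mono) simp
  also have "\<dots> = (\<integral>\<omega>. (real k powr D - 1) * indicator {w} (\<omega> t) \<partial>?N)" by (simp add: Eq)
  also have "\<dots> \<le> (\<integral>\<omega>. u (\<omega> t) - 1 \<partial>?N)"
  proof (rule integral_mono)
    show "(real k powr D - 1) * indicator {w} (\<omega> t) \<le> u (\<omega> t) - 1" for \<omega>
      using u1[of "\<omega> t"] by (auto simp: u_def D_def split: split_indicator)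
  qed (use iu[OF t01(1)] iw in auto)
  also have "\<dots> = (\<integral>\<omega>. u (\<omega> t) \<partial>?N) - (\<integral>\<omega>. u (\<omega> s) \<partial>?N)"
    using iu[OF t01(1)] restricted_measure(2)[OF t01(1)] Es by simp
  also have "\<dots> \<le> lam * (growth * measure Q A) * (t - s)"
    using L.expectation_growth(2)[OF abs_u u0 t gen growth_exponent] Es by (simp add: growth_def)
  finally show "?q \<le> 2 * lam * growth * (t - s) * real k powr (- d z w) * measure Q A"
    using k1 by (simp add: D_def powr_minus field_simps)
qed

lemma transition_lower:
  assumes t: "s \<le> t" "t \<le> 1"
  shows "measure Q A \<le> growth * measure Q (A \<inter> {\<omega>\<in>paths adj. \<omega> t = z})"
    and "adj z v \<Longrightarrow> measure Q A * real k powr (- d z v) * (LBINT r:{s..t}. J r z v)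
      \<le> growth * growth * measure Q (A \<inter> {\<omega>\<in>paths adj. \<omega> t = v})"
proof -
  interpret L: jump_law adj "slowed_kernel d J k" lam s "density Q (indicator A)"
    by (rule jump_law_restrict[OF k Q s(1) A s(2) fin])
  have t01: "t \<in> {0..1}" using t s by auto
  show "measure Q A \<le> growth * measure Q (A \<inter> {\<omega>\<in>paths adj. \<omega> t = z})"
    using L.prob_lower(1)[OF t growth_exponent, of z]
    by (simp add: restricted_measure_start restricted_measure(1)[OF t01] growth_def)
  assume zv: "adj z v"
  then have "z \<noteq> v" using graph by (auto simp: good_graph_def)
  have "(LBINT r:{s..t}. slowed_kernel d J k r z v) = real k powr (- d z v) * (LBINT r:{s..t}. J r z v)"
    unfolding slowed_kernel_def by (rule set_integral_mult_right)
  then show "measure Q A * real k powr (- d z v) * (LBINT r:{s..t}. J r z v)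
      \<le> growth * growth * measure Q (A \<inter> {\<omega>\<in>paths adj. \<omega> t = v})"
    using L.prob_lower(2)[OF t growth_exponent zv \<open>z \<noteq> v\<close>]
    by (simp add: restricted_measure_start restricted_measure(1)[OF t01] growth_def mult.assoc)
qed

end

lemma step_event:
  fixes w :: 'a
  assumes k: "1 \<le> k" and Q: "slowed k Q" and s: "0 \<le> s" "s \<le> t" "t \<le> 1" and A: "A \<in> sets (path_sigma adj {0..s})"
    and fin: "emeasure Q A < \<infinity>"
  defines "B \<equiv> A \<inter> {\<omega>\<in>paths adj. \<omega> t = w}"
  shows "B \<in> sets (path_sigma adj {0..t})" "emeasure Q B < \<infinity>" "\<And>\<omega>. \<omega> \<in> B \<Longrightarrow> \<omega> t = w"
proof -
  show "B \<in> sets (path_sigma adj {0..t})"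
    unfolding B_def using A sets_path_sigma_mono[of "{0..s}" "{0..t}" adj] coordinate_event[of t "{0..t}" adj w] s
    by (intro sets.Int) auto
  have "A \<in> sets Q" by (rule jump_law_restrict(2)[OF k Q s(1) A _ fin]) (use s in auto)
  then have "emeasure Q B \<le> emeasure Q A" unfolding B_def by (intro emeasure_mono) auto
  then show "emeasure Q B < \<infinity>" using fin by simp
qed (simp add: B_def)

text \<open>The lower counterpart, with one constant for all \<open>k\<close>, \<open>Q\<close> and
  \<open>A\<close>. Half of the time is spent on a jump to the geodesic neighbour \<open>v\<close>,
  the other half on the rest of the way; the powers of \<open>k\<close> multiply exactly because
  \<open>d z w = d z v + d v w\<close>. Distances between distinct points are at least 1, so the
  integer part of the distance decreases.\<close>

lemma transition_positive:
  assumes "0 \<le> s" "s < t" "t \<le> 1"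
  shows "\<exists>c>0. \<forall>k Q A. 1 \<le> k \<longrightarrow> slowed k Q \<longrightarrow> A \<in> sets (path_sigma adj {0..s}) \<longrightarrow> emeasure Q A < \<infinity> \<longrightarrow>
    (\<forall>\<omega>\<in>A. \<omega> s = z) \<longrightarrow> c * real k powr (- d z w) * measure Q A \<le> measure Q (A \<inter> {\<omega>\<in>paths adj. \<omega> t = w})"
  using assms(1,2)
proof (induction "nat \<lfloor>d z w\<rfloor>" arbitrary: z s rule: less_induct)
  case less
  note dd = good_distanceD[OF dist]
  show ?case
  proof (cases "z = w")
    case True
    show ?thesis
    proof (intro exI[of _ "1 / growth"] conjI allI impI)
      fix k Q A assume *: "1 \<le> k" "slowed k Q" "A \<in> sets (path_sigma adj {0..s})" "emeasure Q A < \<infinity>" "\<forall>\<omega>\<in>A. \<omega> s = z"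
      have "measure Q A \<le> growth * measure Q (A \<inter> {\<omega>\<in>paths adj. \<omega> t = z})"
        by (rule transition_lower(1)[OF *(1,2) less.prems(1) _ *(3,4)]) (use * less.prems assms in auto)
      then show "1 / growth * real k powr (- d z w) * measure Q A \<le> measure Q (A \<inter> {\<omega>\<in>paths adj. \<omega> t = w})"
        using True growth_pos *(1) by (simp add: dd(2) field_simps)
    qed (use growth_pos in auto)
  next
    case False
    obtain v where v: "adj z v" "d z w = d z v + d v w" using ex_geodesic_neighbour[OF graph dist False] .
    have "z \<noteq> v" using v graph by (auto simp: good_graph_def)
    then have "d v w \<le> d z w - 1" using v(2) dd(6)[of z v] by simp
    then have "\<lfloor>d v w\<rfloor> < \<lfloor>d z w\<rfloor>" by linarith
    moreover have "0 \<le> \<lfloor>d v w\<rfloor>" using dd(1)[of v w] by simp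
    ultimately have smaller: "nat \<lfloor>d v w\<rfloor> < nat \<lfloor>d z w\<rfloor>" by (simp only: nat_less_eq_zless)
    define h where "h = (s + t) / 2"
    have h: "0 \<le> h" "h < t" "s < h" using less.prems by (auto simp: h_def)
    obtain c where c: "0 < c" "\<And>k Q A. 1 \<le> k \<Longrightarrow> slowed k Q \<Longrightarrow> A \<in> sets (path_sigma adj {0..h}) \<Longrightarrow> emeasure Q A < \<infinity> \<Longrightarrow>
        \<forall>\<omega>\<in>A. \<omega> h = v \<Longrightarrow> c * real k powr (- d v w) * measure Q A \<le> measure Q (A \<inter> {\<omega>\<in>paths adj. \<omega> t = w})"
      using less.hyps[OF smaller h(1,2)] by blast
    define I where "I = (LBINT r:{s..h}. J r z v)"
    have I: "0 < I" unfolding I_def by (rule J_integral_pos[OF v(1)]) (use h less.prems assms in auto)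
    show ?thesis
    proof (intro exI[of _ "c * I / (growth * growth)"] conjI allI impI)
      show "0 < c * I / (growth * growth)" using c(1) I growth_pos by simp
      fix k Q A assume *: "1 \<le> k" "slowed k Q" "A \<in> sets (path_sigma adj {0..s})" "emeasure Q A < \<infinity>" "\<forall>\<omega>\<in>A. \<omega> s = z"
      define B where "B = A \<inter> {\<omega>\<in>paths adj. \<omega> h = v}"
      have B: "B \<in> sets (path_sigma adj {0..h})" "emeasure Q B < \<infinity>" "\<And>\<omega>. \<omega> \<in> B \<Longrightarrow> \<omega> h = v"
        unfolding B_def by (rule step_event[OF *(1,2) less.prems(1) _ _ *(3,4)]; use h assms in simp)+
      have "measure Q A * real k powr (- d z v) * I \<le> growth * growth * measure Q B"
        unfolding I_def B_def
        by (rule transition_lower(2)[OF *(1,2) less.prems(1) _ *(3,4)]) (use * h v less.prems assms in auto)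
      then have 1: "measure Q A * real k powr (- d z v) * I / (growth * growth) \<le> measure Q B"
        using growth_pos by (simp add: field_simps)
      have pw: "real k powr (- d z w) = real k powr (- d v w) * real k powr (- d z v)"
        by (simp only: v(2) powr_add[symmetric]) (simp add: algebra_simps)
      have "c * I / (growth * growth) * real k powr (- d z w) * measure Q A
         = c * real k powr (- d v w) * (measure Q A * real k powr (- d z v) * I / (growth * growth))"
        unfolding pw by (simp add: mult_ac)
      also have "\<dots> \<le> c * real k powr (- d v w) * measure Q B"
        by (rule mult_left_mono[OF 1]) (use c(1) in auto)
      also have "\<dots> \<le> measure Q (B \<inter> {\<omega>\<in>paths adj. \<omega> t = w})"
        by (rule c(2)[OF *(1,2) B(1,2)]) (use B(3) in auto)
      also have "\<dots> \<le> measure Q (A \<inter> {\<omega>\<in>paths adj. \<omega> t = w})"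
      proof -
        have "A \<inter> {\<omega>\<in>paths adj. \<omega> t = w} \<in> sets (path_sigma adj {0..t})"
          and fin: "emeasure Q (A \<inter> {\<omega>\<in>paths adj. \<omega> t = w}) < \<infinity>"
          by (rule step_event[OF *(1,2) less.prems(1) _ _ *(3,4)]; use less.prems assms in simp)+
        then have AQ: "A \<inter> {\<omega>\<in>paths adj. \<omega> t = w} \<in> sets Q"
          by (intro jump_law_restrict(2)[OF *(1,2)]) (use less.prems assms in auto)
        have "B \<inter> {\<omega>\<in>paths adj. \<omega> t = w} \<in> sets (path_sigma adj {0..t})"
          and "emeasure Q (B \<inter> {\<omega>\<in>paths adj. \<omega> t = w}) < \<infinity>"
          by (rule step_event[OF *(1,2) h(1) _ _ B(1,2)]; use h assms in simp)+
        then have BQ: "B \<inter> {\<omega>\<in>paths adj. \<omega> t = w} \<in> sets Q"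
          by (intro jump_law_restrict(2)[OF *(1,2)]) (use less.prems assms in auto)
        have "measure Q (B \<inter> {\<omega>\<in>paths adj. \<omega> t = w}) \<le> measure Q (A \<inter> {\<omega>\<in>paths adj. \<omega> t = w})"
          by (rule measure_mono_fmeasurable[OF _ BQ]) (use fin AQ in \<open>auto simp: fmeasurable_def B_def\<close>)
        then show ?thesis .
      qed
      finally show "c * I / (growth * growth) * real k powr (- d z w) * measure Q A \<le> measure Q (A \<inter> {\<omega>\<in>paths adj. \<omega> t = w})" .
    qed
  qed
qed

section \<open>Cells of fixed ends and cylinder events\<close>

definition two_point :: "'a \<Rightarrow> 'a \<Rightarrow> (real \<Rightarrow> 'a) set" where
  "two_point x y = {\<omega>\<in>paths adj. \<omega> 0 = x \<and> \<omega> 1 = y}"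

text \<open>Two intermediate times are enough to detect a detour
  (\<open>d x z + d z w + d w y > d x y\<close>) and a change of state between \<open>a\<close> and
  \<open>b\<close> (\<open>z \<noteq> w\<close>).\<close>

definition four_point :: "'a \<Rightarrow> real \<Rightarrow> 'a \<Rightarrow> real \<Rightarrow> 'a \<Rightarrow> 'a \<Rightarrow> (real \<Rightarrow> 'a) set" where
  "four_point x a z b w y = {\<omega>\<in>paths adj. \<omega> 0 = x \<and> \<omega> a = z \<and> \<omega> b = w \<and> \<omega> 1 = y}"

lemma path_event_sets:
  "t \<in> {0..1} \<Longrightarrow> {\<omega>\<in>paths adj. \<omega> t = x} \<in> sets (path_space adj)"
  by (rule coordinate_event)

lemma two_point_sets: "two_point x y \<in> sets (path_space adj)"
proof -
  have "two_point x y = {\<omega>\<in>paths adj. \<omega> 0 = x} \<inter> {\<omega>\<in>paths adj. \<omega> 1 = y}" by (auto simp: two_point_def)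
  then show ?thesis by (auto intro!: sets.Int path_event_sets)
qed

lemma four_point_eq:
  "four_point x a z b w y = {\<omega>\<in>paths adj. \<omega> 0 = x} \<inter> {\<omega>\<in>paths adj. \<omega> a = z}
    \<inter> {\<omega>\<in>paths adj. \<omega> b = w} \<inter> {\<omega>\<in>paths adj. \<omega> 1 = y}"
  by (auto simp: four_point_def)

lemma four_point_sets: "a \<in> {0..1} \<Longrightarrow> b \<in> {0..1} \<Longrightarrow> four_point x a z b w y \<in> sets (path_space adj)"
  unfolding four_point_eq by (intro sets.Int path_event_sets) auto

lemma initial_event:
  fixes x :: 'a
  assumes Q: "slowed k Q"
  defines "A \<equiv> {\<omega>\<in>paths adj. \<omega> 0 = x}"
  shows "A \<in> sets (path_sigma adj {0..0})" "emeasure Q A < \<infinity>" "measure Q A = m x" "\<And>\<omega>. \<omega> \<in> A \<Longrightarrow> \<omega> 0 = x"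
proof -
  have sQ: "sets Q = sets (path_space adj)" and m0: "marginal Q 0 = point_measure UNIV (\<lambda>x. ennreal (m x))"
    using Q by (auto simp: markov_jump_measure_def)
  have sp: "space Q = paths adj" using sets_eq_imp_space_eq[OF sQ] by simp
  have "emeasure (marginal Q 0) {x} = emeasure Q ((\<lambda>\<omega>. \<omega> 0) -` {x} \<inter> space Q)"
    unfolding marginal_def
    by (rule emeasure_distr) (simp_all add: measurable_cong_sets[OF sQ refl] measurable_coordinate)
  also have "(\<lambda>\<omega>. \<omega> 0) -` {x} \<inter> space Q = A" by (auto simp: A_def sp)
  finally have e: "emeasure Q A = ennreal (m x)"
    by (simp add: m0 emeasure_point_measure_finite2)
  then show "emeasure Q A < \<infinity>" by simp
  show "measure Q A = m x" using e m_pos[of x] by (simp add: measure_def)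
  show "A \<in> sets (path_sigma adj {0..0})" unfolding A_def by (rule coordinate_event) simp
qed (simp add: A_def)

lemma two_point_finite:
  assumes Q: "slowed k Q"
  shows "emeasure Q (two_point x y) < \<infinity>" "two_point x y \<in> sets Q"
proof -
  have sQ: "sets Q = sets (path_space adj)" using Q by (auto simp: markov_jump_measure_def)
  show "two_point x y \<in> sets Q" using two_point_sets by (simp add: sQ)
  have "emeasure Q (two_point x y) \<le> emeasure Q {\<omega>\<in>paths adj. \<omega> 0 = x}"
    by (rule emeasure_mono) (use path_event_sets[of 0 x] in \<open>auto simp: two_point_def sQ\<close>)
  then show "emeasure Q (two_point x y) < \<infinity>" using initial_event(2)[OF Q, where x = x] by simp
qed

lemma two_point_upper:
  assumes k: "1 \<le> k" and Q: "slowed k Q"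
  shows "measure Q (two_point x y) \<le> growth * real k powr (- d x y) * m x"
proof -
  note A = initial_event[OF Q, where x = x]
  have "{\<omega>\<in>paths adj. \<omega> 0 = x} \<inter> {\<omega>\<in>paths adj. \<omega> 1 = y} = two_point x y" by (auto simp: two_point_def)
  then show ?thesis
    using transition_upper(1)[where z = x and s = 0 and A = "{\<omega>\<in>paths adj. \<omega> 0 = x}", OF k Q _ _ A(1,2), where t = 1 and w = y] by (simp add: A(3))
qed

lemma two_point_lower:
  "\<exists>c>0. \<forall>k Q. 1 \<le> k \<longrightarrow> slowed k Q \<longrightarrow> c * real k powr (- d x y) * m x \<le> measure Q (two_point x y)"
proof -
  obtain c where c: "0 < c" "\<And>k Q A. 1 \<le> k \<Longrightarrow> slowed k Q \<Longrightarrow> A \<in> sets (path_sigma adj {0..0}) \<Longrightarrow> emeasure Q A < \<infinity> \<Longrightarrow>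
    (\<forall>\<omega>\<in>A. \<omega> 0 = x) \<Longrightarrow> c * real k powr (- d x y) * measure Q A \<le> measure Q (A \<inter> {\<omega>\<in>paths adj. \<omega> 1 = y})"
    using transition_positive[of 0 1 x y] by auto
  have eq: "{\<omega>\<in>paths adj. \<omega> 0 = x} \<inter> {\<omega>\<in>paths adj. \<omega> 1 = y} = two_point x y" by (auto simp: two_point_def)
  show ?thesis
  proof (intro exI[of _ c] conjI allI impI)
    fix k Q assume *: "1 \<le> k" "slowed k Q"
    show "c * real k powr (- d x y) * m x \<le> measure Q (two_point x y)"
      using c(2)[OF * initial_event(1,2)[OF *(2), where x = x]] by (simp add: initial_event(3)[OF *(2)] eq)
  qed (rule c(1))
qed

text \<open>Each leg is estimated after restriction to the preceding ones. The second form spends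
  the estimate linear in time on the middle leg.\<close>

lemma four_point_upper:
  assumes k: "1 \<le> k" and Q: "slowed k Q" and ab: "0 \<le> a" "a \<le> b" "b \<le> 1"
  shows "measure Q (four_point x a z b w y)
      \<le> growth ^ 3 * real k powr (- (d x z + d z w + d w y)) * m x"
    and "z \<noteq> w \<Longrightarrow> 2 \<le> k \<Longrightarrow> measure Q (four_point x a z b w y)
      \<le> 2 * lam * growth ^ 3 * (b - a) * real k powr (- (d x z + d z w + d w y)) * m x"
proof -
  let ?E = "\<lambda>t x. {\<omega>\<in>paths adj. \<omega> t = x}"
  note A = initial_event[OF Q, where x = x]
  have B: "?E 0 x \<inter> ?E a z \<in> sets (path_sigma adj {0..a})" "emeasure Q (?E 0 x \<inter> ?E a z) < \<infinity>"
    by (rule step_event[OF k Q _ _ _ A(1,2)]; use ab in simp)+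
  have C: "?E 0 x \<inter> ?E a z \<inter> ?E b w \<in> sets (path_sigma adj {0..b})" "emeasure Q (?E 0 x \<inter> ?E a z \<inter> ?E b w) < \<infinity>"
    by (rule step_event[OF k Q _ _ _ B]; use ab in simp)+
  have 1: "measure Q (?E 0 x \<inter> ?E a z) \<le> growth * real k powr (- d x z) * m x"
    using transition_upper(1)[where z = x and s = 0 and A = "{\<omega>\<in>paths adj. \<omega> 0 = x}", OF k Q _ _ A(1,2), where t = a and w = z] ab by (simp add: A(3))
  have 2: "measure Q (?E 0 x \<inter> ?E a z \<inter> ?E b w) \<le> growth * real k powr (- d z w) * measure Q (?E 0 x \<inter> ?E a z)"
    by (rule transition_upper(1)[OF k Q _ _ B]) (use ab in auto)
  have 3: "measure Q (four_point x a z b w y) \<le> growth * real k powr (- d w y) * measure Q (?E 0 x \<inter> ?E a z \<inter> ?E b w)"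
    unfolding four_point_eq by (rule transition_upper(1)[OF k Q _ _ C]) (use ab in auto)
  have pw: "real k powr (- (d x z + d z w + d w y)) = real k powr (- d w y) * (real k powr (- d z w) * real k powr (- d x z))"
    by (simp only: powr_add[symmetric]) (simp add: algebra_simps)
  have g: "0 \<le> growth * real k powr c" for c using growth_pos by simp
  have "measure Q (four_point x a z b w y) \<le> growth * real k powr (- d w y) *
     (growth * real k powr (- d z w) * (growth * real k powr (- d x z) * m x))"
    by (rule order_trans[OF 3 mult_left_mono[OF order_trans[OF 2 mult_left_mono[OF 1 g]] g]])
  then show "measure Q (four_point x a z b w y)
      \<le> growth ^ 3 * real k powr (- (d x z + d z w + d w y)) * m x"
    unfolding pw by (simp add: power3_eq_cube mult_ac)
  assume zw: "z \<noteq> w" "2 \<le> k"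
  have 2: "measure Q (?E 0 x \<inter> ?E a z \<inter> ?E b w) \<le> 2 * lam * growth * (b - a) * real k powr (- d z w) * measure Q (?E 0 x \<inter> ?E a z)"
    by (rule transition_upper(2)[OF k Q _ _ B]) (use ab zw in auto)
  have g': "0 \<le> 2 * lam * growth * (b - a) * real k powr c" for c using growth_pos lam_pos ab by simp
  have "measure Q (four_point x a z b w y) \<le> growth * real k powr (- d w y) *
     (2 * lam * growth * (b - a) * real k powr (- d z w) * (growth * real k powr (- d x z) * m x))"
    by (rule order_trans[OF 3 mult_left_mono[OF order_trans[OF 2 mult_left_mono[OF 1 g']] g]])
  then show "measure Q (four_point x a z b w y)
      \<le> 2 * lam * growth ^ 3 * (b - a) * real k powr (- (d x z + d z w + d w y)) * m x"
    unfolding pw by (simp add: power3_eq_cube mult_ac)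
qed

text \<open>The walk waits at \<open>x\<close> until \<open>a\<close>, jumps to \<open>v\<close> by
  time \<open>b\<close>, waits there until \<open>1 - \<eta>\<close>, and has a time \<eta> left to
  reach \<open>y\<close>. Starting the last leg at \<open>1 - \<eta>\<close> instead of
  \<open>b\<close> makes its constant independent of \<open>a\<close> and \<open>b\<close>.\<close>

lemma four_point_lower:
  assumes \<eta>: "0 < \<eta>" "\<eta> \<le> 1" and xv: "adj x v" and geo: "d x y = d x v + d v y"
  shows "\<exists>c>0. \<forall>k Q a b. 1 \<le> k \<longrightarrow> slowed k Q \<longrightarrow> 0 \<le> a \<longrightarrow> a \<le> b \<longrightarrow> b \<le> 1 - \<eta> \<longrightarrow>
    c * real k powr (- d x y) * m x * (LBINT r:{a..b}. J r x v) \<le> measure Q (four_point x a x b v y)"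
proof -
  let ?E = "\<lambda>t x. {\<omega>\<in>paths adj. \<omega> t = x}"
  define h where "h = 1 - \<eta>"
  have h: "0 \<le> h" "h < 1" using \<eta> by (auto simp: h_def)
  obtain c where c: "0 < c" "\<And>k Q A. 1 \<le> k \<Longrightarrow> slowed k Q \<Longrightarrow> A \<in> sets (path_sigma adj {0..h}) \<Longrightarrow> emeasure Q A < \<infinity> \<Longrightarrow>
    (\<forall>\<omega>\<in>A. \<omega> h = v) \<Longrightarrow> c * real k powr (- d v y) * measure Q A \<le> measure Q (A \<inter> ?E 1 y)"
    using transition_positive[of h 1 v y] h by auto
  \<comment> \<open>One factor \<open>growth\<close> for each of the two waits and two for the
    jump.\<close>
  have "c / growth ^ 4 * real k powr (- d x y) * m x * (LBINT r:{a..b}. J r x v) \<le> measure Q (four_point x a x b v y)"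
    if k: "1 \<le> k" and Q: "slowed k Q" and ab: "0 \<le> a" "a \<le> b" "b \<le> 1 - \<eta>" for k Q a b
  proof -
    have b: "b \<le> h" "b \<le> 1" "a \<le> 1" using ab \<eta> by (auto simp: h_def)
    note A = initial_event[OF Q, where x = x]
    have B: "?E 0 x \<inter> ?E a x \<in> sets (path_sigma adj {0..a})" "emeasure Q (?E 0 x \<inter> ?E a x) < \<infinity>"
      by (rule step_event[OF k Q _ _ _ A(1,2)]; use ab b in simp)+
    have C: "?E 0 x \<inter> ?E a x \<inter> ?E b v \<in> sets (path_sigma adj {0..b})" "emeasure Q (?E 0 x \<inter> ?E a x \<inter> ?E b v) < \<infinity>"
      by (rule step_event[OF k Q _ _ _ B]; use ab b in simp)+
    have D: "?E 0 x \<inter> ?E a x \<inter> ?E b v \<inter> ?E h v \<in> sets (path_sigma adj {0..h})"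
        "emeasure Q (?E 0 x \<inter> ?E a x \<inter> ?E b v \<inter> ?E h v) < \<infinity>"
      by (rule step_event[OF k Q _ _ _ C]; use ab b h in simp)+
    define I where "I = (LBINT r:{a..b}. J r x v)"
    have I0: "0 \<le> I" unfolding I_def by (rule J_integral_nonneg) (use ab b in auto)
    have 1: "m x \<le> growth * measure Q (?E 0 x \<inter> ?E a x)"
      using transition_lower(1)[where z = x and s = 0 and A = "{\<omega>\<in>paths adj. \<omega> 0 = x}", OF k Q _ _ A(1,2), where t = a] ab b by (simp add: A(3))
    have 2: "measure Q (?E 0 x \<inter> ?E a x) * real k powr (- d x v) * I \<le> growth * growth * measure Q (?E 0 x \<inter> ?E a x \<inter> ?E b v)"
      unfolding I_def by (rule transition_lower(2)[OF k Q _ _ B _ _ _ xv]) (use ab b in auto)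
    have 3: "measure Q (?E 0 x \<inter> ?E a x \<inter> ?E b v) \<le> growth * measure Q (?E 0 x \<inter> ?E a x \<inter> ?E b v \<inter> ?E h v)"
      by (rule transition_lower(1)[OF k Q _ _ C]) (use ab b h in auto)
    have 4: "c * real k powr (- d v y) * measure Q (?E 0 x \<inter> ?E a x \<inter> ?E b v \<inter> ?E h v)
       \<le> measure Q (?E 0 x \<inter> ?E a x \<inter> ?E b v \<inter> ?E h v \<inter> ?E 1 y)"
      by (rule c(2)[OF k Q D]) auto
    have sQ: "sets Q = sets (path_space adj)" using Q by (auto simp: markov_jump_measure_def)
    have 5: "measure Q (?E 0 x \<inter> ?E a x \<inter> ?E b v \<inter> ?E h v \<inter> ?E 1 y) \<le> measure Q (four_point x a x b v y)"
    proof (rule measure_mono_fmeasurable)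
      show "?E 0 x \<inter> ?E a x \<inter> ?E b v \<inter> ?E h v \<inter> ?E 1 y \<in> sets Q"
        unfolding sQ by (intro sets.Int path_event_sets) (use ab b h in auto)
      have "four_point x a x b v y \<in> sets Q"
        unfolding sQ by (rule four_point_sets) (use ab b in auto)
      moreover have "emeasure Q (four_point x a x b v y) \<le> emeasure Q (two_point x y)"
        by (rule emeasure_mono) (use two_point_finite(2)[OF Q] in \<open>auto simp: four_point_def two_point_def\<close>)
      ultimately show "four_point x a x b v y \<in> fmeasurable Q"
        using two_point_finite(1)[OF Q, of x y] by (simp add: fmeasurable_def)
    qed (auto simp: four_point_def)
    let ?P = "real k powr (- d x v) * I"
    have P0: "0 \<le> ?P" using I0 by simp
    have "m x * ?P \<le> growth * measure Q (?E 0 x \<inter> ?E a x) * ?P" by (rule mult_right_mono[OF 1 P0])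
    also have "\<dots> = growth * (measure Q (?E 0 x \<inter> ?E a x) * real k powr (- d x v) * I)" by simp
    also have "\<dots> \<le> growth * (growth * growth * (growth * measure Q (?E 0 x \<inter> ?E a x \<inter> ?E b v \<inter> ?E h v)))"
      using growth_pos 2 3 by (intro mult_left_mono order_trans[OF 2] mult_left_mono) auto
    finally have 6: "m x * ?P / growth ^ 4 \<le> measure Q (?E 0 x \<inter> ?E a x \<inter> ?E b v \<inter> ?E h v)"
      using growth_pos by (simp add: field_simps power4_eq_xxxx)
    have pw: "real k powr (- d x y) = real k powr (- d v y) * real k powr (- d x v)"
      by (simp only: geo powr_add[symmetric]) (simp add: algebra_simps)
    have "c / growth ^ 4 * real k powr (- d x y) * m x * I = c * real k powr (- d v y) * (m x * ?P / growth ^ 4)"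
      unfolding pw by (simp add: mult_ac)
    also have "\<dots> \<le> measure Q (four_point x a x b v y)"
      by (rule order_trans[OF mult_left_mono[OF 6] order_trans[OF 4 5]]) (use c(1) in auto)
    finally show ?thesis by (simp add: I_def)
  qed
  then show ?thesis using c(1) growth_pos by (intro exI[of _ "c / growth ^ 4"]) auto
qed

end

section \<open>Schrodinger solutions\<close>

text \<open>The tangent of the convex function \<open>r * ln r\<close> at \<open>s\<close>.\<close>

lemma entropy_tangent: "r * (1 + ln s) - s \<le> r * ln r" if "0 \<le> r" "0 < s" for r s :: real
proof (cases "r = 0")
  case False
  then have r: "0 < r" using that by simp
  have "ln (s / r) \<le> s / r - 1" using r that by (intro ln_le_minus_one) simp
  then have "r * (ln s - ln r) \<le> r * (s / r - 1)" using r that by (intro mult_left_mono) (auto simp: ln_div)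
  then show ?thesis using r by (simp add: algebra_simps)
qed (use that in simp)

text \<open>The same tangent, taken at the new value \<open>t\<close>: the old value
  \<open>c\<close> may be 0, where the slope is infinite.\<close>

lemma entropy_secant: "t * ln t - c * ln c \<le> (t - c) * (1 + ln t)" if "0 \<le> c" "0 < t" for c t :: real
  using entropy_tangent[OF that] by (simp add: algebra_simps)

text \<open>Jensen's inequality on \<open>A\<close>, obtained by integrating the tangent at the mean
  density \<open>c\<close>.\<close>

lemma set_integral_entropy_lower:
  assumes \<rho>[measurable]: "\<rho> \<in> borel_measurable r" and \<rho>0: "\<And>x. 0 \<le> \<rho> x"
    and p: "p = density r (\<lambda>x. ennreal (\<rho> x))" "finite_measure p"
    and A[measurable]: "A \<in> sets r" and finA: "emeasure r A < \<infinity>" and posA: "0 < measure r A"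
    and int: "set_integrable r A (\<lambda>x. \<rho> x * ln (\<rho> x))"
  defines "c \<equiv> measure p A / measure r A"
  shows "measure r A * (c * ln c) \<le> (LINT x:A|r. \<rho> x * ln (\<rho> x))"
proof -
  interpret p: finite_measure p by fact
  have em: "(\<integral>\<^sup>+x. ennreal (indicator A x * \<rho> x) \<partial>r) = ennreal (measure p A)"
  proof -
    have "emeasure p A = (\<integral>\<^sup>+x. ennreal (\<rho> x) * indicator A x \<partial>r)"
      unfolding p(1) by (rule emeasure_density) auto
    also have "\<dots> = (\<integral>\<^sup>+x. ennreal (indicator A x * \<rho> x) \<partial>r)"
      by (rule nn_integral_cong) (auto split: split_indicator)
    finally show ?thesis by (simp add: p.emeasure_eq_measure)
  qed
  have i\<rho>: "integrable r (\<lambda>x. indicator A x * \<rho> x)"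
    by (rule integrableI_nonneg) (use \<rho>0 em in auto)
  have v\<rho>: "(\<integral>x. indicator A x * \<rho> x \<partial>r) = measure p A"
    using em by (subst (asm) nn_integral_eq_integral[OF i\<rho>]) (use \<rho>0 in \<open>auto intro!: integral_nonneg_AE\<close>)
  have i1: "integrable r (indicator A :: _ \<Rightarrow> real)"
    using finA by (simp add: integrable_indicator_iff)
  have bound: "measure p A * (1 + ln s) - s * measure r A \<le> (LINT x:A|r. \<rho> x * ln (\<rho> x))" if s: "0 < s" for s
  proof -
    have "measure p A * (1 + ln s) - s * measure r A
       = (\<integral>x. (1 + ln s) * (indicator A x * \<rho> x) - s * indicator A x \<partial>r)"
    proof -
      have "(\<integral>x. indicator A x \<partial>r) = measure r A"
        using sets.sets_into_space[OF A] by (simp add: Int_absorb2)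
      then show ?thesis
        unfolding Bochner_Integration.integral_diff[OF integrable_mult_right[OF i\<rho>, of "1 + ln s"] integrable_mult_right[OF i1, of s]]
        by (simp add: v\<rho>)
    qed
    also have "\<dots> \<le> (LINT x:A|r. \<rho> x * ln (\<rho> x))"
      unfolding set_lebesgue_integral_def
    proof (rule integral_mono)
      show "integrable r (\<lambda>x. indicator A x *\<^sub>R (\<rho> x * ln (\<rho> x)))"
        using int by (simp add: set_integrable_def)
      show "(1 + ln s) * (indicator A x * \<rho> x) - s * indicator A x \<le> indicator A x *\<^sub>R (\<rho> x * ln (\<rho> x))" for x
        using entropy_tangent[OF \<rho>0[of x] s] by (auto simp: mult.commute split: split_indicator)
    qed (use i\<rho> i1 in auto)
    finally show ?thesis .
  qed
  show ?thesis
  proof (cases "measure p A = 0")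
    case True
    \<comment> \<open>There is no tangent at the mean 0; the tangents at small \<open>s\<close> give
      the bound in the limit.\<close>
    have "- (LINT x:A|r. \<rho> x * ln (\<rho> x)) \<le> 0 + e" if "0 < e" for e
      using bound[of "e / measure r A"] that posA True by simp
    then have "- (LINT x:A|r. \<rho> x * ln (\<rho> x)) \<le> 0" by (rule field_le_epsilon)
    then show ?thesis using True by (simp add: c_def)
  next
    case False
    then have "0 < c" using posA by (simp add: c_def zero_less_measure_iff)
    from bound[OF this] show ?thesis using posA by (simp add: c_def algebra_simps)
  qed
qed

section \<open>Consequences of minimality and uniqueness on cells of fixed ends\<close>

context walk_setting
begin

lemma sets_slowed: "slowed k Q \<Longrightarrow> sets Q = sets (path_space adj)"
  by (simp add: markov_jump_measure_def)

lemma space_slowed: "slowed k Q \<Longrightarrow> space Q = paths adj"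
  using sets_eq_imp_space_eq[OF sets_slowed, of k Q] by simp

lemma slowed_sigma_finite:
  assumes "slowed k Q"
  shows "sigma_finite_measure Q"
proof
  let ?E = "\<lambda>x. {\<omega>\<in>paths adj. \<omega> 0 = x}"
  have "range ?E \<subseteq> sets Q" using path_event_sets[of 0] by (auto simp: sets_slowed[OF assms])
  moreover have "\<Union>(range ?E) = space Q" by (auto simp: space_slowed[OF assms])
  moreover have "emeasure Q (?E x) \<noteq> \<infinity>" for x using initial_event(2)[OF assms, where x = x] by simp
  ultimately show "\<exists>A. countable A \<and> A \<subseteq> sets Q \<and> \<Union> A = space Q \<and> (\<forall>a\<in>A. emeasure Q a \<noteq> \<infinity>)"
    by (intro exI[of _ "range ?E"]) auto
qed

lemma bridgingD:
  assumes "P \<in> bridging_measures adj \<mu>0 \<mu>1"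
  shows "prob_space P" "sets P = sets (path_space adj)" "space P = paths adj" "marginal P 0 = \<mu>0" "marginal P 1 = \<mu>1"
proof -
  show s: "sets P = sets (path_space adj)" using assms by (auto simp: bridging_measures_def space_prob_algebra)
  show "space P = paths adj" using sets_eq_imp_space_eq[OF s] by simp
qed (use assms in \<open>auto simp: bridging_measures_def space_prob_algebra\<close>)

lemma measurable_coord_path:
  assumes "sets P = sets (path_space adj)" "t \<in> {0..1}"
  shows "(\<lambda>\<omega>. \<omega> t) \<in> P \<rightarrow>\<^sub>M count_space UNIV"
  unfolding measurable_cong_sets[OF assms(1) refl] by (rule measurable_coordinate[OF assms(2)])

lemma marginal_eqI:
  assumes P: "sets P = sets (path_space adj)" and P': "sets P' = sets (path_space adj)" and t: "t \<in> {0..1}"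
    and eq: "\<And>u. emeasure P {\<omega>\<in>paths adj. \<omega> t = u} = emeasure P' {\<omega>\<in>paths adj. \<omega> t = u}"
  shows "marginal P t = marginal P' t"
proof -
  have "emeasure (marginal M t) {u} = emeasure M {\<omega>\<in>paths adj. \<omega> t = u}" if M: "sets M = sets (path_space adj)" for M u
  proof -
    have sp: "space M = paths adj" using sets_eq_imp_space_eq[OF M] by simp
    have "emeasure (marginal M t) {u} = emeasure M ((\<lambda>\<omega>. \<omega> t) -` {u} \<inter> space M)"
      unfolding marginal_def by (rule emeasure_distr[OF measurable_coord_path[OF M t]]) simp
    also have "(\<lambda>\<omega>. \<omega> t) -` {u} \<inter> space M = {\<omega>\<in>paths adj. \<omega> t = u}" by (auto simp: sp)
    finally show ?thesis .
  qed
  then show ?thesis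
    by (intro measure_eqI_countable[where A = UNIV]) (use P P' eq in \<open>auto simp: marginal_def\<close>)
qed

lemma ex_two_point_pos:
  assumes P: "prob_space P" "sets P = sets (path_space adj)"
  shows "\<exists>x y. 0 < measure P (two_point x y)"
proof (rule ccontr)
  interpret prob_space P by fact
  have sp: "space P = paths adj" using sets_eq_imp_space_eq[OF P(2)] by simp
  assume "\<not> ?thesis"
  then have "two_point x y \<in> null_sets P" for x y
    using two_point_sets[of x y] by (auto simp: null_sets_def emeasure_eq_measure P(2) zero_less_measure_iff)
  then have "(\<Union>z. two_point (fst z) (snd z)) \<in> null_sets P" by (intro null_sets_UN) auto
  moreover have "(\<Union>z. two_point (fst z) (snd z)) = space P" by (auto simp: two_point_def sp)
  ultimately have "emeasure P (space P) = 0" by auto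
  then show False using emeasure_space_1 by simp
qed

text \<open>
  If the minimal entropy were infinite, every bridging measure would be a minimizer. Redirecting all
  paths from \<open>x\<close> to \<open>y\<close> onto a single one, in two ways, then contradicts uniqueness.
\<close>

lemma schrodinger_finite_entropy:
  assumes S: "schrodinger_solution adj Q \<mu>0 \<mu>1 P" and nontrivial: "\<exists>x y::'a. x \<noteq> y"
  shows "rel_entropy P Q \<noteq> \<infinity>"
proof
  assume inf: "rel_entropy P Q = \<infinity>"
  have Pb: "P \<in> bridging_measures adj \<mu>0 \<mu>1"
    using S by (auto simp: schrodinger_solution_def is_arg_min_def)
  note P = bridgingD[OF Pb]
  interpret prob_space P by (rule P(1))
  have unique: "P' = P" if "P' \<in> bridging_measures adj \<mu>0 \<mu>1" for P'
  proof -
    have "is_arg_min (\<lambda>P. rel_entropy P Q) (\<lambda>P. P \<in> bridging_measures adj \<mu>0 \<mu>1) P'"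
      using S that inf by (auto simp: schrodinger_solution_def is_arg_min_linorder)
    then show ?thesis using S by (auto simp: schrodinger_solution_def)
  qed
  obtain x y where xy: "0 < measure P (two_point x y)" using ex_two_point_pos[OF P(1,2)] by blast
  obtain y' where "y' \<noteq> x" using nontrivial by metis
  then obtain v where v: "adj x v" using ex_geodesic_neighbour[OF graph dist] by metis
  then have xv: "x \<noteq> v" using graph by (auto simp: good_graph_def)
  obtain \<gamma> \<gamma>' s where \<gamma>: "\<gamma> \<in> paths adj" "\<gamma>' \<in> paths adj" "\<gamma> 0 = x" "\<gamma> 1 = y" "\<gamma>' 0 = x" "\<gamma>' 1 = y"
    "s \<in> {0..1}" "\<gamma> s = x" "\<gamma>' s = v"
    using ex_two_paths[OF graph v] by metis
  let ?A = "two_point x y"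
  have A[measurable]: "?A \<in> sets P" by (simp add: P(2) two_point_sets)
  define T where "T \<beta> \<omega> = (if \<omega> \<in> ?A then \<beta> else \<omega>)" for \<beta> \<omega>
  have T: "T \<beta> \<in> P \<rightarrow>\<^sub>M path_space adj" if "\<beta> \<in> paths adj" for \<beta>
  proof -
    have "?A \<inter> space P = ?A" by (auto simp: P(3) two_point_def)
    then show ?thesis
      unfolding T_def by (intro measurable_If_set measurable_const measurable_ident_sets)
        (simp_all add: that P(2) two_point_sets)
  qed
  have redirect: "distr P (path_space adj) (T \<beta>) = P" if \<beta>: "\<beta> \<in> paths adj" "\<beta> 0 = x" "\<beta> 1 = y" for \<beta>
  proof (rule unique)
    have "marginal (distr P (path_space adj) (T \<beta>)) t = marginal P t" if t: "t \<in> {0, 1}" for t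
      unfolding marginal_def
    proof (subst distr_distr)
      show "(\<lambda>\<omega>. \<omega> t) \<in> path_space adj \<rightarrow>\<^sub>M count_space UNIV" using t by (intro measurable_coordinate) auto
      show "distr P (count_space UNIV) ((\<lambda>\<omega>. \<omega> t) \<circ> T \<beta>) = distr P (count_space UNIV) (\<lambda>\<omega>. \<omega> t)"
        by (rule distr_cong) (use \<beta> t in \<open>auto simp: T_def two_point_def\<close>)
    qed (rule T[OF \<beta>(1)])
    then show "distr P (path_space adj) (T \<beta>) \<in> bridging_measures adj \<mu>0 \<mu>1"
      using prob_space_distr[OF T[OF \<beta>(1)]] P(4,5) by (simp add: bridging_measures_def space_prob_algebra)
  qed
  \<comment> \<open>The event that tells the two redirections apart: one gives it mass 0, the other
    the whole mass of the cell.\<close>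
  let ?E = "?A \<inter> {\<omega>\<in>paths adj. \<omega> s = v}"
  have E: "?E \<in> sets (path_space adj)" using two_point_sets path_event_sets[OF \<gamma>(7)] by auto
  have pE: "measure P ?E = measure P (T \<beta> -` ?E \<inter> space P)" if "\<beta> \<in> paths adj" "\<beta> 0 = x" "\<beta> 1 = y" for \<beta>
    using redirect[OF that] measure_distr[OF T[OF that(1)] E] by simp
  have "T \<gamma> -` ?E \<inter> space P = {}" using \<gamma> xv by (auto simp: T_def)
  then have "measure P ?E = 0" using pE[OF \<gamma>(1,3,4)] by simp
  moreover have "T \<gamma>' -` ?E \<inter> space P = ?A"
    using \<gamma> by (auto simp: T_def P(3) two_point_def)
  then have "measure P ?E = measure P ?A" using pE[OF \<gamma>(2,5,6)] by simp
  ultimately show False using xy by simp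
qed

lemma measure_two_point_pos:
  assumes "1 \<le> k" "slowed k Q"
  shows "0 < measure Q (two_point x y)"
proof -
  obtain c where "0 < c" "c * real k powr (- d x y) * m x \<le> measure Q (two_point x y)"
    using two_point_lower[of x y] assms by blast
  moreover have "0 < c * real k powr (- d x y) * m x" using \<open>0 < c\<close> m_pos[of x] assms by simp
  ultimately show ?thesis by linarith
qed

text \<open>The density \<rho> of the overview, as a quotient of masses of cells; the denominator is
  positive by \<open>measure_two_point_pos\<close>.\<close>

definition ratio :: "(real \<Rightarrow> 'a) measure \<Rightarrow> (real \<Rightarrow> 'a) measure \<Rightarrow> 'a \<Rightarrow> 'a \<Rightarrow> real" where
  "ratio Q P x y = measure P (two_point x y) / measure Q (two_point x y)"

context
  fixes k Q \<mu>0 \<mu>1 P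
  assumes k: "1 \<le> k" and Q: "slowed k Q" and S: "schrodinger_solution adj Q \<mu>0 \<mu>1 P"
    and nontrivial: "\<exists>x y::'a. x \<noteq> y"
begin

lemma schrodinger_bridging: "P \<in> bridging_measures adj \<mu>0 \<mu>1"
  using S by (auto simp: schrodinger_solution_def is_arg_min_def)

text \<open>The competitor has density \<open>t x y\<close> on each cell of \<open>F\<close> and
  agrees with \<open>P\<close> elsewhere; the conditions on rows, columns and total keep it a
  probability with the same marginals. Minimality of \<open>P\<close>, and Jensen's inequality on
  each cell, give the first claim. The second is the case in which the competitor averages the
  density of \<open>P\<close> over the cells.\<close>

lemma schrodinger_cell_perturbation:
  fixes t :: "'a \<Rightarrow> 'a \<Rightarrow> real"
  assumes F: "finite F" and t0: "\<And>x y. 0 \<le> t x y"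
    and row: "\<And>u. (\<Sum>(x, y)\<in>F. if x = u then t x y * measure Q (two_point x y) else 0)
      = (\<Sum>(x, y)\<in>F. if x = u then measure P (two_point x y) else 0)"
    and col: "\<And>u. (\<Sum>(x, y)\<in>F. if y = u then t x y * measure Q (two_point x y) else 0)
      = (\<Sum>(x, y)\<in>F. if y = u then measure P (two_point x y) else 0)"
    and total: "(\<Sum>(x, y)\<in>F. t x y * measure Q (two_point x y)) = (\<Sum>(x, y)\<in>F. measure P (two_point x y))"
  defines "h \<equiv> \<lambda>r::real. r * ln r"
  shows "(\<Sum>(x, y)\<in>F. measure Q (two_point x y) * h (ratio Q P x y))
      \<le> (\<Sum>(x, y)\<in>F. measure Q (two_point x y) * h (t x y))"
    and "(\<And>x y. (x, y) \<in> F \<Longrightarrow> t x y = ratio Q P x y) \<Longrightarrow> (x, y) \<in> F \<Longrightarrow> E \<in> sets Q \<Longrightarrow>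
      measure P (two_point x y \<inter> E) = ratio Q P x y * measure Q (two_point x y \<inter> E)"
proof -
  note P = bridgingD[OF schrodinger_bridging]
  note sQ = sets_slowed[OF Q] and spQ = space_slowed[OF Q]
  interpret P: prob_space P by (rule P(1))
  interpret Q: sigma_finite_measure Q by (rule slowed_sigma_finite[OF Q])
  obtain \<rho> where \<rho>[measurable]: "\<rho> \<in> borel_measurable Q" and \<rho>0: "\<And>x. 0 \<le> \<rho> x"
    and P\<rho>: "P = density Q (\<lambda>x. ennreal (\<rho> x))"
    and weight: "emeasure Q (space Q) < \<infinity> \<or> (\<exists>W. entropy_weight P Q W)"
    and int: "integrable P (\<lambda>x. ln (\<rho> x))"
  proof (rule rel_entropy_finiteE)
    show "sigma_finite_measure Q" by (rule slowed_sigma_finite[OF Q])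
    show "rel_entropy P Q \<noteq> \<infinity>" by (rule schrodinger_finite_entropy[OF S nontrivial])
  qed (use P(1,2) sQ in auto)
  define C where "C = (\<Union>(x, y)\<in>F. two_point x y)"
  have cell[measurable]: "two_point x y \<in> sets Q" for x y by (simp add: sQ two_point_sets)
  have C[measurable]: "C \<in> sets Q" unfolding C_def by (rule sets.finite_UN[OF F]) auto
  have C_iff: "\<omega> \<in> C \<longleftrightarrow> \<omega> \<in> paths adj \<and> (\<omega> 0, \<omega> 1) \<in> F" for \<omega>
    by (force simp: C_def two_point_def)
  have finC: "emeasure Q C < \<infinity>"
  proof -
    have "emeasure Q C \<le> (\<Sum>(x, y)\<in>F. emeasure Q (two_point x y))"
      unfolding C_def case_prod_beta by (rule emeasure_subadditive_finite[OF F]) auto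
    also have "\<dots> < \<infinity>" using two_point_finite(1)[OF Q] F by (auto simp: case_prod_beta)
    finally show ?thesis .
  qed
  define g where "g \<omega> = t (\<omega> 0) (\<omega> 1) * indicator C \<omega>" for \<omega> :: "real \<Rightarrow> 'a"
  define B where "B = (\<Sum>(x, y)\<in>F. t x y)"
  have ind: "indicator (two_point (fst z) (snd z)) \<omega> = (if z = (\<omega> 0, \<omega> 1) then 1 else (0::real))"
    if "\<omega> \<in> paths adj" for \<omega> z
    using that by (cases z) (auto simp: two_point_def indicator_def)
  have g_cell: "g \<omega> = (\<Sum>(x, y)\<in>F. t x y * indicator (two_point x y) \<omega>)" if "\<omega> \<in> paths adj" for \<omega>
  proof -
    have "(\<Sum>(x, y)\<in>F. t x y * indicator (two_point x y) \<omega>) = (\<Sum>z\<in>F. if z = (\<omega> 0, \<omega> 1) then t (\<omega> 0) (\<omega> 1) else 0)"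
      by (rule sum.cong) (simp_all add: case_prod_beta ind[OF that])
    also have "\<dots> = (if (\<omega> 0, \<omega> 1) \<in> F then t (\<omega> 0) (\<omega> 1) else 0)" using F by simp
    also have "\<dots> = g \<omega>" using that by (auto simp: g_def C_iff split: split_indicator)
    finally show ?thesis by simp
  qed
  have gm[measurable]: "g \<in> borel_measurable Q"
  proof -
    have "(\<lambda>\<omega>. \<Sum>(x, y)\<in>F. t x y * indicator (two_point x y) \<omega>) \<in> borel_measurable Q"
      by (simp add: case_prod_beta)
    then show ?thesis by (rule measurable_cong[THEN iffD1, rotated]) (simp add: g_cell spQ)
  qed
  have g0: "0 \<le> g \<omega>" for \<omega> by (simp add: g_def t0)
  have gB: "g \<omega> \<le> B" for \<omega>
  proof (cases "\<omega> \<in> C")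
    case True
    then have "(\<omega> 0, \<omega> 1) \<in> F" by (simp add: C_iff)
    then have "(case (\<omega> 0, \<omega> 1) of (x, y) \<Rightarrow> t x y) \<le> B"
      unfolding B_def by (rule member_le_sum) (use F t0 in auto)
    then show ?thesis using True by (simp add: g_def)
  next
    case False
    then show ?thesis using t0 by (auto simp: g_def B_def intro!: sum_nonneg)
  qed
  define p' where "p' = density Q (\<lambda>\<omega>. ennreal (if \<omega> \<in> C then g \<omega> else \<rho> \<omega>))"
  have sp': "sets p' = sets (path_space adj)" by (simp add: p'_def sQ)
  have emp': "emeasure p' E = ennreal (measure P (E - C) + (\<Sum>(x, y)\<in>F. t x y * measure Q (two_point x y \<inter> E)))"
    if E[measurable]: "E \<in> sets Q" for E
  proof -
    have fin: "emeasure Q (two_point x y \<inter> E) = ennreal (measure Q (two_point x y \<inter> E))" for x y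
    proof -
      have "emeasure Q (two_point x y \<inter> E) \<le> emeasure Q (two_point x y)" by (rule emeasure_mono) auto
      then show ?thesis using two_point_finite(1)[OF Q, of x y] by (intro emeasure_eq_ennreal_measure) auto
    qed
    have "emeasure p' E = (\<integral>\<^sup>+\<omega>. ennreal (if \<omega> \<in> C then g \<omega> else \<rho> \<omega>) * indicator E \<omega> \<partial>Q)"
      unfolding p'_def by (rule emeasure_density) auto
    also have "\<dots> = (\<integral>\<^sup>+\<omega>. ennreal (\<rho> \<omega>) * indicator (E - C) \<omega>
        + (\<Sum>(x, y)\<in>F. ennreal (t x y) * indicator (two_point x y \<inter> E) \<omega>) \<partial>Q)"
    proof (rule nn_integral_cong)
      fix \<omega> assume "\<omega> \<in> space Q"
      then have \<omega>: "\<omega> \<in> paths adj" by (simp add: spQ)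
      have "(\<Sum>(x, y)\<in>F. ennreal (t x y) * indicator (two_point x y \<inter> E) \<omega>)
        = (\<Sum>(x, y)\<in>F. ennreal (t x y * indicator (two_point x y) \<omega>)) * indicator E \<omega>"
        by (simp add: sum_distrib_right case_prod_beta) (rule sum.cong, auto split: split_indicator)
      also have "(\<Sum>(x, y)\<in>F. ennreal (t x y * indicator (two_point x y) \<omega>)) = ennreal (g \<omega>)"
        unfolding g_cell[OF \<omega>] case_prod_beta by (rule sum_ennreal) (use t0 in auto)
      finally show "ennreal (if \<omega> \<in> C then g \<omega> else \<rho> \<omega>) * indicator E \<omega> = ennreal (\<rho> \<omega>) * indicator (E - C) \<omega>
        + (\<Sum>(x, y)\<in>F. ennreal (t x y) * indicator (two_point x y \<inter> E) \<omega>)"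
        by (auto simp: g_def split: split_indicator)
    qed
    also have "\<dots> = (\<integral>\<^sup>+\<omega>. ennreal (\<rho> \<omega>) * indicator (E - C) \<omega> \<partial>Q)
        + (\<Sum>(x, y)\<in>F. \<integral>\<^sup>+\<omega>. ennreal (t x y) * indicator (two_point x y \<inter> E) \<omega> \<partial>Q)"
      unfolding case_prod_beta by (subst nn_integral_add, simp, simp, subst nn_integral_sum) auto
    also have "(\<integral>\<^sup>+\<omega>. ennreal (\<rho> \<omega>) * indicator (E - C) \<omega> \<partial>Q) = emeasure P (E - C)"
      unfolding P\<rho> by (rule emeasure_density[symmetric]) auto
    also have "\<dots> = ennreal (measure P (E - C))" by (rule P.emeasure_eq_measure)
    also have "(\<Sum>(x, y)\<in>F. \<integral>\<^sup>+\<omega>. ennreal (t x y) * indicator (two_point x y \<inter> E) \<omega> \<partial>Q)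
       = (\<Sum>(x, y)\<in>F. ennreal (t x y * measure Q (two_point x y \<inter> E)))"
      by (rule sum.cong) (auto simp: nn_integral_cmult_indicator fin ennreal_mult' t0)
    also have "\<dots> = ennreal (\<Sum>(x, y)\<in>F. t x y * measure Q (two_point x y \<inter> E))"
      unfolding case_prod_beta by (rule sum_ennreal) (use t0 in auto)
    finally show ?thesis
      by (subst ennreal_plus) (use t0 in \<open>auto simp: case_prod_beta intro!: sum_nonneg\<close>)
  qed
  have split: "measure P E = measure P (E - C) + (\<Sum>(x, y)\<in>F. measure P (two_point x y \<inter> E))"
    if E: "E \<in> sets Q" for E
  proof -
    have sPQ: "sets P = sets Q" using P(2) sQ by simp
    have "E = (E - C) \<union> (\<Union>(x, y)\<in>F. two_point x y \<inter> E)" by (auto simp: C_def)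
    also have "measure P \<dots> = measure P (E - C) + measure P (\<Union>(x, y)\<in>F. two_point x y \<inter> E)"
    proof (rule P.finite_measure_Union)
      show "E - C \<in> sets P" unfolding sPQ using E C by (rule sets.Diff)
      show "(\<Union>(x, y)\<in>F. two_point x y \<inter> E) \<in> sets P"
        unfolding sPQ case_prod_beta by (intro sets.finite_UN[OF F] sets.Int cell E)
    qed (auto simp: C_def)
    also have "measure P (\<Union>(x, y)\<in>F. two_point x y \<inter> E) = (\<Sum>(x, y)\<in>F. measure P (two_point x y \<inter> E))"
      unfolding case_prod_beta
      by (rule P.finite_measure_finite_Union[OF F])
        (use E cell sPQ in \<open>auto simp: disjoint_family_on_def two_point_def\<close>)
    finally show ?thesis .
  qed
  have eq_of_sums: "emeasure p' E = emeasure P E"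
    if "E \<in> sets Q" "(\<Sum>(x, y)\<in>F. t x y * measure Q (two_point x y \<inter> E)) = (\<Sum>(x, y)\<in>F. measure P (two_point x y \<inter> E))" for E
    using emp'[OF that(1)] split[OF that(1)] that(2) by (simp add: P.emeasure_eq_measure)
  have restrict0: "two_point x y \<inter> {\<omega>\<in>paths adj. \<omega> 0 = u} = (if x = u then two_point x y else {})"
    and restrict1: "two_point x y \<inter> {\<omega>\<in>paths adj. \<omega> 1 = u} = (if y = u then two_point x y else {})"
    and restrictS: "two_point x y \<inter> paths adj = two_point x y" for x y u
    by (auto simp: two_point_def)
  have "marginal p' 0 = marginal P 0"
  proof (rule marginal_eqI[OF sp' P(2)])
    fix u
    have "(\<Sum>(x, y)\<in>F. t x y * measure Q (two_point x y \<inter> {\<omega>\<in>paths adj. \<omega> 0 = u}))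
      = (\<Sum>(x, y)\<in>F. if x = u then t x y * measure Q (two_point x y) else 0)"
      unfolding restrict0 by (rule sum.cong) auto
    also have "\<dots> = (\<Sum>(x, y)\<in>F. measure P (two_point x y \<inter> {\<omega>\<in>paths adj. \<omega> 0 = u}))"
      unfolding row restrict0 by (rule sum.cong) auto
    finally show "emeasure p' {\<omega>\<in>paths adj. \<omega> 0 = u} = emeasure P {\<omega>\<in>paths adj. \<omega> 0 = u}"
      by (intro eq_of_sums) (auto simp: sQ intro!: path_event_sets)
  qed auto
  moreover have "marginal p' 1 = marginal P 1"
  proof (rule marginal_eqI[OF sp' P(2)])
    fix u
    have "(\<Sum>(x, y)\<in>F. t x y * measure Q (two_point x y \<inter> {\<omega>\<in>paths adj. \<omega> 1 = u}))
      = (\<Sum>(x, y)\<in>F. if y = u then t x y * measure Q (two_point x y) else 0)"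
      unfolding restrict1 by (rule sum.cong) auto
    also have "\<dots> = (\<Sum>(x, y)\<in>F. measure P (two_point x y \<inter> {\<omega>\<in>paths adj. \<omega> 1 = u}))"
      unfolding col restrict1 by (rule sum.cong) auto
    finally show "emeasure p' {\<omega>\<in>paths adj. \<omega> 1 = u} = emeasure P {\<omega>\<in>paths adj. \<omega> 1 = u}"
      by (intro eq_of_sums) (auto simp: sQ intro!: path_event_sets)
  qed auto
  moreover have prob': "prob_space p'"
  proof
    have "emeasure p' (paths adj) = emeasure P (paths adj)"
      by (rule eq_of_sums) (use total sets.top[of Q] in \<open>auto simp: restrictS spQ\<close>)
    then show "emeasure p' (space p') = 1"
      using P.emeasure_space_1 by (simp add: P(3) p'_def spQ)
  qed
  ultimately have p'b: "p' \<in> bridging_measures adj \<mu>0 \<mu>1"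
    using sp' P(4,5) by (simp add: bridging_measures_def space_prob_algebra)
  note rep = rel_entropy_replace_density[OF slowed_sigma_finite[OF Q] \<rho> \<rho>0 P\<rho> P(1) weight int C finC gm g0 gB p'_def prob']
  have min: "rel_entropy P Q \<le> rel_entropy p' Q"
    using S p'b by (auto simp: schrodinger_solution_def is_arg_min_linorder)
  have le: "(LINT x:C|Q. \<rho> x * ln (\<rho> x)) \<le> (LINT x:C|Q. g x * ln (g x))"
    using min rep(1,3) by simp
  have cellfin: "emeasure Q (two_point x y) < \<infinity>" for x y by (rule two_point_finite[OF Q])
  have icell: "set_integrable Q (two_point x y) (\<lambda>x. \<rho> x * ln (\<rho> x))" if "(x, y) \<in> F" for x y
    by (rule set_integrable_subset[OF rep(2)]) (use that in \<open>auto simp: C_def\<close>)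
  have sumC: "(LINT x:C|Q. f x) = (\<Sum>(x, y)\<in>F. LINT \<omega>:two_point x y|Q. f \<omega>)"
    if i: "\<And>x y. (x, y) \<in> F \<Longrightarrow> set_integrable Q (two_point x y) f" for f :: "(real \<Rightarrow> 'a) \<Rightarrow> real"
  proof -
    have "(LINT x:C|Q. f x) = (\<integral>\<omega>. (\<Sum>(x, y)\<in>F. indicator (two_point x y) \<omega> *\<^sub>R f \<omega>) \<partial>Q)"
      unfolding set_lebesgue_integral_def
    proof (rule Bochner_Integration.integral_cong)
      fix \<omega> assume "\<omega> \<in> space Q"
      then have \<omega>: "\<omega> \<in> paths adj" by (simp add: spQ)
      have "(\<Sum>(x, y)\<in>F. indicator (two_point x y) \<omega> *\<^sub>R f \<omega>) = (\<Sum>z\<in>F. if z = (\<omega> 0, \<omega> 1) then f \<omega> else 0)"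
        by (rule sum.cong) (simp_all add: case_prod_beta ind[OF \<omega>])
      also have "\<dots> = (if (\<omega> 0, \<omega> 1) \<in> F then f \<omega> else 0)" using F by simp
      finally show "indicator C \<omega> *\<^sub>R f \<omega> = (\<Sum>(x, y)\<in>F. indicator (two_point x y) \<omega> *\<^sub>R f \<omega>)"
        using \<omega> by (auto simp: C_iff split: split_indicator)
    qed simp
    also have "\<dots> = (\<Sum>(x, y)\<in>F. LINT \<omega>:two_point x y|Q. f \<omega>)"
      unfolding set_lebesgue_integral_def case_prod_beta
      by (rule Bochner_Integration.integral_sum) (use i in \<open>auto simp: set_integrable_def\<close>)
    finally show ?thesis .
  qed
  have gcell: "(LINT \<omega>:two_point x y|Q. g \<omega> * ln (g \<omega>)) = measure Q (two_point x y) * h (t x y)"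
    "set_integrable Q (two_point x y) (\<lambda>\<omega>. g \<omega> * ln (g \<omega>))" if "(x, y) \<in> F" for x y
  proof -
    have eq: "indicator (two_point x y) \<omega> *\<^sub>R (g \<omega> * ln (g \<omega>)) = indicator (two_point x y) \<omega> *\<^sub>R h (t x y)" for \<omega>
      using that by (auto simp: two_point_def g_def C_iff h_def split: split_indicator)
    show "(LINT \<omega>:two_point x y|Q. g \<omega> * ln (g \<omega>)) = measure Q (two_point x y) * h (t x y)"
      unfolding set_lebesgue_integral_def eq using cellfin[of x y]
      by (subst integral_scaleR_left) (auto simp: integrable_indicator_iff)
    show "set_integrable Q (two_point x y) (\<lambda>\<omega>. g \<omega> * ln (g \<omega>))"
      unfolding set_integrable_def eq using cellfin[of x y]
      by (intro integrable_scaleR_left) (auto simp: integrable_indicator_iff)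
  qed
  have gsum: "(LINT x:C|Q. g x * ln (g x)) = (\<Sum>(x, y)\<in>F. measure Q (two_point x y) * h (t x y))"
    by (subst sumC) (use gcell in \<open>auto intro!: sum.cong\<close>)
  have jensen: "(\<Sum>(x, y)\<in>F. measure Q (two_point x y) * h (ratio Q P x y)) \<le> (LINT x:C|Q. \<rho> x * ln (\<rho> x))"
  proof (subst sumC)
    show "set_integrable Q (two_point x y) (\<lambda>x. \<rho> x * ln (\<rho> x))" if "(x, y) \<in> F" for x y by (rule icell[OF that])
    show "(\<Sum>(x, y)\<in>F. measure Q (two_point x y) * h (ratio Q P x y)) \<le> (\<Sum>(x, y)\<in>F. LINT \<omega>:two_point x y|Q. \<rho> \<omega> * ln (\<rho> \<omega>))"
    proof (rule sum_mono)
      fix z assume z: "z \<in> F"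
      have "measure Q (two_point (fst z) (snd z)) * h (ratio Q P (fst z) (snd z))
        \<le> (LINT \<omega>:two_point (fst z) (snd z)|Q. \<rho> \<omega> * ln (\<rho> \<omega>))"
        unfolding h_def ratio_def
        by (rule set_integral_entropy_lower[OF \<rho> \<rho>0 P\<rho> P.finite_measure_axioms cell cellfin measure_two_point_pos[OF k Q] icell])
          (use z in simp)
      then show "(case z of (x, y) \<Rightarrow> measure Q (two_point x y) * h (ratio Q P x y))
        \<le> (case z of (x, y) \<Rightarrow> LINT \<omega>:two_point x y|Q. \<rho> \<omega> * ln (\<rho> \<omega>))"
        by (simp add: case_prod_beta)
    qed
  qed
  show "(\<Sum>(x, y)\<in>F. measure Q (two_point x y) * h (ratio Q P x y))
      \<le> (\<Sum>(x, y)\<in>F. measure Q (two_point x y) * h (t x y))"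
    using jensen le gsum by simp
  assume teq: "\<And>x y. (x, y) \<in> F \<Longrightarrow> t x y = ratio Q P x y" and xy: "(x, y) \<in> F" and E: "E \<in> sets Q"
  have "(\<Sum>(x, y)\<in>F. measure Q (two_point x y) * h (t x y)) = (\<Sum>(x, y)\<in>F. measure Q (two_point x y) * h (ratio Q P x y))"
    by (rule sum.cong) (use teq in auto)
  \<comment> \<open>Averaging does not increase the entropy, so the competitor is a minimizer too,
    and uniqueness identifies it with \<open>P\<close>.\<close>
  then have "rel_entropy p' Q \<le> rel_entropy P Q" using jensen gsum rep(1,3) by simp
  then have "is_arg_min (\<lambda>P. rel_entropy P Q) (\<lambda>P. P \<in> bridging_measures adj \<mu>0 \<mu>1) p'"
    using S p'b by (auto simp: schrodinger_solution_def is_arg_min_linorder intro: order_trans)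
  then have "p' = P" using S by (auto simp: schrodinger_solution_def)
  let ?D = "two_point x y \<inter> E"
  have D: "?D \<in> sets Q" using E by auto
  have DC: "?D - C = {}" using xy by (auto simp: C_def)
  have sumD: "(\<Sum>(x', y')\<in>F. t x' y' * measure Q (two_point x' y' \<inter> ?D)) = t x y * measure Q ?D"
  proof -
    have "(\<Sum>(x', y')\<in>F. t x' y' * measure Q (two_point x' y' \<inter> ?D)) = (\<Sum>z\<in>F. if z = (x, y) then t x y * measure Q ?D else 0)"
    proof (rule sum.cong)
      fix z assume "z \<in> F"
      obtain x' y' where z: "z = (x', y')" by (cases z)
      have "two_point x' y' \<inter> ?D = (if z = (x, y) then ?D else {})"
        by (auto simp: z two_point_def)
      then show "(case z of (x', y') \<Rightarrow> t x' y' * measure Q (two_point x' y' \<inter> ?D)) = (if z = (x, y) then t x y * measure Q ?D else 0)"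
        by (auto simp: z)
    qed simp
    also have "\<dots> = t x y * measure Q ?D" using F xy by (simp add: sum.delta)
    finally show ?thesis .
  qed
  have "emeasure P ?D = ennreal (t x y * measure Q ?D)"
    using emp'[OF D] unfolding \<open>p' = P\<close> DC sumD by simp
  then have "measure P ?D = t x y * measure Q ?D" using t0 by (simp add: measure_def enn2real_ennreal)
  then show "measure P (two_point x y \<inter> E) = ratio Q P x y * measure Q (two_point x y \<inter> E)"
    using teq[OF xy] by simp
qed

lemma ratio_nonneg: "0 \<le> ratio Q P x y"
  by (simp add: ratio_def)

lemma ratio_times: "ratio Q P x y * measure Q (two_point x y) = measure P (two_point x y)"
  using measure_two_point_pos[OF k Q, of x y] by (simp add: ratio_def)

text \<open>A single cell that keeps its mass: the constraints on the marginals hold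
  trivially.\<close>

lemma schrodinger_bridge:
  assumes "E \<in> sets Q"
  shows "measure P (two_point x y \<inter> E) = ratio Q P x y * measure Q (two_point x y \<inter> E)"
  by (rule schrodinger_cell_perturbation(2)[of "{(x, y)}" "ratio Q P"])
    (use assms in \<open>auto simp: ratio_times ratio_nonneg\<close>)

text \<open>Mass \<open>e\<close> is moved from \<open>(x, y)\<close> and \<open>(x', y')\<close> to
  \<open>(x, y')\<close> and \<open>(x', y)\<close>, which keeps all marginals. The tangents at the
  perturbed densities bound the change of entropy by \<open>e\<close> times a combination of
  logarithms; minimality makes it nonnegative, and \<open>e\<close> tends to 0.\<close>

lemma ratio_exchange_le:
  assumes pos: "0 < ratio Q P x y" "0 < ratio Q P x' y'"
  shows "ratio Q P x y * ratio Q P x' y' \<le> ratio Q P x y' * ratio Q P x' y"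
proof (cases "x = x' \<or> y = y'")
  case False
  then have ne: "x \<noteq> x'" "y \<noteq> y'" by auto
  let ?c = "ratio Q P" and ?q = "\<lambda>x y. measure Q (two_point x y)"
  have qpos: "0 < ?q u v" for u v by (rule measure_two_point_pos[OF k Q])
  define F where "F = {(x, y), (x', y'), (x, y'), (x', y)}"
  \<comment> \<open>The bounds on \<open>e\<close> keep the two donor cells positive; the two
    receiving cells become positive even if they were empty, so that all logarithms make
    sense.\<close>
  have bound: "(?c x y - e / ?q x y) * (?c x' y' - e / ?q x' y') \<le> (?c x y' + e / ?q x y') * (?c x' y + e / ?q x' y)"
    if e: "0 < e" "e < ?c x y * ?q x y" "e < ?c x' y' * ?q x' y'" for e
  proof -
    define \<sigma> where "\<sigma> u v = (if (u, v) = (x, y) \<or> (u, v) = (x', y') then - e else e)" for u v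
    define t where "t u v = (if (u, v) \<in> F then ?c u v + \<sigma> u v / ?q u v else 0)" for u v
    have tpos: "0 < t u v" if "(u, v) \<in> F" for u v
      using that e qpos[of u v] ne ratio_nonneg[of u v]
      by (auto simp: F_def t_def \<sigma>_def field_simps add_pos_nonneg add_nonneg_pos)
    have t0: "0 \<le> t u v" for u v using tpos[of u v] by (cases "(u, v) \<in> F") (auto simp: t_def)
    have tq: "t u v * ?q u v = measure P (two_point u v) + \<sigma> u v" if "(u, v) \<in> F" for u v
      using that qpos[of u v] ratio_times[of u v] by (simp add: t_def distrib_right)
    have inF: "(x, y) \<in> F" "(x', y') \<in> F" "(x, y') \<in> F" "(x', y) \<in> F" by (auto simp: F_def)
    note sums = tq[OF inF(1)] tq[OF inF(2)] tq[OF inF(3)] tq[OF inF(4)]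
    have sumF: "(\<Sum>z\<in>F. f z) = f (x, y) + f (x', y') + f (x, y') + f (x', y)" for f :: "'a \<times> 'a \<Rightarrow> real"
      using ne by (simp add: F_def)
    have \<sigma>: "\<sigma> x y = - e" "\<sigma> x' y' = - e" "\<sigma> x y' = e" "\<sigma> x' y = e" using ne by (auto simp: \<sigma>_def)
    let ?h = "\<lambda>r::real. r * ln r"
    have "(\<Sum>(x, y)\<in>F. ?q x y * ?h (?c x y)) \<le> (\<Sum>(x, y)\<in>F. ?q x y * ?h (t x y))"
    proof (rule schrodinger_cell_perturbation(1))
      show "finite F" by (simp add: F_def)
      show "0 \<le> t x y" for x y by (rule t0)
      show "(\<Sum>(x, y)\<in>F. if x = u then t x y * ?q x y else 0) = (\<Sum>(x, y)\<in>F. if x = u then measure P (two_point x y) else 0)" for u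
        unfolding sumF using ne sums[unfolded \<sigma>] by auto
      show "(\<Sum>(x, y)\<in>F. if y = u then t x y * ?q x y else 0) = (\<Sum>(x, y)\<in>F. if y = u then measure P (two_point x y) else 0)" for u
        unfolding sumF using ne sums[unfolded \<sigma>] by auto
      show "(\<Sum>(x, y)\<in>F. t x y * ?q x y) = (\<Sum>(x, y)\<in>F. measure P (two_point x y))"
        unfolding sumF by (simp add: sums \<sigma>)
    qed
    then have "0 \<le> (\<Sum>(x, y)\<in>F. ?q x y * (?h (t x y) - ?h (?c x y)))"
      by (simp add: case_prod_beta right_diff_distrib sum_subtractf)
    also have "\<dots> \<le> (\<Sum>(x, y)\<in>F. \<sigma> x y * (1 + ln (t x y)))"
    proof (rule sum_mono)
      fix z assume z: "z \<in> F"
      obtain u v where uv: "z = (u, v)" by (cases z)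
      have "?q u v * (?h (t u v) - ?h (?c u v)) \<le> ?q u v * ((t u v - ?c u v) * (1 + ln (t u v)))"
        by (rule mult_left_mono[OF entropy_secant]) (use tpos z uv ratio_nonneg qpos[of u v] in auto)
      also have "\<dots> = (t u v * ?q u v - ?c u v * ?q u v) * (1 + ln (t u v))" by (simp add: algebra_simps)
      also have "t u v * ?q u v - ?c u v * ?q u v = \<sigma> u v" using tq z uv ratio_times[of u v] by simp
      finally show "(case z of (x, y) \<Rightarrow> ?q x y * (?h (t x y) - ?h (?c x y))) \<le> (case z of (x, y) \<Rightarrow> \<sigma> x y * (1 + ln (t x y)))"
        by (simp add: uv)
    qed
    also have "\<dots> = e * (ln (t x y') + ln (t x' y) - ln (t x y) - ln (t x' y'))"
      unfolding sumF by (simp add: \<sigma> algebra_simps)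
    finally have "ln (t x y) + ln (t x' y') \<le> ln (t x y') + ln (t x' y)" using e(1) by (simp add: zero_le_mult_iff)
    then have "ln (t x y * t x' y') \<le> ln (t x y' * t x' y)"
      using tpos[OF inF(1)] tpos[OF inF(2)] tpos[OF inF(3)] tpos[OF inF(4)] by (simp add: ln_mult)
    then have "t x y * t x' y' \<le> t x y' * t x' y"
      using tpos[OF inF(1)] tpos[OF inF(2)] tpos[OF inF(3)] tpos[OF inF(4)] by (subst (asm) ln_le_cancel_iff) auto
    then show ?thesis using inF by (simp add: t_def \<sigma>)
  qed
  have "\<forall>\<^sub>F e in at_right 0. (?c x y - e / ?q x y) * (?c x' y' - e / ?q x' y') \<le> (?c x y' + e / ?q x y') * (?c x' y + e / ?q x' y)"
  proof -
    have "0 < min (?c x y * ?q x y) (?c x' y' * ?q x' y')" using pos qpos by simp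
    then show ?thesis unfolding eventually_at_right_field
      by (intro exI[of _ "min (?c x y * ?q x y) (?c x' y' * ?q x' y')"]) (auto intro!: bound)
  qed
  moreover have "((\<lambda>e. (?c x y - e / ?q x y) * (?c x' y' - e / ?q x' y')) \<longlongrightarrow> (?c x y - 0 / ?q x y) * (?c x' y' - 0 / ?q x' y')) (at_right 0)"
    "((\<lambda>e. (?c x y' + e / ?q x y') * (?c x' y + e / ?q x' y)) \<longlongrightarrow> (?c x y' + 0 / ?q x y') * (?c x' y + 0 / ?q x' y)) (at_right 0)"
    by (intro tendsto_intros; use qpos in \<open>simp add: less_imp_neq[symmetric]\<close>)+
  ultimately show ?thesis
    by (auto dest: tendsto_le[rotated 1])
qed auto

text \<open>The inequality first shows that the two crossed ratios are positive; then it applies to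
  them and yields its own converse.\<close>

lemma ratio_exchange:
  assumes pos: "0 < ratio Q P x y" "0 < ratio Q P x' y'"
  shows "0 < ratio Q P x y'" and "ratio Q P x y * ratio Q P x' y' = ratio Q P x y' * ratio Q P x' y"
proof -
  have le: "ratio Q P x y * ratio Q P x' y' \<le> ratio Q P x y' * ratio Q P x' y"
    by (rule ratio_exchange_le[OF pos])
  have "0 < ratio Q P x y * ratio Q P x' y'" using pos by simp
  then have "0 < ratio Q P x y' * ratio Q P x' y" using le by linarith
  then have p: "0 < ratio Q P x y'" "0 < ratio Q P x' y"
    using ratio_nonneg[of x y'] ratio_nonneg[of x' y] by (auto simp: zero_less_mult_iff)
  show "0 < ratio Q P x y'" by (rule p(1))
  show "ratio Q P x y * ratio Q P x' y' = ratio Q P x y' * ratio Q P x' y"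
    using le ratio_exchange_le[OF p] by simp
qed

end

end

section \<open>Narrow limits\<close>

lemma topspace_skorokhod [simp]: "topspace (skorokhod_topology adj) = paths adj"
proof -
  have "openin (skorokhod_topology adj) (paths adj)"
    by (auto simp: openin_skorokhod_topology skorokhod_ball_def intro!: exI[of _ 1])
  then have "paths adj \<subseteq> topspace (skorokhod_topology adj)" by (rule openin_subset)
  moreover have "topspace (skorokhod_topology adj) \<subseteq> paths adj"
    using openin_topspace[of "skorokhod_topology adj"] unfolding openin_skorokhod_topology by simp
  ultimately show ?thesis by simp
qed

text \<open>Open sets are defined by balls: if the preimage of \<open>U\<close> failed to be open at
  \<omega>, each ball of radius \<open>1 / (n + 1)\<close> would contain a path whose value escapes
  \<open>U\<close>.\<close>

lemma skorokhod_continuousI: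
  assumes seq: "\<And>\<omega> W. \<omega> \<in> paths adj \<Longrightarrow> (\<And>n. W n \<in> skorokhod_ball adj \<omega> (1 / (real n + 1))) \<Longrightarrow>
    (\<lambda>n. f (W n)) \<longlonglongrightarrow> f \<omega>"
  shows "continuous_map (skorokhod_topology adj) euclideanreal f"
  unfolding continuous_map_def
proof (intro conjI allI impI)
  fix U assume U: "openin euclideanreal U"
  show "openin (skorokhod_topology adj) {\<omega> \<in> topspace (skorokhod_topology adj). f \<omega> \<in> U}"
    unfolding openin_skorokhod_topology
  proof (intro conjI ballI)
    fix \<omega> assume \<omega>: "\<omega> \<in> {\<omega> \<in> topspace (skorokhod_topology adj). f \<omega> \<in> U}"
    show "\<exists>e>0. skorokhod_ball adj \<omega> e \<subseteq> {\<omega> \<in> topspace (skorokhod_topology adj). f \<omega> \<in> U}"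
    proof (rule ccontr)
      assume contra: "\<not> ?thesis"
      have "\<exists>\<omega>'. \<omega>' \<in> skorokhod_ball adj \<omega> (1 / (real n + 1)) \<and> f \<omega>' \<notin> U" for n :: nat
      proof -
        have "\<not> skorokhod_ball adj \<omega> (1 / (real n + 1)) \<subseteq> {\<omega> \<in> topspace (skorokhod_topology adj). f \<omega> \<in> U}"
        proof -
          have "0 < 1 / (real n + 1)" by simp
          with contra show ?thesis by blast
        qed
        then show ?thesis by (auto simp: skorokhod_ball_def)
      qed
      then obtain W where W: "\<And>n. W n \<in> skorokhod_ball adj \<omega> (1 / (real n + 1))" "\<And>n. f (W n) \<notin> U"
        by metis
      have "(\<lambda>n. f (W n)) \<longlonglongrightarrow> f \<omega>" by (rule seq) (use \<omega> W in auto)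
      then have "\<forall>\<^sub>F n in sequentially. f (W n) \<in> U"
        by (rule topological_tendstoD) (use U \<omega> in auto)
      then show False using W(2) by (auto simp: eventually_sequentially)
    qed
  qed auto
qed auto

lemma time_warp_ends:
  assumes "\<theta> \<in> time_warps"
  shows "\<theta> 0 = 0" "\<theta> 1 = 1"
proof -
  have sm: "strict_mono_on {0..1} \<theta>" and im: "\<theta> ` {0..1} = {0..1}" using assms by (auto simp: time_warps_def)
  have mono: "\<theta> a \<le> \<theta> b" if "0 \<le> a" "a \<le> b" "b \<le> 1" for a b
    using strict_mono_onD[OF sm, of a b] that by (cases "a = b") auto
  have "0 \<in> \<theta> ` {0..1}" "1 \<in> \<theta> ` {0..1}" unfolding im by auto
  then obtain a b where ab: "a \<in> {0..1}" "\<theta> a = 0" "b \<in> {0..1}" "\<theta> b = 1" by fastforce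
  have "\<theta> 0 \<in> {0..1}" "\<theta> 1 \<in> {0..1}" using im by auto
  then show "\<theta> 0 = 0" "\<theta> 1 = 1" using mono[of 0 a] mono[of b 1] ab by auto
qed

lemma skorokhod_ball_ends:
  assumes "\<omega>' \<in> skorokhod_ball adj \<omega> e"
  shows "\<omega>' \<in> paths adj" "\<omega>' 0 = \<omega> 0" "\<omega>' 1 = \<omega> 1"
proof -
  obtain \<theta> where \<theta>: "\<theta> \<in> time_warps" "\<forall>t\<in>{0..1}. \<omega>' (\<theta> t) = \<omega> t" and p: "\<omega>' \<in> paths adj"
    using assms by (auto simp: skorokhod_ball_def)
  show "\<omega>' \<in> paths adj" by (rule p)
  have "\<omega>' (\<theta> 0) = \<omega> 0" "\<omega>' (\<theta> 1) = \<omega> 1" using \<theta>(2) by auto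
  then show "\<omega>' 0 = \<omega> 0" "\<omega>' 1 = \<omega> 1" using time_warp_ends[OF \<theta>(1)] by auto
qed

text \<open>\<open>W n\<close> takes at \<open>s\<close> a value of \<omega> at a time closer to
  \<open>s\<close> than the radius, and \<omega> is constant near a time without jump.\<close>

lemma skorokhod_pointwise:
  assumes \<omega>: "\<omega> \<in> paths adj" and W: "\<And>n. W n \<in> skorokhod_ball adj \<omega> (1 / (real n + 1))"
    and s: "0 < s" "s < 1" "s \<notin> jump_times \<omega>"
  shows "\<forall>\<^sub>F n in sequentially. W n s = \<omega> s"
proof -
  obtain e where e: "0 < e" "\<And>u. u \<noteq> s \<Longrightarrow> dist u s < e \<Longrightarrow> \<omega> u = \<omega> s"
    using eventually_at_path[OF \<omega> s] by (auto simp: eventually_at)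
  obtain m :: nat where m: "1 / e < real m" using reals_Archimedean2 by blast
  have "W n s = \<omega> s" if n: "m \<le> n" for n
  proof -
    obtain \<theta> where \<theta>: "\<theta> \<in> time_warps" "\<forall>t\<in>{0..1}. \<bar>\<theta> t - t\<bar> < 1 / (real n + 1)" "\<forall>t\<in>{0..1}. W n (\<theta> t) = \<omega> t"
      using W[of n] by (auto simp: skorokhod_ball_def)
    have "s \<in> \<theta> ` {0..1}" using \<theta>(1) s by (auto simp: time_warps_def)
    then obtain u where u: "u \<in> {0..1}" "s = \<theta> u" by auto
    have "1 / (real n + 1) < e"
    proof -
      have "1 / e < real n + 1" using m n by linarith
      then show ?thesis using e(1) by (simp add: field_simps)
    qed
    then have "dist u s < e" using \<theta>(2) u by (fastforce simp: dist_real_def abs_minus_commute)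
    then have "\<omega> u = \<omega> s" using e(2) by (cases "u = s") auto
    then show ?thesis using \<theta>(3) u by auto
  qed
  then show ?thesis by (rule eventually_sequentiallyI)
qed

lemma measurable_path:
  fixes \<omega> :: "real \<Rightarrow> 'a::countable"
  assumes "\<omega> \<in> paths adj"
  shows "(\<lambda>r. \<omega> (clamp01 r)) \<in> borel \<rightarrow>\<^sub>M count_space UNIV"
proof -
  have "(\<lambda>r. (\<omega>, r)) \<in> borel \<rightarrow>\<^sub>M path_space adj \<Otimes>\<^sub>M borel"
    by (rule measurable_Pair1') (simp add: assms)
  from measurable_compose[OF this measurable_evaluation] show ?thesis by simp
qed

lemma measurable_shifted_indicator:
  fixes adj :: "'a::countable \<Rightarrow> 'a \<Rightarrow> bool"
  assumes P: "sets P = sets (path_space adj)"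
  shows "(\<lambda>p. indicator {z} ((fst p) (clamp01 (a + snd p))) :: real) \<in> borel_measurable (P \<Otimes>\<^sub>M lborel)"
proof -
  have "(\<lambda>p. (fst p, a + snd p)) \<in> P \<Otimes>\<^sub>M lborel \<rightarrow>\<^sub>M path_space adj \<Otimes>\<^sub>M borel"
    using measurable_cong_sets[OF sets_pair_measure_cong[OF P sets_lborel] refl]
    by (auto intro!: measurable_Pair measurable_compose[OF measurable_fst] measurable_ident_sets[OF P])
  from measurable_compose[OF this measurable_evaluation]
  have "(\<lambda>p. (fst p) (clamp01 (a + snd p))) \<in> P \<Otimes>\<^sub>M lborel \<rightarrow>\<^sub>M count_space UNIV" by simp
  then show ?thesis by (rule measurable_compose) simp
qed

section \<open>Time averages as continuous test functions\<close>

context walk_setting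
begin

text \<open>A continuous substitute for the indicator of \<open>four_point x a z b w y\<close>, to
  which it converges as \<open>h\<close> tends to 0. Both intermediate times shift together over a
  window of length \<open>h\<close>; the ends stay sharp, since time warps fix 0 and 1.\<close>

definition averaged :: "'a \<Rightarrow> real \<Rightarrow> 'a \<Rightarrow> real \<Rightarrow> 'a \<Rightarrow> 'a \<Rightarrow> real \<Rightarrow> (real \<Rightarrow> 'a) \<Rightarrow> real" where
  "averaged x a z b w y h \<omega> = indicator (two_point x y) \<omega> *
     (LBINT r:{0..h}. indicator {z} (\<omega> (clamp01 (a + r))) * indicator {w} (\<omega> (clamp01 (b + r)))) / h"

lemma averaged_integrand_measurable:
  assumes "\<omega> \<in> paths adj"
  shows "(\<lambda>r. indicator {z} (\<omega> (clamp01 (a + r))) * indicator {w} (\<omega> (clamp01 (b + r))) :: real) \<in> borel_measurable borel"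
proof -
  have "(\<lambda>r. indicator {z} (\<omega> (clamp01 (a + r))) :: real) \<in> borel_measurable borel" for a z
    by (rule measurable_compose[OF measurable_compose[OF _ measurable_path[OF assms]]]) auto
  then show ?thesis by measurable
qed

lemma continuous_averaged:
  assumes h: "0 < h" and ab: "0 \<le> a" "0 \<le> b" "a + h \<le> 1" "b + h \<le> 1"
  shows "continuous_map (skorokhod_topology adj) euclideanreal (averaged x a z b w y h)"
proof (rule skorokhod_continuousI)
  fix \<omega> W assume \<omega>: "\<omega> \<in> paths adj" and W: "\<And>n. W n \<in> skorokhod_ball adj \<omega> (1 / (real n + 1))"
  let ?g = "\<lambda>\<omega> r. indicator {z} (\<omega> (clamp01 (a + r))) * indicator {w} (\<omega> (clamp01 (b + r))) :: real"
  note Wp = skorokhod_ball_ends[OF W]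
  have "(\<lambda>n. \<integral>r. indicator {0..h} r *\<^sub>R ?g (W n) r \<partial>lborel) \<longlonglongrightarrow> (\<integral>r. indicator {0..h} r *\<^sub>R ?g \<omega> r \<partial>lborel)"
  proof (rule integral_dominated_convergence[where w = "indicator {0..h}"])
    show "integrable lborel (indicator {0..h} :: real \<Rightarrow> real)"
      by (auto simp: integrable_indicator_iff emeasure_lborel_Icc_eq)
    show "AE r in lborel. norm (indicator {0..h} r *\<^sub>R ?g (W n) r) \<le> indicator {0..h} r" for n
      by (rule AE_I2) (auto split: split_indicator)
    \<comment> \<open>The values of \<open>r\<close> for which a shifted time meets a jump of
      \<omega>, and the ends of the window: a finite set.\<close>
    let ?N = "{0, h} \<union> (\<lambda>s. s - a) ` jump_times \<omega> \<union> (\<lambda>s. s - b) ` jump_times \<omega>"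
    have "?N \<in> null_sets lborel"
      by (rule finite_imp_null_set_lborel) (use pathD(4)[OF \<omega>] in auto)
    then have "AE r in lborel. r \<notin> ?N" by (rule AE_not_in)
    then show "AE r in lborel. (\<lambda>n. indicator {0..h} r *\<^sub>R ?g (W n) r) \<longlonglongrightarrow> indicator {0..h} r *\<^sub>R ?g \<omega> r"
    proof eventually_elim
      case (elim r)
      show ?case
      proof (cases "r \<in> {0..h}")
        case True
        then have r: "0 < r" "r < h" using elim by auto
        have nj: "a + r \<notin> jump_times \<omega>" "b + r \<notin> jump_times \<omega>"
          using elim image_eqI[of r "\<lambda>s. s - a" "a + r" "jump_times \<omega>"] image_eqI[of r "\<lambda>s. s - b" "b + r" "jump_times \<omega>"]
          by auto
        have "\<forall>\<^sub>F n in sequentially. W n (a + r) = \<omega> (a + r)" "\<forall>\<^sub>F n in sequentially. W n (b + r) = \<omega> (b + r)"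
          by (rule skorokhod_pointwise[OF \<omega> W]; use r ab nj in simp)+
        then have "\<forall>\<^sub>F n in sequentially. indicator {0..h} r *\<^sub>R ?g (W n) r = indicator {0..h} r *\<^sub>R ?g \<omega> r"
          by eventually_elim (use r ab in simp)
        then show ?thesis by (rule tendsto_eventually)
      qed auto
    qed
  qed (use averaged_integrand_measurable[OF \<omega>] averaged_integrand_measurable[OF Wp(1)] in measurable)
  then have "(\<lambda>n. (LBINT r:{0..h}. ?g (W n) r)) \<longlonglongrightarrow> (LBINT r:{0..h}. ?g \<omega> r)"
    by (simp add: set_lebesgue_integral_def)
  then have "(\<lambda>n. indicator (two_point x y) \<omega> * (LBINT r:{0..h}. ?g (W n) r) / h) \<longlonglongrightarrow> indicator (two_point x y) \<omega> * (LBINT r:{0..h}. ?g \<omega> r) / h"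
    using h by (intro tendsto_intros) auto
  moreover have "indicator (two_point x y) (W n) = (indicator (two_point x y) \<omega> :: real)" for n
    using Wp \<omega> by (auto simp: two_point_def indicator_def)
  ultimately show "(\<lambda>n. averaged x a z b w y h (W n)) \<longlonglongrightarrow> averaged x a z b w y h \<omega>"
    by (simp add: averaged_def)
qed

lemma averaged_bounds:
  assumes h: "0 < h" and \<omega>: "\<omega> \<in> paths adj"
  shows "0 \<le> averaged x a z b w y h \<omega>" "averaged x a z b w y h \<omega> \<le> 1"
proof -
  let ?g = "\<lambda>r. indicator {z} (\<omega> (clamp01 (a + r))) * indicator {w} (\<omega> (clamp01 (b + r))) :: real"
  have g[measurable]: "?g \<in> borel_measurable borel" by (rule averaged_integrand_measurable[OF \<omega>])
  have i: "set_integrable lborel {0..h} ?g"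
    unfolding set_integrable_def
    by (rule integrableI_bounded_set_indicator[where B = 1])
      (auto simp: emeasure_lborel_Icc_eq split: split_indicator)
  have "(LBINT r:{0..h}. ?g r) \<le> (LBINT r:{0..h}. 1)"
    by (rule set_integral_mono[OF i]) (auto simp: set_integral_const_Icc split: split_indicator)
  then have le: "(LBINT r:{0..h}. ?g r) \<le> h" using h by (simp add: set_integral_const_Icc)
  have ge: "0 \<le> (LBINT r:{0..h}. ?g r)"
    unfolding set_lebesgue_integral_def by (rule integral_nonneg_AE) auto
  show "0 \<le> averaged x a z b w y h \<omega>" "averaged x a z b w y h \<omega> \<le> 1"
    using h le ge by (auto simp: averaged_def split: split_indicator)
qed

text \<open>By Fubini the expectation is the mean over the window of the masses of the shifted
  events.\<close>

lemma expectation_averaged: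
  assumes P: "prob_space P" "sets P = sets (path_space adj)" and h: "0 < h"
    and ab: "0 \<le> a" "0 \<le> b" "a + h \<le> 1" "b + h \<le> 1"
  shows "(\<forall>r\<in>{0..h}. measure P (four_point x (a + r) z (b + r) w y) \<le> B) \<Longrightarrow> (\<integral>\<omega>. averaged x a z b w y h \<omega> \<partial>P) \<le> B"
    and "(\<forall>r\<in>{0..h}. B \<le> measure P (four_point x (a + r) z (b + r) w y)) \<Longrightarrow> B \<le> (\<integral>\<omega>. averaged x a z b w y h \<omega> \<partial>P)"
proof -
  interpret p: prob_space P by (rule P(1))
  interpret pair: pair_sigma_finite P "lborel :: real measure"
    by (simp add: pair_sigma_finite_def p.sigma_finite_measure_axioms lborel.sigma_finite_measure_axioms)
  have spP: "space P = paths adj" using sets_eq_imp_space_eq[OF P(2)] by simp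
  define G where "G \<omega> r = indicator {0..h} r * (indicator (two_point x y) \<omega> *
     (indicator {z} (\<omega> (clamp01 (a + r))) * indicator {w} (\<omega> (clamp01 (b + r)))) :: real)" for \<omega> :: "real \<Rightarrow> 'a" and r :: real
  note ev = measurable_shifted_indicator[OF P(2)]
  have tp[measurable]: "two_point x y \<in> sets P" by (simp add: P(2) two_point_sets)
  have int: "integrable (P \<Otimes>\<^sub>M lborel) (\<lambda>(\<omega>, r). G \<omega> r)"
  proof (rule integrableI_bounded_set[where A = "space P \<times> {0..h}" and B = 1])
    show "emeasure (P \<Otimes>\<^sub>M lborel) (space P \<times> {0..h}) < \<infinity>"
      using h by (subst lborel.emeasure_pair_measure_Times) (auto simp: ennreal_mult_less_top p.emeasure_eq_measure)
    show "AE p in P \<Otimes>\<^sub>M lborel. p \<in> space P \<times> {0..h} \<longrightarrow> norm (case p of (\<omega>, r) \<Rightarrow> G \<omega> r) \<le> 1"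
      by (rule AE_I2) (auto simp: G_def split: split_indicator)
    show "AE p in P \<Otimes>\<^sub>M lborel. p \<notin> space P \<times> {0..h} \<longrightarrow> (case p of (\<omega>, r) \<Rightarrow> G \<omega> r) = 0"
      by (rule AE_I2) (auto simp: G_def space_pair_measure indicator_def)
    show "(\<lambda>(\<omega>, r). G \<omega> r) \<in> borel_measurable (P \<Otimes>\<^sub>M lborel)"
      unfolding G_def case_prod_beta by (intro borel_measurable_times ev) measurable
  qed measurable
  have inner: "(\<integral>r. G \<omega> r \<partial>lborel) = h * averaged x a z b w y h \<omega>" for \<omega>
  proof -
    have "(\<integral>r. G \<omega> r \<partial>lborel) = (\<integral>r. indicator (two_point x y) \<omega> *
       (indicator {0..h} r *\<^sub>R (indicator {z} (\<omega> (clamp01 (a + r))) * indicator {w} (\<omega> (clamp01 (b + r))))) \<partial>lborel)"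
      by (rule Bochner_Integration.integral_cong) (auto simp: G_def)
    then show ?thesis using h by (simp add: averaged_def set_lebesgue_integral_def)
  qed
  have outer: "(\<integral>\<omega>. G \<omega> r \<partial>P) = indicator {0..h} r *\<^sub>R measure P (four_point x (a + r) z (b + r) w y)" for r
  proof (cases "r \<in> {0..h}")
    case True
    then have "(\<integral>\<omega>. G \<omega> r \<partial>P) = (\<integral>\<omega>. indicator (four_point x (a + r) z (b + r) w y) \<omega> \<partial>P)"
      by (intro Bochner_Integration.integral_cong)
        (use ab in \<open>auto simp: G_def four_point_def two_point_def spP split: split_indicator\<close>)
    also have "\<dots> = measure P (four_point x (a + r) z (b + r) w y \<inter> space P)" by (rule Bochner_Integration.integral_indicator)
    also have "four_point x (a + r) z (b + r) w y \<inter> space P = four_point x (a + r) z (b + r) w y"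
      by (auto simp: four_point_def spP)
    finally show ?thesis using True by simp
  qed (simp add: G_def)
  have iq: "set_integrable lborel {0..h} (\<lambda>r. measure P (four_point x (a + r) z (b + r) w y))"
    unfolding set_integrable_def outer[symmetric] by (rule pair.integrable_snd[OF int])
  have "h * (\<integral>\<omega>. averaged x a z b w y h \<omega> \<partial>P) = (\<integral>\<omega>. \<integral>r. G \<omega> r \<partial>lborel \<partial>P)" by (simp add: inner)
  also have "\<dots> = (\<integral>r. \<integral>\<omega>. G \<omega> r \<partial>P \<partial>lborel)" by (rule pair.Fubini_integral[OF int, symmetric])
  also have "\<dots> = (LBINT r:{0..h}. measure P (four_point x (a + r) z (b + r) w y))"
    by (simp add: outer set_lebesgue_integral_def)
  finally have eq: "h * (\<integral>\<omega>. averaged x a z b w y h \<omega> \<partial>P) = (LBINT r:{0..h}. measure P (four_point x (a + r) z (b + r) w y))" .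
  show "(\<integral>\<omega>. averaged x a z b w y h \<omega> \<partial>P) \<le> B"
    if B: "\<forall>r\<in>{0..h}. measure P (four_point x (a + r) z (b + r) w y) \<le> B"
  proof -
    have "h * (\<integral>\<omega>. averaged x a z b w y h \<omega> \<partial>P) \<le> (LBINT r:{0..h}. B)"
      unfolding eq by (rule set_integral_mono[OF iq set_integral_const_Icc(1)]) (use B in auto)
    then show ?thesis using h by (simp add: set_integral_const_Icc)
  qed
  show "B \<le> (\<integral>\<omega>. averaged x a z b w y h \<omega> \<partial>P)"
    if B: "\<forall>r\<in>{0..h}. B \<le> measure P (four_point x (a + r) z (b + r) w y)"
  proof -
    have "(LBINT r:{0..h}. B) \<le> h * (\<integral>\<omega>. averaged x a z b w y h \<omega> \<partial>P)"
      unfolding eq by (rule set_integral_mono[OF set_integral_const_Icc(1) iq]) (use B in auto)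
    then show ?thesis using h by (simp add: set_integral_const_Icc)
  qed
qed

lemma averaged_measurable:
  assumes P: "prob_space P" "sets P = sets (path_space adj)"
  shows "averaged x a z b w y h \<in> borel_measurable P"
proof -
  interpret p: prob_space P by (rule P(1))
  note ev = measurable_shifted_indicator[OF P(2)]
  have tp[measurable]: "two_point x y \<in> sets P" by (simp add: P(2) two_point_sets)
  have "(\<lambda>\<omega>. \<integral>r. indicator {0..h} r *\<^sub>R (indicator {z} (\<omega> (clamp01 (a + r))) * indicator {w} (\<omega> (clamp01 (b + r))) :: real) \<partial>lborel)
      \<in> borel_measurable P"
  proof (rule lborel.borel_measurable_lebesgue_integral)
    show "(\<lambda>(\<omega>, r). indicator {0..h} r *\<^sub>R (indicator {z} (\<omega> (clamp01 (a + r))) * indicator {w} (\<omega> (clamp01 (b + r))) :: real))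
      \<in> borel_measurable (P \<Otimes>\<^sub>M lborel)"
      unfolding case_prod_beta by (intro borel_measurable_scaleR borel_measurable_times ev) measurable
  qed
  then show ?thesis unfolding averaged_def[abs_def] set_lebesgue_integral_def by measurable
qed

text \<open>Just after \<open>a\<close> and \<open>b\<close> the path is constant, so the average
  equals the indicator once the window is short enough. There must be room after both times, hence
  they lie below 1.\<close>

lemma averaged_tendsto:
  assumes P: "prob_space P" "sets P = sets (path_space adj)"
    and ab: "0 \<le> a" "a < 1" "0 \<le> b" "b < 1" and H: "H \<longlonglongrightarrow> 0" "\<And>n. 0 < H n"
  shows "(\<lambda>n. \<integral>\<omega>. averaged x a z b w y (H n) \<omega> \<partial>P) \<longlonglongrightarrow> measure P (four_point x a z b w y)"
proof -
  interpret p: prob_space P by (rule P(1))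
  have spP: "space P = paths adj" using sets_eq_imp_space_eq[OF P(2)] by simp
  have fp: "four_point x a z b w y \<in> sets P" unfolding P(2) by (rule four_point_sets) (use ab in auto)
  have "(\<lambda>n. \<integral>\<omega>. averaged x a z b w y (H n) \<omega> \<partial>P) \<longlonglongrightarrow> (\<integral>\<omega>. indicator (four_point x a z b w y) \<omega> \<partial>P)"
  proof (rule integral_dominated_convergence[where w = "\<lambda>_. 1"])
    show "AE \<omega> in P. norm (averaged x a z b w y (H n) \<omega>) \<le> 1" for n
      by (rule AE_I2) (use averaged_bounds[OF H(2)] in \<open>auto simp: spP\<close>)
    show "AE \<omega> in P. (\<lambda>n. averaged x a z b w y (H n) \<omega>) \<longlonglongrightarrow> indicator (four_point x a z b w y) \<omega>"
    proof (rule AE_I2)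
      fix \<omega> assume "\<omega> \<in> space P"
      then have \<omega>: "\<omega> \<in> paths adj" by (simp add: spP)
      have "\<exists>e>0. \<forall>r. 0 \<le> r \<longrightarrow> r < e \<longrightarrow> \<omega> (clamp01 (a + r)) = \<omega> a" if a: "0 \<le> a" "a < 1" for a
      proof -
        obtain c where c: "a < c" "\<And>s. a < s \<Longrightarrow> s < c \<Longrightarrow> \<omega> s = \<omega> a"
          using pathD(1)[OF \<omega> a] by (auto simp: eventually_at_right_field)
        show ?thesis
        proof (intro exI[of _ "min c 1 - a"] conjI allI impI)
          fix r assume "0 \<le> r" "r < min c 1 - a"
          then show "\<omega> (clamp01 (a + r)) = \<omega> a" using a c(2)[of "a + r"] by (cases "r = 0") auto
        qed (use c a in auto)
      qed
      from this[OF ab(1,2)] this[OF ab(3,4)] obtain e e' where e: "0 < e" "0 < e'"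
        "\<And>r. 0 \<le> r \<Longrightarrow> r < e \<Longrightarrow> \<omega> (clamp01 (a + r)) = \<omega> a" "\<And>r. 0 \<le> r \<Longrightarrow> r < e' \<Longrightarrow> \<omega> (clamp01 (b + r)) = \<omega> b"
        by metis
      have "\<forall>\<^sub>F n in sequentially. H n < min e e'" using H(1) e(1,2) by (intro order_tendstoD) auto
      then have "\<forall>\<^sub>F n in sequentially. averaged x a z b w y (H n) \<omega> = indicator (four_point x a z b w y) \<omega>"
      proof eventually_elim
        case (elim n)
        have "(LBINT r:{0..H n}. indicator {z} (\<omega> (clamp01 (a + r))) * indicator {w} (\<omega> (clamp01 (b + r))))
           = (LBINT r:{0..H n}. indicator {z} (\<omega> a) * indicator {w} (\<omega> b) :: real)"
          by (rule set_lebesgue_integral_cong) (use elim e in auto)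
        also have "\<dots> = indicator {z} (\<omega> a) * indicator {w} (\<omega> b) * H n"
          using H(2)[of n] by (simp add: set_integral_const_Icc)
        finally show ?case
          using H(2)[of n] \<omega> by (auto simp: averaged_def two_point_def four_point_def split: split_indicator)
      qed
      then show "(\<lambda>n. averaged x a z b w y (H n) \<omega>) \<longlonglongrightarrow> indicator (four_point x a z b w y) \<omega>"
        by (rule tendsto_eventually)
    qed
  qed (use fp averaged_measurable[OF P] in auto)
  also have "(\<integral>\<omega>. indicator (four_point x a z b w y) \<omega> \<partial>P) = measure P (four_point x a z b w y)"
    using sets.sets_into_space[OF fp] by (simp add: Int_absorb2)
  finally show ?thesis .
qed

section \<open>Passing bounds on cylinder events to the limit\<close>

context
  fixes P :: "nat \<Rightarrow> (real \<Rightarrow> 'a) measure" and Phat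
  assumes P: "\<And>k. 2 \<le> k \<Longrightarrow> prob_space (P k)" "\<And>k. 2 \<le> k \<Longrightarrow> sets (P k) = sets (path_space adj)"
    and Phat: "prob_space Phat" "sets Phat = sets (path_space adj)"
    and lim: "narrow_limit adj P Phat"
begin

lemma narrow_averaged:
  assumes h: "0 < h" and ab: "0 \<le> a" "0 \<le> b" "a + h \<le> 1" "b + h \<le> 1"
  shows "(\<lambda>k. \<integral>\<omega>. averaged x a z b w y h \<omega> \<partial>P k) \<longlonglongrightarrow> (\<integral>\<omega>. averaged x a z b w y h \<omega> \<partial>Phat)"
proof -
  have "bounded (averaged x a z b w y h ` paths adj)"
    using averaged_bounds[OF h] by (auto simp: bounded_iff intro!: exI[of _ 1])
  then show ?thesis using lim continuous_averaged[OF h ab] by (auto simp: narrow_limit_def)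
qed

text \<open>The bound holds for all shifts in the window, hence for the averages; these converge as
  \<open>k\<close> tends to infinity, and only then is the window shrunk.\<close>

lemma narrow_four_point_upper:
  assumes h: "0 < h" and ab: "0 \<le> a" "a \<le> b" "b + h \<le> 1" and B: "B \<longlonglongrightarrow> L"
    and bound: "\<forall>\<^sub>F k in sequentially. \<forall>r\<in>{0..h}. measure (P k) (four_point x (a + r) z (b + r) w y) \<le> B k"
  shows "measure Phat (four_point x a z b w y) \<le> L"
proof -
  define H where "H n = h / (real n + 1)" for n
  have H: "H \<longlonglongrightarrow> 0" "0 < H n" "H n \<le> h" for n
  proof -
    show "H \<longlonglongrightarrow> 0" unfolding H_def by real_asymp
    show "0 < H n" "H n \<le> h" using h by (auto simp: H_def field_simps)
  qed
  have "(\<integral>\<omega>. averaged x a z b w y (H n) \<omega> \<partial>Phat) \<le> L" for n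
  proof (rule tendsto_le[OF sequentially_bot B narrow_averaged])
    show "\<forall>\<^sub>F k in sequentially. (\<integral>\<omega>. averaged x a z b w y (H n) \<omega> \<partial>P k) \<le> B k"
      using bound eventually_ge_at_top[of 2]
    proof eventually_elim
      case (elim k)
      show ?case by (rule expectation_averaged(1)[OF P]) (use elim H(2,3)[of n] ab in auto)
    qed
  qed (use H(2,3)[of n] ab in auto)
  then show ?thesis
    by (intro tendsto_le[OF sequentially_bot tendsto_const averaged_tendsto[OF Phat _ _ _ _ H(1,2)]])
      (use ab h in auto)
qed

text \<open>The form \<open>B k * (e - c * h')\<close> leaves room for what a lower bound by an
  integral over time loses when its interval is shifted within a window of length \<open>h'\<close>.
  The loss disappears as the window shrinks.\<close>

lemma narrow_four_point_lower:
  assumes h: "0 < h" and ab: "0 \<le> a" "a \<le> b" "b + h \<le> 1" and B: "B \<longlonglongrightarrow> L" and c: "0 \<le> c"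
    and bound: "\<And>h'. 0 < h' \<Longrightarrow> h' \<le> h \<Longrightarrow>
      \<forall>\<^sub>F k in sequentially. \<forall>r\<in>{0..h'}. B k * (e - c * h') \<le> measure (P k) (four_point x (a + r) z (b + r) w y)"
  shows "L * e \<le> measure Phat (four_point x a z b w y)"
proof -
  define H where "H n = h / (real n + 1)" for n
  have H: "H \<longlonglongrightarrow> 0" "0 < H n" "H n \<le> h" for n
  proof -
    show "H \<longlonglongrightarrow> 0" unfolding H_def by real_asymp
    show "0 < H n" "H n \<le> h" using h by (auto simp: H_def field_simps)
  qed
  have le: "L * (e - c * H n) \<le> (\<integral>\<omega>. averaged x a z b w y (H n) \<omega> \<partial>Phat)" for n
  proof (rule tendsto_le[OF sequentially_bot narrow_averaged tendsto_mult_right[OF B]])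
    show "\<forall>\<^sub>F k in sequentially. B k * (e - c * H n) \<le> (\<integral>\<omega>. averaged x a z b w y (H n) \<omega> \<partial>P k)"
      using bound[OF H(2,3)[of n]] eventually_ge_at_top[of 2]
    proof eventually_elim
      case (elim k)
      show ?case by (rule expectation_averaged(2)[OF P]) (use elim H(2,3)[of n] ab in auto)
    qed
  qed (use H(2,3)[of n] ab in auto)
  have "(\<lambda>n. L * (e - c * H n)) \<longlonglongrightarrow> L * (e - c * 0)" by (intro tendsto_intros H)
  then show ?thesis
    using tendsto_le[OF sequentially_bot averaged_tendsto[OF Phat _ _ _ _ H(1,2)], of a b "\<lambda>n. L * (e - c * H n)" "L * e"]
      le ab h by auto
qed

text \<open>Paths in a Skorokhod ball share both ends with its centre, so the indicator of such an
  event is itself continuous and needs no averaging.\<close>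

lemma narrow_endpoint_event:
  assumes S: "\<And>\<omega> \<omega>'. \<omega> \<in> paths adj \<Longrightarrow> \<omega>' \<in> paths adj \<Longrightarrow> \<omega> 0 = \<omega>' 0 \<Longrightarrow> \<omega> 1 = \<omega>' 1 \<Longrightarrow> \<omega> \<in> E \<longleftrightarrow> \<omega>' \<in> E"
    and E: "E \<in> sets (path_space adj)"
  shows "(\<lambda>k. measure (P k) E) \<longlonglongrightarrow> measure Phat E"
proof -
  have test: "(\<lambda>k. \<integral>\<omega>. f \<omega> \<partial>P k) \<longlonglongrightarrow> (\<integral>\<omega>. f \<omega> \<partial>Phat)"
    if "continuous_map (skorokhod_topology adj) euclideanreal f" "bounded (f ` paths adj)" for f
    using lim that by (auto simp: narrow_limit_def)
  have c: "continuous_map (skorokhod_topology adj) euclideanreal (indicator E)"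
  proof (rule skorokhod_continuousI)
    fix \<omega> W assume \<omega>: "\<omega> \<in> paths adj" and W: "\<And>n. W n \<in> skorokhod_ball adj \<omega> (1 / (real n + 1))"
    have "indicator E (W n) = (indicator E \<omega> :: real)" for n
      using S[OF skorokhod_ball_ends(1)[OF W] \<omega> skorokhod_ball_ends(2,3)[OF W], of n] by (simp add: indicator_def)
    then show "(\<lambda>n. indicator E (W n)) \<longlonglongrightarrow> (indicator E \<omega> :: real)" by simp
  qed
  have b: "bounded ((indicator E :: _ \<Rightarrow> real) ` paths adj)"
    by (auto simp: bounded_iff intro!: exI[of _ 1] split: split_indicator)
  have m: "(\<integral>\<omega>. indicator E \<omega> \<partial>M) = measure M E" if M: "sets M = sets (path_space adj)" for M :: "(real \<Rightarrow> 'a) measure"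
    using sets.sets_into_space[of E M] E M by (simp add: Int_absorb2)
  have ev: "\<forall>\<^sub>F k in sequentially. (\<integral>\<omega>. indicator E \<omega> \<partial>P k) = measure (P k) E"
    using eventually_ge_at_top[of 2] by eventually_elim (rule m[OF P(2)])
  show ?thesis
    using Lim_transform_eventually[OF test[OF c b] ev] unfolding m[OF Phat(2)] .
qed

end

end

section \<open>The displacement random walk\<close>

locale displacement = walk_setting +
  fixes R P :: "nat \<Rightarrow> (real \<Rightarrow> 'a::countable) measure" and Phat and \<mu>0 \<mu>1 :: "'a measure"
  assumes R: "1 \<le> k \<Longrightarrow> slowed k (R k)"
    and S: "2 \<le> k \<Longrightarrow> schrodinger_solution adj (R k) \<mu>0 \<mu>1 (P k)"
    and Phat: "Phat \<in> space (prob_algebra (path_space adj))"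
    and lim: "narrow_limit adj P Phat"
begin

sublocale hat: prob_space Phat
  using Phat by (simp add: space_prob_algebra)

lemma sets_hat: "sets Phat = sets (path_space adj)"
  using Phat by (simp add: space_prob_algebra)

lemma space_hat: "space Phat = paths adj"
  using sets_eq_imp_space_eq[OF sets_hat] by simp

lemma P_bridging: "2 \<le> k \<Longrightarrow> P k \<in> bridging_measures adj \<mu>0 \<mu>1"
  using S[of k] by (auto simp: schrodinger_solution_def is_arg_min_def)

lemma P_prob: "2 \<le> k \<Longrightarrow> prob_space (P k)"
  by (rule bridgingD(1)[OF P_bridging])

lemma P_sets: "2 \<le> k \<Longrightarrow> sets (P k) = sets (path_space adj)"
  by (rule bridgingD(2)[OF P_bridging])

lemma marginal_hat:
  assumes t: "t = 0 \<or> t = 1"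
  shows "marginal Phat t = marginal (P 2) t"
proof (rule marginal_eqI[OF sets_hat P_sets])
  fix u
  let ?E = "{\<omega>\<in>paths adj. \<omega> t = u}"
  have E: "?E \<in> sets (path_space adj)" by (rule path_event_sets) (use t in auto)
  have const: "measure (P k) ?E = measure (P 2) ?E" if k: "2 \<le> k" for k
  proof -
    have mm: "marginal (P k) t = marginal (P 2) t"
      using bridgingD(4,5)[OF P_bridging[OF k]] bridgingD(4,5)[OF P_bridging[of 2]] t by auto
    have "measure (marginal (P k) t) {u} = measure (P k) ?E" if k: "2 \<le> k" for k
    proof -
      have sp: "space (P k) = paths adj" by (rule bridgingD(3)[OF P_bridging[OF k]])
      have "measure (marginal (P k) t) {u} = measure (P k) ((\<lambda>\<omega>. \<omega> t) -` {u} \<inter> space (P k))"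
        unfolding marginal_def by (rule measure_distr[OF measurable_coord_path[OF P_sets[OF k]]]) (use t in auto)
      also have "(\<lambda>\<omega>. \<omega> t) -` {u} \<inter> space (P k) = ?E" by (auto simp: sp)
      finally show ?thesis .
    qed
    from this[OF k] this[of 2] mm show ?thesis by simp
  qed
  have "(\<lambda>k. measure (P k) ?E) \<longlonglongrightarrow> measure Phat ?E"
    by (rule narrow_endpoint_event[OF P_prob P_sets hat.prob_space_axioms sets_hat lim _ E]) (use t in auto)
  moreover have "(\<lambda>k. measure (P k) ?E) \<longlonglongrightarrow> measure (P 2) ?E"
    by (rule tendsto_eventually[OF eventually_sequentiallyI[of 2]]) (rule const)
  ultimately have "measure Phat ?E = measure (P 2) ?E" by (rule LIMSEQ_unique)
  interpret P2: prob_space "P 2" by (rule P_prob) simp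
  show "emeasure Phat ?E = emeasure (P 2) ?E"
    using \<open>measure Phat ?E = measure (P 2) ?E\<close> by (simp add: hat.emeasure_eq_measure P2.emeasure_eq_measure)
qed (use t in auto)

lemma marginal_hat_ends: "marginal Phat 0 = \<mu>0" "marginal Phat 1 = \<mu>1"
  using marginal_hat[of 0] marginal_hat[of 1] bridgingD(4,5)[OF P_bridging[of 2]] by auto

lemma two_point_lim: "(\<lambda>k. measure (P k) (two_point x y)) \<longlonglongrightarrow> measure Phat (two_point x y)"
  by (rule narrow_endpoint_event[OF P_prob P_sets hat.prob_space_axioms sets_hat lim _ two_point_sets])
    (auto simp: two_point_def)

text \<open>A cell has mass at most 1 under \<open>P k\<close>, and at least of order
  \<open>k powr (- d x y)\<close> under \<open>R k\<close>.\<close>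

lemma ratio_upper: "\<exists>C>0. \<forall>k\<ge>2. ratio (R k) (P k) x y \<le> C * real k powr d x y"
proof -
  obtain c where c: "0 < c" "\<And>k Q. 1 \<le> k \<Longrightarrow> slowed k Q \<Longrightarrow> c * real k powr (- d x y) * m x \<le> measure Q (two_point x y)"
    using two_point_lower[of x y] by blast
  have "ratio (R k) (P k) x y \<le> 1 / (c * m x) * real k powr d x y" if k: "2 \<le> k" for k
  proof -
    interpret p: prob_space "P k" by (rule P_prob[OF k])
    have pos: "0 < c * real k powr (- d x y) * m x" using c(1) m_pos[of x] k by simp
    have "ratio (R k) (P k) x y \<le> 1 / (c * real k powr (- d x y) * m x)"
      unfolding ratio_def using c(2)[OF _ R, of k] k pos by (intro frac_le) auto
    also have "\<dots> = 1 / (c * m x) * real k powr d x y"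
      using k by (simp add: powr_minus field_simps)
    finally show ?thesis .
  qed
  then show ?thesis using c(1) m_pos[of x] by (intro exI[of _ "1 / (c * m x)"]) auto
qed

text \<open>Wherever the limit charges the cell, this shows that the order in
  \<open>ratio_upper\<close> is attained.\<close>

lemma ratio_lower:
  assumes k: "2 \<le> k"
  shows "measure (P k) (two_point x y) * real k powr d x y / (growth * m x) \<le> ratio (R k) (P k) x y"
proof -
  have q: "0 < measure (R k) (two_point x y)" by (rule measure_two_point_pos[OF _ R]) (use k in auto)
  have "measure (R k) (two_point x y) \<le> growth * real k powr (- d x y) * m x"
    by (rule two_point_upper[OF _ R]) (use k in auto)
  then have "measure (P k) (two_point x y) / (growth * real k powr (- d x y) * m x) \<le> ratio (R k) (P k) x y"
    unfolding ratio_def using q by (intro divide_left_mono) (auto intro!: mult_pos_pos less_le_trans[OF q])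
  also have "measure (P k) (two_point x y) / (growth * real k powr (- d x y) * m x)
     = measure (P k) (two_point x y) * real k powr d x y / (growth * m x)"
    using k by (simp add: powr_minus field_simps)
  finally show ?thesis .
qed

text \<open>A shift by \<open>r\<close> gives up at most an initial piece of length
  \<open>r\<close>, on which the rate is at most \<open>lam\<close>. It provides the loss term of
  \<open>narrow_four_point_lower\<close>.\<close>

lemma shifted_J_integral:
  assumes r: "0 \<le> r" and ab: "0 \<le> a" "b + r \<le> 1"
  shows "(LBINT u:{a..b}. J u x y) - lam * r \<le> (LBINT u:{a + r..b + r}. J u x y)"
proof -
  let ?j = "\<lambda>u. J (clamp01 u) x y"
  have i: "integrable lborel (\<lambda>u. indicator {a..b} u *\<^sub>R ?j u)" "integrable lborel (\<lambda>u. indicator {a + r..b + r} u *\<^sub>R ?j u)"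
    using J_integrable[of a b x y] J_integrable[of "a + r" "b + r" x y] by (auto simp: set_integrable_def)
  have i': "integrable lborel (\<lambda>u. indicator {a..a + r} u *\<^sub>R lam)"
    using set_integral_const_Icc(1)[of a "a + r" lam] by (simp add: set_integrable_def)
  have "(\<integral>u. indicator {a..b} u *\<^sub>R ?j u \<partial>lborel) \<le> (\<integral>u. indicator {a + r..b + r} u *\<^sub>R ?j u + indicator {a..a + r} u *\<^sub>R lam \<partial>lborel)"
  proof (rule integral_mono[OF i(1) Bochner_Integration.integrable_add[OF i(2) i']])
    fix u
    show "indicator {a..b} u *\<^sub>R ?j u \<le> indicator {a + r..b + r} u *\<^sub>R ?j u + indicator {a..a + r} u *\<^sub>R lam"
      using J_nonneg[OF clamp01_in, of u x y] J_le[OF clamp01_in, of u x y] lam_pos r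
      by (auto simp: indicator_def)
  qed
  also have "\<dots> = (\<integral>u. indicator {a + r..b + r} u *\<^sub>R ?j u \<partial>lborel) + lam * r"
    using set_integral_const_Icc(2)[of a "a + r" lam] r
    by (subst Bochner_Integration.integral_add[OF i(2) i']) (simp add: set_lebesgue_integral_def)
  finally have "(LBINT u:{a..b}. ?j u) \<le> (LBINT u:{a + r..b + r}. ?j u) + lam * r"
    by (simp add: set_lebesgue_integral_def)
  then show ?thesis using ab r by (simp add: J_integral_clamp)
qed

end

section \<open>Geodesics, jumps and cyclical monotonicity in the limit\<close>

locale nontrivial_displacement = displacement +
  assumes nontrivial: "\<exists>x y::'a. x \<noteq> y"
begin

lemma four_point_P:
  assumes k: "2 \<le> k" and ab: "a \<in> {0..1}" "b \<in> {0..1}"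
  shows "measure (P k) (four_point x a z b w y) = ratio (R k) (P k) x y * measure (R k) (four_point x a z b w y)"
proof -
  have k1: "1 \<le> k" using k by simp
  have "four_point x a z b w y \<in> sets (R k)" unfolding sets_slowed[OF R[OF k1]] by (rule four_point_sets[OF ab])
  from schrodinger_bridge[OF k1 R[OF k1] S[OF k] nontrivial this]
  have "measure (P k) (two_point x y \<inter> four_point x a z b w y) = ratio (R k) (P k) x y * measure (R k) (two_point x y \<inter> four_point x a z b w y)" .
  moreover have "two_point x y \<inter> four_point x a z b w y = four_point x a z b w y" by (auto simp: two_point_def four_point_def)
  ultimately show ?thesis by simp
qed

text \<open>The ratio contributes \<open>k powr d x y\<close> and the event under \<open>R k\<close>
  the inverse power of the length of the way through \<open>z\<close> and \<open>w\<close>; the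
  exponent is minus the length of the detour.\<close>

lemma four_point_P_upper:
  "\<exists>C>0. \<forall>k a b. 2 \<le> k \<longrightarrow> 0 \<le> a \<longrightarrow> a \<le> b \<longrightarrow> b \<le> 1 \<longrightarrow>
     measure (P k) (four_point x a z b w y) \<le> C * real k powr (d x y - (d x z + d z w + d w y)) \<and>
     (z \<noteq> w \<longrightarrow> measure (P k) (four_point x a z b w y) \<le> C * (b - a) * real k powr (d x y - (d x z + d z w + d w y)))"
proof -
  obtain C where C: "0 < C" "\<And>k. 2 \<le> k \<Longrightarrow> ratio (R k) (P k) x y \<le> C * real k powr d x y"
    using ratio_upper[of x y] by blast
  \<comment> \<open>The factor \<open>1 + 2 * lam\<close> lets one constant serve both
    bounds.\<close>
  define D where "D = C * (1 + 2 * lam) * growth ^ 3 * m x"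
  have D: "0 < D" using C(1) lam_pos growth_pos m_pos[of x] by (simp add: D_def)
  show ?thesis
  proof (intro exI[of _ D] conjI allI impI)
    fix k a b assume k: "2 \<le> (k::nat)" and ab: "0 \<le> (a::real)" "a \<le> b" "b \<le> 1"
    let ?s = "d x z + d z w + d w y"
    have k1: "1 \<le> k" using k by simp
    have ab': "a \<in> {0..1}" "b \<in> {0..1}" using ab by auto
    have pw: "real k powr (d x y - ?s) = real k powr d x y * real k powr (- ?s)"
    proof -
      have "real k powr (A - B) = real k powr A * real k powr (- B)" for A B
        by (simp add: powr_diff powr_minus_divide)
      then show ?thesis .
    qed
    have le: "measure (P k) (four_point x a z b w y) \<le> D * e * real k powr (d x y - ?s)"
      if e: "0 \<le> e" "measure (R k) (four_point x a z b w y) \<le> (1 + 2 * lam) * growth ^ 3 * e * real k powr (- ?s) * m x" for e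
    proof -
      have "measure (P k) (four_point x a z b w y) \<le> (C * real k powr d x y) * ((1 + 2 * lam) * growth ^ 3 * e * real k powr (- ?s) * m x)"
        unfolding four_point_P[OF k ab'] using C e by (intro mult_mono C(2)[OF k]) auto
      also have "\<dots> = D * e * real k powr (d x y - ?s)" unfolding pw by (simp add: D_def mult_ac)
      finally show ?thesis .
    qed
    have nn: "0 \<le> growth ^ 3 * real k powr (- ?s) * m x" using growth_pos m_pos[of x] by simp
    have "measure (R k) (four_point x a z b w y) \<le> 1 * (growth ^ 3 * real k powr (- ?s) * m x)"
      using four_point_upper(1)[OF k1 R[OF k1] ab, of x z w y] by simp
    also have "\<dots> \<le> (1 + 2 * lam) * (growth ^ 3 * real k powr (- ?s) * m x)"
      by (rule mult_right_mono[OF _ nn]) (use lam_pos in auto)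
    finally show "measure (P k) (four_point x a z b w y) \<le> D * real k powr (d x y - ?s)"
      using le[of 1] by (simp add: mult.assoc)
    assume zw: "z \<noteq> w"
    have nn: "0 \<le> growth ^ 3 * (b - a) * real k powr (- ?s) * m x" using growth_pos m_pos[of x] ab by simp
    have "measure (R k) (four_point x a z b w y) \<le> 2 * lam * (growth ^ 3 * (b - a) * real k powr (- ?s) * m x)"
      using four_point_upper(2)[OF k1 R[OF k1] ab zw k, of x y] by (simp add: mult.assoc)
    also have "\<dots> \<le> (1 + 2 * lam) * (growth ^ 3 * (b - a) * real k powr (- ?s) * m x)"
      by (rule mult_right_mono[OF _ nn]) auto
    finally show "measure (P k) (four_point x a z b w y) \<le> D * (b - a) * real k powr (d x y - ?s)"
      using ab by (intro le) (auto simp: mult.assoc)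
  qed (rule D)
qed

text \<open>A proper detour makes the exponent in \<open>four_point_P_upper\<close> negative, so its
  mass vanishes in the limit.\<close>

lemma hat_geodesic:
  assumes ab: "0 \<le> a" "a \<le> b" "b < 1" and pos: "0 < measure Phat (four_point x a z b w y)"
  shows "d x z + d z w + d w y \<le> d x y"
proof (rule ccontr)
  assume "\<not> ?thesis"
  then have neg: "d x y - (d x z + d z w + d w y) < 0" by simp
  obtain C where C: "0 < C" "\<And>k a b. 2 \<le> k \<Longrightarrow> 0 \<le> a \<Longrightarrow> a \<le> b \<Longrightarrow> b \<le> 1 \<Longrightarrow>
     measure (P k) (four_point x a z b w y) \<le> C * real k powr (d x y - (d x z + d z w + d w y))"
    using four_point_P_upper[of x z w y] by blast
  have "measure Phat (four_point x a z b w y) \<le> C * 0"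
  proof (rule narrow_four_point_upper[OF P_prob P_sets hat.prob_space_axioms sets_hat lim, of "1 - b"])
    show "(\<lambda>k. C * real k powr (d x y - (d x z + d z w + d w y))) \<longlonglongrightarrow> C * 0"
      by (intro tendsto_mult tendsto_const tendsto_neg_powr[OF neg] filterlim_real_sequentially)
    show "\<forall>\<^sub>F k in sequentially. \<forall>r\<in>{0..1 - b}. measure (P k) (four_point x (a + r) z (b + r) w y)
       \<le> C * real k powr (d x y - (d x z + d z w + d w y))"
      using eventually_ge_at_top[of 2] by eventually_elim (use ab in \<open>auto intro!: C(2)\<close>)
  qed (use ab in auto)
  then show False using pos by simp
qed

text \<open>The exponent is never positive, by the triangle inequality, so the bound linear in
  \<open>b - a\<close> survives with the power of \<open>k\<close> replaced by 1.\<close>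

lemma hat_jump_bound:
  assumes zw: "z \<noteq> w"
  shows "\<exists>C>0. \<forall>a b. 0 \<le> a \<longrightarrow> a \<le> b \<longrightarrow> b < 1 \<longrightarrow> measure Phat (four_point x a z b w y) \<le> C * (b - a)"
proof -
  obtain C where C: "0 < C" "\<And>k a b. 2 \<le> k \<Longrightarrow> 0 \<le> a \<Longrightarrow> a \<le> b \<Longrightarrow> b \<le> 1 \<Longrightarrow>
     measure (P k) (four_point x a z b w y) \<le> C * (b - a) * real k powr (d x y - (d x z + d z w + d w y))"
    using four_point_P_upper[of x z w y] zw by blast
  show ?thesis
  proof (intro exI[of _ C] conjI allI impI)
    fix a b :: real assume ab: "0 \<le> a" "a \<le> b" "b < 1"
    show "measure Phat (four_point x a z b w y) \<le> C * (b - a)"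
    proof (rule narrow_four_point_upper[OF P_prob P_sets hat.prob_space_axioms sets_hat lim, of "1 - b"])
      show "\<forall>\<^sub>F k in sequentially. \<forall>r\<in>{0..1 - b}. measure (P k) (four_point x (a + r) z (b + r) w y) \<le> C * (b - a)"
        using eventually_ge_at_top[of 2]
      proof eventually_elim
        case (elim k)
        show ?case
        proof
          fix r assume r: "r \<in> {0..1 - b}"
          have "d x y - (d x z + d z w + d w y) \<le> 0"
            using good_distanceD(5)[OF dist, of x y z] good_distanceD(5)[OF dist, of z y w] by simp
          then have "real k powr (d x y - (d x z + d z w + d w y)) \<le> 1"
            using elim powr_mono[of "d x y - (d x z + d z w + d w y)" 0 "real k"] by simp
          then have "C * (b - a) * real k powr (d x y - (d x z + d z w + d w y)) \<le> C * (b - a) * 1"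
            using C(1) ab by (intro mult_left_mono) auto
          then show "measure (P k) (four_point x (a + r) z (b + r) w y) \<le> C * (b - a)"
            using C(2)[OF elim, of "a + r" "b + r"] r ab by simp
        qed
      qed
    qed (use ab in auto)
  qed (rule C(1))
qed

text \<open>Along a geodesic edge the power from \<open>ratio_lower\<close> and the one from
  \<open>four_point_lower\<close> cancel, and the mass of the cell times the integrated rate
  remains.\<close>

lemma hat_jump_lower:
  assumes \<eta>: "0 < \<eta>" "\<eta> \<le> 1" and xv: "adj x v" and geo: "d x y = d x v + d v y"
  shows "\<exists>c>0. \<forall>a b. 0 \<le> a \<longrightarrow> a \<le> b \<longrightarrow> b \<le> 1 - \<eta> \<longrightarrow>
    c * measure Phat (two_point x y) * (LBINT u:{a..b}. J u x v) \<le> measure Phat (four_point x a x b v y)"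
proof -
  \<comment> \<open>Half of \<eta> is kept in reserve, so that the averaging window may shift both
    times by up to \<open>\<eta> / 2\<close>.\<close>
  obtain c where c: "0 < c" "\<And>k Q a b. 1 \<le> k \<Longrightarrow> slowed k Q \<Longrightarrow> 0 \<le> a \<Longrightarrow> a \<le> b \<Longrightarrow> b \<le> 1 - \<eta> / 2 \<Longrightarrow>
    c * real k powr (- d x y) * m x * (LBINT r:{a..b}. J r x v) \<le> measure Q (four_point x a x b v y)"
    using four_point_lower[of "\<eta> / 2" x v y] \<eta> xv geo by auto
  define c' where "c' = c / growth"
  have c': "0 < c'" using c(1) growth_pos by (simp add: c'_def)
  show ?thesis
  proof (intro exI[of _ c'] conjI allI impI)
    fix a b :: real assume ab: "0 \<le> a" "a \<le> b" "b \<le> 1 - \<eta>"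
    show "c' * measure Phat (two_point x y) * (LBINT u:{a..b}. J u x v) \<le> measure Phat (four_point x a x b v y)"
    proof (rule narrow_four_point_lower[OF P_prob P_sets hat.prob_space_axioms sets_hat lim, of "\<eta> / 2" _ _ _ _ lam])
      show "(\<lambda>k. c' * measure (P k) (two_point x y)) \<longlonglongrightarrow> c' * measure Phat (two_point x y)"
        by (intro tendsto_mult tendsto_const two_point_lim)
      fix h assume h: "0 < h" "h \<le> \<eta> / 2"
      show "\<forall>\<^sub>F k in sequentially. \<forall>r\<in>{0..h}. c' * measure (P k) (two_point x y) * ((LBINT u:{a..b}. J u x v) - lam * h)
         \<le> measure (P k) (four_point x (a + r) x (b + r) v y)"
        using eventually_ge_at_top[of 2]
      proof eventually_elim
        case (elim k)
        show ?case
        proof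
          fix r assume r: "r \<in> {0..h}"
          have k1: "1 \<le> k" using elim by simp
          define I where "I = (LBINT u:{a + r..b + r}. J u x v)"
          have I: "(LBINT u:{a..b}. J u x v) - lam * h \<le> I"
          proof -
            have "lam * r \<le> lam * h" using r lam_pos by simp
            then show ?thesis
              using shifted_J_integral[of r a b x v] r ab h \<eta> by (simp add: I_def)
          qed
          have I0: "0 \<le> I" unfolding I_def by (rule J_integral_nonneg) (use r ab h \<eta> in auto)
          have "c' * measure (P k) (two_point x y) * ((LBINT u:{a..b}. J u x v) - lam * h)
             \<le> c' * measure (P k) (two_point x y) * I"
            using c' by (intro mult_left_mono[OF I]) auto
          also have "\<dots> = (measure (P k) (two_point x y) * real k powr d x y / (growth * m x)) * (c * real k powr (- d x y) * m x * I)"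
            using elim m_pos[of x] by (simp add: c'_def powr_minus field_simps)
          also have "\<dots> \<le> ratio (R k) (P k) x y * measure (R k) (four_point x (a + r) x (b + r) v y)"
          proof (rule mult_mono[OF ratio_lower[OF elim]])
            show "c * real k powr (- d x y) * m x * I \<le> measure (R k) (four_point x (a + r) x (b + r) v y)"
              unfolding I_def by (rule c(2)[OF k1 R[OF k1]]) (use r ab h \<eta> in auto)
            show "0 \<le> ratio (R k) (P k) x y" by (simp add: ratio_def)
            show "0 \<le> c * real k powr (- d x y) * m x * I" using c(1) I0 m_pos[of x] by simp
          qed
          also have "\<dots> = measure (P k) (four_point x (a + r) x (b + r) v y)"
            by (rule four_point_P[OF elim, symmetric]) (use r ab h \<eta> in auto)
          finally show "c' * measure (P k) (two_point x y) * ((LBINT u:{a..b}. J u x v) - lam * h)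
             \<le> measure (P k) (four_point x (a + r) x (b + r) v y)" .
        qed
      qed
    qed (use ab \<eta> lam_pos in auto)
  qed (rule c')
qed

text \<open>
  Values of the alternating chains \<open>y\<^sub>1, x\<^sub>1, y\<^sub>2, x\<^sub>2, \<dots>\<close> through the support of the limit coupling:
  moving from \<open>x\<close> to the next \<open>y'\<close> costs \<open>d x y'\<close>, undoing a transport from \<open>x'\<close> to \<open>y'\<close> gains \<open>d x' y'\<close>.
\<close>

inductive chain :: "'a \<Rightarrow> 'a \<Rightarrow> real \<Rightarrow> bool" where
  base: "0 < measure Phat (two_point x y) \<Longrightarrow> chain y x (- d x y)"
| step: "chain y x c \<Longrightarrow> 0 < measure Phat (two_point x' y') \<Longrightarrow> chain y x' (c + d x y' - d x' y')"

lemma eventually_ratio_lower: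
  assumes "0 < measure Phat (two_point x y)"
  shows "\<exists>c>0. \<forall>\<^sub>F k in sequentially. c * real k powr d x y \<le> ratio (R k) (P k) x y"
proof (intro exI[of _ "measure Phat (two_point x y) / 2 / (growth * m x)"] conjI)
  show "0 < measure Phat (two_point x y) / 2 / (growth * m x)" using assms growth_pos m_pos[of x] by simp
  have "\<forall>\<^sub>F k in sequentially. measure Phat (two_point x y) / 2 < measure (P k) (two_point x y)"
    by (rule order_tendstoD(1)[OF two_point_lim]) (use assms in simp)
  then show "\<forall>\<^sub>F k in sequentially. measure Phat (two_point x y) / 2 / (growth * m x) * real k powr d x y \<le> ratio (R k) (P k) x y"
    using eventually_ge_at_top[of 2]
  proof eventually_elim
    case (elim k)
    have "measure Phat (two_point x y) / 2 / (growth * m x) * real k powr d x y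
       = measure Phat (two_point x y) / 2 * (real k powr d x y / (growth * m x))" by simp
    also have "\<dots> \<le> measure (P k) (two_point x y) * (real k powr d x y / (growth * m x))"
      by (rule mult_right_mono) (use elim growth_pos m_pos[of x] in auto)
    also have "\<dots> \<le> ratio (R k) (P k) x y" using ratio_lower[OF elim(2), of x y] by simp
    finally show ?case .
  qed
qed

text \<open>By the exchange identity the ratio of \<open>(x', y)\<close> is that of
  \<open>(x, y)\<close> times that of \<open>(x', y')\<close> over that of \<open>(x, y')\<close>.
  The numerators are bounded below, by induction and because the limit charges
  \<open>(x', y')\<close>; the denominator is bounded above by \<open>ratio_upper\<close>.\<close>

lemma chain_ratio:
  assumes "chain y x c"
  shows "\<exists>C>0. \<forall>\<^sub>F k in sequentially. C * real k powr (- c) \<le> ratio (R k) (P k) x y"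
  using assms
proof (induction rule: chain.induct)
  case (base x y)
  then show ?case using eventually_ratio_lower by simp
next
  case (step y x c x' y')
  obtain C1 where C1: "0 < C1" "\<forall>\<^sub>F k in sequentially. C1 * real k powr (- c) \<le> ratio (R k) (P k) x y"
    using step.IH by blast
  obtain C2 where C2: "0 < C2" "\<forall>\<^sub>F k in sequentially. C2 * real k powr d x' y' \<le> ratio (R k) (P k) x' y'"
    using eventually_ratio_lower[OF step.hyps(2)] by blast
  obtain C3 where C3: "0 < C3" "\<And>k. 2 \<le> k \<Longrightarrow> ratio (R k) (P k) x y' \<le> C3 * real k powr d x y'"
    using ratio_upper[of x y'] by blast
  show ?case
  proof (intro exI[of _ "C1 * C2 / C3"] conjI)
    show "0 < C1 * C2 / C3" using C1 C2 C3 by simp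
    show "\<forall>\<^sub>F k in sequentially. C1 * C2 / C3 * real k powr (- (c + d x y' - d x' y')) \<le> ratio (R k) (P k) x' y"
      using C1(2) C2(2) eventually_ge_at_top[of 2]
    proof eventually_elim
      case (elim k)
      have k1: "1 \<le> k" using elim by simp
      have kp: "0 < real k powr e" for e using elim by simp
      let ?r = "ratio (R k) (P k)"
      have pos: "0 < ?r x y" "0 < ?r x' y'"
        using less_le_trans[OF mult_pos_pos[OF C1(1) kp] elim(1)] less_le_trans[OF mult_pos_pos[OF C2(1) kp] elim(2)] by auto
      note ex = ratio_exchange[OF k1 R[OF k1] S[OF elim(3)] nontrivial pos]
      have "(C1 * real k powr (- c)) * (C2 * real k powr d x' y') \<le> ?r x y * ?r x' y'"
        by (rule mult_mono[OF elim(1,2)]) (use pos C2(1) in auto)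
      also have "\<dots> = ?r x y' * ?r x' y" by (rule ex(2))
      also have "\<dots> \<le> (C3 * real k powr d x y') * ?r x' y"
        by (rule mult_right_mono[OF C3(2)[OF elim(3)]]) (simp add: ratio_def)
      finally have 1: "(C1 * real k powr (- c)) * (C2 * real k powr d x' y') \<le> (C3 * real k powr d x y') * ?r x' y" .
      have pw: "real k powr (- (c + d x y' - d x' y')) = real k powr (- c) * real k powr d x' y' / real k powr d x y'"
        by (simp only: powr_add[symmetric] powr_diff[symmetric]) (simp add: algebra_simps)
      show ?case unfolding pw using 1 C3(1) kp[of "d x y'"]
        by (simp add: field_simps)
    qed
  qed
qed

text \<open>Cyclical monotonicity: \<open>d x y\<close> closes the chain to a cycle. A negative
  total would let the lower bound of \<open>chain_ratio\<close> exceed \<open>ratio_upper\<close>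
  for large \<open>k\<close>.\<close>

lemma chain_nonneg:
  assumes "chain y x c"
  shows "0 \<le> c + d x y"
proof (rule ccontr)
  assume "\<not> ?thesis"
  then have neg: "c + d x y < 0" by simp
  obtain C1 where C1: "0 < C1" "\<forall>\<^sub>F k in sequentially. C1 * real k powr (- c) \<le> ratio (R k) (P k) x y"
    using chain_ratio[OF assms] by blast
  obtain C2 where C2: "0 < C2" "\<And>k. 2 \<le> k \<Longrightarrow> ratio (R k) (P k) x y \<le> C2 * real k powr d x y"
    using ratio_upper[of x y] by blast
  have "\<forall>\<^sub>F k in sequentially. C1 \<le> C2 * real k powr (c + d x y)"
    using C1(2) eventually_ge_at_top[of 2]
  proof eventually_elim
    case (elim k)
    have kp: "0 < real k powr e" for e using elim by simp
    have "C1 * real k powr (- c) \<le> C2 * real k powr d x y" using elim(1) C2(2)[OF elim(2)] by simp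
    then have "C1 * real k powr (- c) * real k powr c \<le> C2 * real k powr d x y * real k powr c"
      by (rule mult_right_mono) simp
    then show ?case using elim(2) by (simp add: mult.assoc add.commute flip: powr_add)
  qed
  moreover have "(\<lambda>k. C2 * real k powr (c + d x y)) \<longlonglongrightarrow> C2 * 0"
    by (intro tendsto_mult tendsto_const tendsto_neg_powr[OF neg] filterlim_real_sequentially)
  ultimately have "C1 \<le> C2 * 0" by (rule tendsto_le[OF sequentially_bot _ tendsto_const, rotated])
  then show False using C1(1) by simp
qed

text \<open>Rockafellar's construction: \<open>f v\<close> is the cheapest value of a chain leading
  from a base point to \<open>v\<close>. The free last move \<open>d x v\<close> makes
  \<open>f\<close> Lipschitz, and prolonging a chain by a charged pair makes it tight there.\<close>

lemma ex_potential:
  obtains f :: "'a \<Rightarrow> real" where "\<And>x y. f y - f x \<le> d x y"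
    "\<And>x y. 0 < measure Phat (two_point x y) \<Longrightarrow> f y - f x = d x y"
proof -
  note dd = good_distanceD[OF dist]
  obtain o' y0 where o: "0 < measure Phat (two_point o' y0)"
    using ex_two_point_pos[OF hat.prob_space_axioms sets_hat] by blast
  define V where "V v = {d o' y + c + d x v | y x c. chain y x c}" for v
  have ne: "V v \<noteq> {}" for v using chain.base[OF o] by (auto simp: V_def)
  have bdd: "bdd_below (V v)" for v
  proof (rule bdd_belowI)
    fix e assume "e \<in> V v"
    then obtain y x c where e: "e = d o' y + c + d x v" "chain y x c" by (auto simp: V_def)
    \<comment> \<open>Leading the closing move through \<open>v\<close> and \<open>o'\<close> turns
      \<open>chain_nonneg\<close> into a lower bound that does not depend on the chain.\<close>
    have "d x y \<le> d x v + (d v o' + d o' y)" using dd(5)[of x y v] dd(5)[of v y o'] by simp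
    then show "- d v o' \<le> e" using chain_nonneg[OF e(2)] e(1) by simp
  qed
  define f where "f v = Inf (V v)" for v
  have lip: "f y - f x \<le> d x y" for x y
  proof -
    have "f y - d x y \<le> f x" unfolding f_def[of x]
    proof (rule cInf_greatest[OF ne])
      fix e assume "e \<in> V x"
      then obtain y' x' c where e: "e = d o' y' + c + d x' x" "chain y' x' c" by (auto simp: V_def)
      have "f y \<le> d o' y' + c + d x' y" unfolding f_def by (rule cInf_lower[OF _ bdd]) (use e in \<open>auto simp: V_def\<close>)
      then show "f y - d x y \<le> e" using e(1) dd(5)[of x' y x] by simp
    qed
    then show ?thesis by simp
  qed
  have "d x y \<le> f y - f x" if pos: "0 < measure Phat (two_point x y)" for x y
  proof -
    have "f x + d x y \<le> f y" unfolding f_def[of y]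
    proof (rule cInf_greatest[OF ne])
      fix e assume "e \<in> V y"
      then obtain y' x' c where e: "e = d o' y' + c + d x' y" "chain y' x' c" by (auto simp: V_def)
      \<comment> \<open>Using the pair \<open>(x, y)\<close> as next link changes the value by
        exactly \<open>- d x y\<close>.\<close>
      have "chain y' x (c + d x' y - d x y)" by (rule chain.step[OF e(2) pos])
      then have "f x \<le> d o' y' + (c + d x' y - d x y) + d x x"
        unfolding f_def by (intro cInf_lower[OF _ bdd]) (auto simp: V_def)
      then show "f x + d x y \<le> e" using e(1) dd(2)[of x] by simp
    qed
    then show ?thesis by simp
  qed
  with lip that show thesis by (metis order_antisym)
qed

end

section \<open>Constant speed\<close>

text \<open>The potential need not be integrable. Its truncations are bounded, hence determined by
  the marginals, and truncation keeps the sign of increments and does not enlarge them.\<close>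

definition clip :: "real \<Rightarrow> real \<Rightarrow> real" where
  "clip N r = max (- N) (min N r)"

lemma clip_bound: "0 \<le> N \<Longrightarrow> \<bar>clip N r\<bar> \<le> N"
  by (auto simp: clip_def)

lemma clip_mono: "r \<le> s \<Longrightarrow> clip N r \<le> clip N s"
  by (auto simp: clip_def)

lemma clip_contraction: "r \<le> s \<Longrightarrow> clip N s - clip N r \<le> s - r"
  by (auto simp: clip_def)

lemma clip_eq: "\<bar>r\<bar> \<le> N \<Longrightarrow> clip N r = r"
  by (auto simp: clip_def)

lemma couplingsD:
  assumes "\<pi> \<in> couplings \<alpha> \<beta>"
  shows "prob_space \<pi>" "sets \<pi> = UNIV" "distr \<pi> (count_space UNIV) fst = \<alpha>" "distr \<pi> (count_space UNIV) snd = \<beta>"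
  using assms by (auto simp: couplings_def space_prob_algebra)

section \<open>Wasserstein distance along the limit walk\<close>

context displacement
begin

lemma measurable_coord_hat: "t \<in> {0..1} \<Longrightarrow> (\<lambda>\<omega>. \<omega> t) \<in> Phat \<rightarrow>\<^sub>M count_space UNIV"
  by (rule measurable_coord_path[OF sets_hat])

lemma measurable_coord_hat_fun: "t \<in> {0..1} \<Longrightarrow> (\<lambda>\<omega>. h (\<omega> t) :: 'b::topological_space) \<in> borel_measurable Phat"
  by (rule measurable_compose[OF measurable_coord_hat]) auto

lemma measurable_coord_hat_pair:
  assumes "s \<in> {0..1}" "t \<in> {0..1}"
  shows "(\<lambda>\<omega>. (\<omega> s, \<omega> t)) \<in> Phat \<rightarrow>\<^sub>M count_space UNIV"
proof -
  have "(\<lambda>\<omega>. (\<omega> s, \<omega> t)) \<in> Phat \<rightarrow>\<^sub>M count_space UNIV \<Otimes>\<^sub>M count_space UNIV"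
    by (rule measurable_Pair) (rule measurable_coord_hat, fact)+
  then show ?thesis by (simp add: pair_measure_countable)
qed

lemma measurable_coord_hat_fun2:
  "s \<in> {0..1} \<Longrightarrow> t \<in> {0..1} \<Longrightarrow> (\<lambda>\<omega>. h (\<omega> s) (\<omega> t) :: 'b::topological_space) \<in> borel_measurable Phat"
  using measurable_compose[OF measurable_coord_hat_pair, of s t "\<lambda>p. h (fst p) (snd p)"] by simp

lemma coupling_hat:
  assumes s: "s \<in> {0..1}" "t \<in> {0..1}"
  shows "distr Phat (count_space UNIV) (\<lambda>\<omega>. (\<omega> s, \<omega> t)) \<in> couplings (marginal Phat s) (marginal Phat t)"
  unfolding couplings_def space_prob_algebra marginal_def
  using measurable_coord_hat_pair[OF s] by (auto simp: distr_distr comp_def intro!: hat.prob_space_distr)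

text \<open>The easy half of Kantorovich duality: a potential with slope 1 along the walk certifies
  that the joint law of the two positions is an optimal coupling. The certificate is applied to
  truncations of \<open>f\<close>, which also covers infinite costs.\<close>

lemma W1_hat:
  assumes s: "s \<in> {0..1}" "t \<in> {0..1}"
    and lip: "\<And>x y. f y - f x \<le> d x y" and eq: "AE \<omega> in Phat. f (\<omega> t) - f (\<omega> s) = d (\<omega> s) (\<omega> t)"
  shows "W1 d (marginal Phat s) (marginal Phat t) = (\<integral>\<^sup>+\<omega>. ennreal (d (\<omega> s) (\<omega> t)) \<partial>Phat)"
proof (rule antisym)
  note dd = good_distanceD[OF dist]
  have "W1 d (marginal Phat s) (marginal Phat t) \<le> (\<integral>\<^sup>+z. ennreal (d (fst z) (snd z)) \<partial>distr Phat (count_space UNIV) (\<lambda>\<omega>. (\<omega> s, \<omega> t)))"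
    unfolding W1_def by (rule INF_lower[OF coupling_hat[OF s]])
  also have "\<dots> = (\<integral>\<^sup>+\<omega>. ennreal (d (\<omega> s) (\<omega> t)) \<partial>Phat)"
    by (subst nn_integral_distr[OF measurable_coord_hat_pair[OF s]]) auto
  finally show "W1 d (marginal Phat s) (marginal Phat t) \<le> (\<integral>\<^sup>+\<omega>. ennreal (d (\<omega> s) (\<omega> t)) \<partial>Phat)" .
  show "(\<integral>\<^sup>+\<omega>. ennreal (d (\<omega> s) (\<omega> t)) \<partial>Phat) \<le> W1 d (marginal Phat s) (marginal Phat t)"
    unfolding W1_def
  proof (rule INF_greatest)
    fix \<pi> assume "\<pi> \<in> couplings (marginal Phat s) (marginal Phat t)"
    note \<pi> = couplingsD[OF this]
    interpret \<pi>: prob_space \<pi> by (rule \<pi>(1))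
    have s\<pi>: "sets \<pi> = sets (count_space UNIV)" using \<pi>(2) by simp
    have meas\<pi>: "h \<in> borel_measurable \<pi>" for h :: "'a \<times> 'a \<Rightarrow> real"
      unfolding measurable_cong_sets[OF s\<pi> refl] by simp
    have proj: "fst \<in> \<pi> \<rightarrow>\<^sub>M count_space UNIV" "snd \<in> \<pi> \<rightarrow>\<^sub>M count_space UNIV"
      unfolding measurable_cong_sets[OF s\<pi> refl] by simp_all
    let ?g = "\<lambda>N \<omega>. clip (real N) (f (\<omega> t)) - clip (real N) (f (\<omega> s))"
    have bound: "(\<integral>\<^sup>+\<omega>. ennreal (?g N \<omega>) \<partial>Phat) \<le> (\<integral>\<^sup>+z. ennreal (d (fst z) (snd z)) \<partial>\<pi>)" for N
    proof -
      let ?f = "\<lambda>x. clip (real N) (f x)"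
      have fb: "norm (?f x) \<le> real N" for x using clip_bound[of "real N"] by simp
      have if_hat: "integrable Phat (\<lambda>\<omega>. ?f (\<omega> u))" if "u \<in> {0..1}" for u
      proof (rule hat.integrable_const_bound)
        show "AE \<omega> in Phat. norm (?f (\<omega> u)) \<le> real N" by (intro AE_I2 fb)
        show "(\<lambda>\<omega>. ?f (\<omega> u)) \<in> borel_measurable Phat" by (rule measurable_coord_hat_fun[OF that])
      qed
      have if_\<pi>: "integrable \<pi> (\<lambda>z. ?f (fst z))" "integrable \<pi> (\<lambda>z. ?f (snd z))"
        by (rule \<pi>.integrable_const_bound[OF AE_I2[OF fb] meas\<pi>])+
      have marg: "(\<integral>\<omega>. ?f (\<omega> s) \<partial>Phat) = (\<integral>z. ?f (fst z) \<partial>\<pi>)" "(\<integral>\<omega>. ?f (\<omega> t) \<partial>Phat) = (\<integral>z. ?f (snd z) \<partial>\<pi>)"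
      proof -
        have "(\<integral>\<omega>. ?f (\<omega> u) \<partial>Phat) = (\<integral>x. ?f x \<partial>marginal Phat u)" if "u \<in> {0..1}" for u
          unfolding marginal_def by (rule integral_distr[symmetric, OF measurable_coord_hat[OF that]]) simp
        moreover have "(\<integral>z. ?f (fst z) \<partial>\<pi>) = (\<integral>x. ?f x \<partial>distr \<pi> (count_space UNIV) fst)"
          by (rule integral_distr[symmetric, OF proj(1)]) simp
        moreover have "(\<integral>z. ?f (snd z) \<partial>\<pi>) = (\<integral>x. ?f x \<partial>distr \<pi> (count_space UNIV) snd)"
          by (rule integral_distr[symmetric, OF proj(2)]) simp
        ultimately show "(\<integral>\<omega>. ?f (\<omega> s) \<partial>Phat) = (\<integral>z. ?f (fst z) \<partial>\<pi>)" "(\<integral>\<omega>. ?f (\<omega> t) \<partial>Phat) = (\<integral>z. ?f (snd z) \<partial>\<pi>)"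
          using \<pi>(3,4) s by auto
      qed
      have "AE \<omega> in Phat. 0 \<le> ?g N \<omega>"
        using eq by eventually_elim (use dd(1) clip_mono in \<open>smt (verit)\<close>)
      then have "(\<integral>\<^sup>+\<omega>. ennreal (?g N \<omega>) \<partial>Phat) = ennreal (\<integral>\<omega>. ?g N \<omega> \<partial>Phat)"
        using if_hat s by (intro nn_integral_eq_integral) auto
      also have "(\<integral>\<omega>. ?g N \<omega> \<partial>Phat) = (\<integral>z. ?f (snd z) - ?f (fst z) \<partial>\<pi>)"
        using if_hat[OF s(1)] if_hat[OF s(2)] if_\<pi> marg by simp
      also have "ennreal (\<integral>z. ?f (snd z) - ?f (fst z) \<partial>\<pi>) \<le> (\<integral>\<^sup>+z. ennreal (d (fst z) (snd z)) \<partial>\<pi>)"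
      proof (cases "(\<integral>\<^sup>+z. ennreal (d (fst z) (snd z)) \<partial>\<pi>) < \<infinity>")
        case True
        have id: "integrable \<pi> (\<lambda>z. d (fst z) (snd z))"
          by (rule integrableI_nonneg[OF meas\<pi>]) (use True dd(1) in auto)
        have "(\<integral>z. ?f (snd z) - ?f (fst z) \<partial>\<pi>) \<le> (\<integral>z. d (fst z) (snd z) \<partial>\<pi>)"
        proof (rule integral_mono[OF _ id])
          fix z
          show "?f (snd z) - ?f (fst z) \<le> d (fst z) (snd z)"
            using lip[of "snd z" "fst z"] dd(1)[of "fst z" "snd z"]
              clip_contraction[of "f (fst z)" "f (snd z)" "real N"] clip_mono[of "f (snd z)" "f (fst z)" "real N"]
            by linarith
        qed (use if_\<pi> in auto)
        then have "ennreal (\<integral>z. ?f (snd z) - ?f (fst z) \<partial>\<pi>) \<le> ennreal (\<integral>z. d (fst z) (snd z) \<partial>\<pi>)" by (rule ennreal_leI)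
        also have "\<dots> = (\<integral>\<^sup>+z. ennreal (d (fst z) (snd z)) \<partial>\<pi>)"
          by (rule nn_integral_eq_integral[symmetric, OF id]) (use dd(1) in auto)
        finally show ?thesis .
      next
        case False
        then show ?thesis by (simp add: not_less top.extremum_unique)
      qed
      finally show ?thesis .
    qed
    have gm: "(\<lambda>\<omega>. ennreal (?g N \<omega>)) \<in> borel_measurable Phat" for N
      by (rule measurable_coord_hat_fun2[of s t "\<lambda>x y. ennreal (clip (real N) (f y) - clip (real N) (f x))", OF s])
    \<comment> \<open>The increments of the truncations eventually equal the distance, and Fatou's
      lemma removes the truncation.\<close>
    have "(\<integral>\<^sup>+\<omega>. ennreal (d (\<omega> s) (\<omega> t)) \<partial>Phat) = (\<integral>\<^sup>+\<omega>. liminf (\<lambda>N. ennreal (?g N \<omega>)) \<partial>Phat)"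
    proof (rule nn_integral_cong_AE, use eq in eventually_elim)
      case (elim \<omega>)
      obtain n :: nat where n: "max \<bar>f (\<omega> s)\<bar> \<bar>f (\<omega> t)\<bar> \<le> real n" using real_arch_simple by blast
      have "\<forall>\<^sub>F N in sequentially. ennreal (?g N \<omega>) = ennreal (d (\<omega> s) (\<omega> t))"
      proof (rule eventually_sequentiallyI[of n])
        fix N assume "n \<le> N"
        then have "max \<bar>f (\<omega> s)\<bar> \<bar>f (\<omega> t)\<bar> \<le> real N" using n by (meson of_nat_le_iff order_trans)
        then show "ennreal (?g N \<omega>) = ennreal (d (\<omega> s) (\<omega> t))" using elim by (simp add: clip_eq)
      qed
      then have "(\<lambda>N. ennreal (?g N \<omega>)) \<longlonglongrightarrow> ennreal (d (\<omega> s) (\<omega> t))" by (rule tendsto_eventually)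
      then show "ennreal (d (\<omega> s) (\<omega> t)) = liminf (\<lambda>N. ennreal (?g N \<omega>))"
        by (simp add: lim_imp_Liminf)
    qed
    also have "\<dots> \<le> liminf (\<lambda>N. \<integral>\<^sup>+\<omega>. ennreal (?g N \<omega>) \<partial>Phat)"
      by (rule nn_integral_liminf[OF gm])
    also have "\<dots> \<le> limsup (\<lambda>N. \<integral>\<^sup>+\<omega>. ennreal (?g N \<omega>) \<partial>Phat)" by (rule Liminf_le_Limsup) simp
    also have "\<dots> \<le> (\<integral>\<^sup>+z. ennreal (d (fst z) (snd z)) \<partial>\<pi>)"
      by (rule Limsup_bounded) (use bound in auto)
    finally show "(\<integral>\<^sup>+\<omega>. ennreal (d (\<omega> s) (\<omega> t)) \<partial>Phat) \<le> (\<integral>\<^sup>+z. ennreal (d (fst z) (snd z)) \<partial>\<pi>)" .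
  qed
qed

text \<open>Under each bridge the path length is at least the distance of the ends, so the given
  coupling has finite cost.\<close>

lemma W1_finite:
  assumes gm: "good_marginals d (R 1) \<mu>0 \<mu>1"
  shows "W1 d \<mu>0 \<mu>1 < \<infinity>"
proof -
  obtain \<pi> where \<pi>: "\<pi> \<in> couplings \<mu>0 \<mu>1"
    "(\<integral>\<^sup>+z. (\<integral>\<^sup>+\<omega>. ennreal (path_length d \<omega>) \<partial>bridge (R 1) (fst z) (snd z)) \<partial>\<pi>) < \<infinity>"
    using gm by (auto simp: good_marginals_def)
  have R1: "slowed 1 (R 1)" by (rule R) simp
  have "ennreal (d x y) \<le> (\<integral>\<^sup>+\<omega>. ennreal (path_length d \<omega>) \<partial>bridge (R 1) x y)" for x y
  proof -
    have b: "bridge (R 1) x y = uniform_measure (R 1) (two_point x y)"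
      unfolding bridge_def two_point_def space_slowed[OF R1] by (rule refl)
    have em: "emeasure (R 1) (two_point x y) \<noteq> 0" "emeasure (R 1) (two_point x y) \<noteq> \<infinity>"
      using measure_two_point_pos[OF _ R1, of x y] two_point_finite(1)[OF R1, of x y] by (auto simp: measure_def)
    interpret b: prob_space "bridge (R 1) x y" unfolding b by (rule prob_space_uniform_measure[OF em])
    have "AE \<omega> in bridge (R 1) x y. d x y \<le> path_length d \<omega>"
      unfolding b
      by (rule AE_uniform_measureI[OF two_point_finite(2)[OF R1]])
        (use distance_le_path_length[OF dist] in \<open>auto simp: two_point_def\<close>)
    then have "(\<integral>\<^sup>+\<omega>. ennreal (d x y) \<partial>bridge (R 1) x y) \<le> (\<integral>\<^sup>+\<omega>. ennreal (path_length d \<omega>) \<partial>bridge (R 1) x y)"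
      by (intro nn_integral_mono_AE) (auto elim!: eventually_mono intro: ennreal_leI)
    then show ?thesis by (simp only: nn_integral_const b.emeasure_space_1 mult_1_right)
  qed
  then have "(\<integral>\<^sup>+z. ennreal (d (fst z) (snd z)) \<partial>\<pi>) \<le> (\<integral>\<^sup>+z. (\<integral>\<^sup>+\<omega>. ennreal (path_length d \<omega>) \<partial>bridge (R 1) (fst z) (snd z)) \<partial>\<pi>)"
    by (intro nn_integral_mono) auto
  moreover have "W1 d \<mu>0 \<mu>1 \<le> (\<integral>\<^sup>+z. ennreal (d (fst z) (snd z)) \<partial>\<pi>)"
    unfolding W1_def by (rule INF_lower[OF \<pi>(1)])
  ultimately show ?thesis using \<pi>(2) by (meson order_le_less_trans)
qed

end

section \<open>Almost sure behaviour of the limit walk\<close>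

context nontrivial_displacement
begin

text \<open>For fixed times there are countably many such events, so those of mass 0 can be
  discarded together.\<close>

lemma AE_four_point:
  assumes ab: "a \<in> {0..1}" "b \<in> {0..1}"
  shows "AE \<omega> in Phat. 0 < measure Phat (four_point (\<omega> 0) a (\<omega> a) b (\<omega> b) (\<omega> 1))"
proof -
  have "AE \<omega> in Phat. \<omega> \<in> four_point x a z b w y \<longrightarrow> 0 < measure Phat (four_point x a z b w y)" for x z w y
  proof (cases "measure Phat (four_point x a z b w y) = 0")
    case True
    have "four_point x a z b w y \<in> sets Phat" unfolding sets_hat by (rule four_point_sets[OF ab])
    then have "four_point x a z b w y \<in> null_sets Phat" using True by (simp add: null_sets_def hat.emeasure_eq_measure)
    then have "AE \<omega> in Phat. \<omega> \<notin> four_point x a z b w y" by (rule AE_not_in)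
    then show ?thesis by eventually_elim simp
  qed (simp add: zero_less_measure_iff)
  then have "AE \<omega> in Phat. \<forall>x z w y. \<omega> \<in> four_point x a z b w y \<longrightarrow> 0 < measure Phat (four_point x a z b w y)"
    by (simp add: AE_all_countable)
  then show ?thesis
  proof (rule AE_mp, intro AE_I2 impI)
    fix \<omega> assume "\<omega> \<in> space Phat" and all: "\<forall>x z w y. \<omega> \<in> four_point x a z b w y \<longrightarrow> 0 < measure Phat (four_point x a z b w y)"
    then have "\<omega> \<in> four_point (\<omega> 0) a (\<omega> a) b (\<omega> b) (\<omega> 1)" by (simp add: four_point_def space_hat)
    with all show "0 < measure Phat (four_point (\<omega> 0) a (\<omega> a) b (\<omega> b) (\<omega> 1))" by blast
  qed
qed

text \<open>On an event of positive mass, \<open>f\<close> gains \<open>d x y\<close> from start to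
  end. The three legs add up to at most that distance by \<open>hat_geodesic\<close>, and
  \<open>f\<close> gains on each no more than its length; so it gains exactly its length on
  each.\<close>

lemma AE_potential:
  assumes lip: "\<And>x y. f y - f x \<le> d x y" and pot: "\<And>x y. 0 < measure Phat (two_point x y) \<Longrightarrow> f y - f x = d x y"
    and st: "0 \<le> s" "s \<le> t" "t \<le> 1"
  shows "AE \<omega> in Phat. f (\<omega> t) - f (\<omega> s) = d (\<omega> s) (\<omega> t)"
proof -
  note dd = good_distanceD[OF dist]
  have tight: "f w - f z = d z w" "f y - f w = d w y"
    if ab: "0 \<le> a" "a \<le> b" "b < 1" and pos: "0 < measure Phat (four_point x a z b w y)" for x a z b w y
  proof -
    have "measure Phat (four_point x a z b w y) \<le> measure Phat (two_point x y)"
      by (rule hat.finite_measure_mono) (use two_point_sets in \<open>auto simp: four_point_def two_point_def sets_hat\<close>)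
    then have "f y - f x = d x y" by (intro pot) (use pos in linarith)
    then show "f w - f z = d z w" "f y - f w = d w y"
      using hat_geodesic[OF ab pos] lip[of z x] lip[of w z] lip[of y w] by linarith+
  qed
  \<comment> \<open>\<open>hat_geodesic\<close> needs times below 1. For \<open>t = 1\<close> both
    intermediate times are put at \<open>s\<close> and the last leg is used.\<close>
  consider "t < 1" | "t = 1" "s < 1" | "t = 1" "s = 1" using st by linarith
  then show ?thesis
  proof cases
    case 1
    show ?thesis
      using AE_four_point[of s t] st by (auto elim!: eventually_mono intro!: tight(1)[OF st(1,2) 1])
  next
    case 2
    show ?thesis unfolding 2(1)
      using AE_four_point[of s s] st by (auto elim!: eventually_mono intro!: tight(2)[OF st(1) order_refl 2(2)])
  qed (simp add: dd(2))
qed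

text \<open>A jump at a fixed time would survive as a jump of some path between \<open>t - 1/n\<close> and \<open>t\<close>, for all large \<open>n\<close>.\<close>

lemma no_fixed_jump:
  assumes t: "0 < t" "t \<le> 1"
  shows "AE \<omega> in Phat. left_lim \<omega> t = \<omega> t"
proof (cases "t = 1")
  case True
  then show ?thesis by (intro AE_I2) (simp add: space_hat pathD(3))
next
  case False
  then have t1: "t < 1" using t by simp
  define e where "e n = t / (real n + 1)" for n
  have e: "0 < e n" "e n \<le> t" for n using t by (auto simp: e_def field_simps)
  have elim: "e \<longlonglongrightarrow> 0" unfolding e_def by real_asymp
  have nullF: "(\<Union>N. \<Inter>n\<in>{N..}. four_point x (t - e n) z t w y) \<in> null_sets Phat" if zw: "z \<noteq> w" for x z w y
  proof (rule null_sets_UN)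
    fix N :: nat
    obtain C where C: "0 < C" "\<And>a b. 0 \<le> a \<Longrightarrow> a \<le> b \<Longrightarrow> b < 1 \<Longrightarrow> measure Phat (four_point x a z b w y) \<le> C * (b - a)"
      using hat_jump_bound[OF zw, of x y] by blast
    have F: "four_point x (t - e n) z t w y \<in> sets Phat" for n
      unfolding sets_hat by (rule four_point_sets) (use t e[of n] less_imp_le[OF e(1)[of n]] in auto)
    let ?I = "\<Inter>n\<in>{N..}. four_point x (t - e n) z t w y"
    have I: "?I \<in> sets Phat" by (rule sets.countable_INT') (use F in auto)
    have "measure Phat ?I \<le> 0"
    proof (rule tendsto_le[OF sequentially_bot _ tendsto_const])
      show "(\<lambda>n. C * e n) \<longlonglongrightarrow> 0" using tendsto_mult[OF tendsto_const elim, of C] by simp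
      show "\<forall>\<^sub>F n in sequentially. measure Phat ?I \<le> C * e n"
      proof (rule eventually_sequentiallyI[of N])
        fix n assume "N \<le> n"
        then have "measure Phat ?I \<le> measure Phat (four_point x (t - e n) z t w y)"
          by (intro hat.finite_measure_mono F) auto
        also have "\<dots> \<le> C * (t - (t - e n))" by (rule C(2)) (use e[of n] t1 in auto)
        finally show "measure Phat ?I \<le> C * e n" by simp
      qed
    qed
    then show "?I \<in> null_sets Phat" using I by (simp add: null_sets_def hat.emeasure_eq_measure measure_le_0_iff)
  qed
  have "AE \<omega> in Phat. z \<noteq> w \<longrightarrow> \<omega> \<notin> (\<Union>N. \<Inter>n\<in>{N..}. four_point x (t - e n) z t w y)" for x z w y
    by (cases "z = w") (use AE_not_in[OF nullF] in auto)
  then have "AE \<omega> in Phat. \<forall>x z w y. z \<noteq> w \<longrightarrow> \<omega> \<notin> (\<Union>N. \<Inter>n\<in>{N..}. four_point x (t - e n) z t w y)"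
    by (simp only: AE_all_countable) simp
  then show ?thesis
  proof (rule AE_mp, intro AE_I2 impI)
    fix \<omega> assume "\<omega> \<in> space Phat"
      and all: "\<forall>x z w y. z \<noteq> w \<longrightarrow> \<omega> \<notin> (\<Union>N. \<Inter>n\<in>{N..}. four_point x (t - e n) z t w y)"
    then have \<omega>: "\<omega> \<in> paths adj" by (simp add: space_hat)
    have "filterlim (\<lambda>n. t - e n) (at_left t) sequentially"
      unfolding filterlim_at using tendsto_diff[OF tendsto_const elim, of t] e
      by (auto simp: less_imp_neq[symmetric] intro!: always_eventually)
    then have "\<forall>\<^sub>F n in sequentially. \<omega> (t - e n) = left_lim \<omega> t"
      using pathD(2)[OF \<omega> t] by (auto simp: filterlim_iff)
    then obtain N where "\<And>n. N \<le> n \<Longrightarrow> \<omega> (t - e n) = left_lim \<omega> t" by (auto simp: eventually_sequentially)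
    then have "\<omega> \<in> (\<Union>N. \<Inter>n\<in>{N..}. four_point (\<omega> 0) (t - e n) (left_lim \<omega> t) t (\<omega> t) (\<omega> 1))"
      using \<omega> by (auto simp: four_point_def)
    then show "left_lim \<omega> t = \<omega> t" using all by blast
  qed
qed

lemma AE_continuous_at:
  assumes t: "t \<in> {0..1}"
  shows "AE \<omega> in Phat. \<forall>\<^sub>F s in at t within {0..1}. \<omega> s = \<omega> t"
proof -
  have "AE \<omega> in Phat. 0 < t \<longrightarrow> left_lim \<omega> t = \<omega> t"
    using no_fixed_jump[of t] t by (cases "0 < t") auto
  then show ?thesis
  proof (rule AE_mp, intro AE_I2 impI)
    fix \<omega> assume "\<omega> \<in> space Phat" and l: "0 < t \<longrightarrow> left_lim \<omega> t = \<omega> t"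
    then have \<omega>: "\<omega> \<in> paths adj" by (simp add: space_hat)
    have left: "\<forall>\<^sub>F s in at t within {0..t}. \<omega> s = \<omega> t"
    proof (cases "0 < t")
      case True
      then have "\<forall>\<^sub>F s in at_left t. \<omega> s = \<omega> t" using pathD(2)[OF \<omega> True] t l by simp
      then show ?thesis by (auto simp: eventually_at_filter elim!: eventually_mono)
    next
      case False
      then have "t = 0" using t by simp
      then show ?thesis by (auto simp: eventually_at_filter)
    qed
    have right: "\<forall>\<^sub>F s in at t within {t..1}. \<omega> s = \<omega> t"
    proof (cases "t < 1")
      case True
      then have "\<forall>\<^sub>F s in at_right t. \<omega> s = \<omega> t" using pathD(1)[OF \<omega>, of t] t by simp
      then show ?thesis by (auto simp: eventually_at_filter elim!: eventually_mono)
    next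
      case False
      then have "t = 1" using t by simp
      then show ?thesis by (auto simp: eventually_at_filter)
    qed
    have "{0..1} = {0..t} \<union> {t..1}" using t by auto
    then show "\<forall>\<^sub>F s in at t within {0..1}. \<omega> s = \<omega> t"
      using left right by (simp add: at_within_union eventually_sup)
  qed
qed

end

section \<open>The expected distance travelled and its inversion\<close>

context displacement
begin

text \<open>A state space with one point is treated apart, because the density ratios are studied
  only when there are two.\<close>

lemma ex_displacement_potential:
  obtains f :: "'a \<Rightarrow> real" where "\<And>x y. f y - f x \<le> d x y"
    "\<And>s t. 0 \<le> s \<Longrightarrow> s \<le> t \<Longrightarrow> t \<le> 1 \<Longrightarrow> AE \<omega> in Phat. f (\<omega> t) - f (\<omega> s) = d (\<omega> s) (\<omega> t)"
proof (cases "\<exists>x y::'a. x \<noteq> y")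
  case True
  interpret N: nontrivial_displacement adj d m J lam R P Phat \<mu>0 \<mu>1
    by unfold_locales (rule True)
  obtain f :: "'a \<Rightarrow> real" where f: "\<And>x y. f y - f x \<le> d x y"
    "\<And>x y. 0 < measure Phat (two_point x y) \<Longrightarrow> f y - f x = d x y"
    using N.ex_potential by blast
  show thesis by (rule that[of f]) (use f N.AE_potential[of f] in auto)
next
  case False
  then have "d x y = 0" for x y using good_distanceD(2)[OF dist, of x] by metis
  then show thesis by (intro that[of "\<lambda>_. 0"]) auto
qed

lemma displacement_constant_speed:
  assumes gm: "good_marginals d (R 1) \<mu>0 \<mu>1" and \<mu>: "\<And>t. t \<in> {0..1} \<Longrightarrow> \<mu> t = marginal Phat t"
  shows "(\<exists>\<tau>. change_of_time \<tau> \<and> constant_speed d \<mu>0 \<mu>1 (\<lambda>t. \<mu> (\<tau> t))) \<and>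
    (\<mu>0 \<noteq> \<mu>1 \<longrightarrow> (\<exists>!\<tau>. change_of_time \<tau> \<and> constant_speed d \<mu>0 \<mu>1 (\<lambda>t. \<mu> (\<tau> t))))"
proof -
  note dd = good_distanceD[OF dist]
  obtain f :: "'a \<Rightarrow> real" where lip: "\<And>x y. f y - f x \<le> d x y"
    and pot: "\<And>s t. 0 \<le> s \<Longrightarrow> s \<le> t \<Longrightarrow> t \<le> 1 \<Longrightarrow> AE \<omega> in Phat. f (\<omega> t) - f (\<omega> s) = d (\<omega> s) (\<omega> t)"
    using ex_displacement_potential by blast
  have W1_eq: "W1 d (\<mu> s) (\<mu> t) = (\<integral>\<^sup>+\<omega>. ennreal (d (\<omega> s) (\<omega> t)) \<partial>Phat)" if "0 \<le> s" "s \<le> t" "t \<le> 1" for s t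
    using W1_hat[of s t f, OF _ _ lip pot] that \<mu> by simp
  have ends: "\<mu> 0 = \<mu>0" "\<mu> 1 = \<mu>1" using \<mu> marginal_hat_ends by auto
  have int01: "integrable Phat (\<lambda>\<omega>. d (\<omega> 0) (\<omega> 1))"
    by (rule integrableI_nonneg)
      (use W1_eq[of 0 1] W1_finite[OF gm] dd(1) ends measurable_coord_hat_fun2[of 0 1 d] in auto)
  \<comment> \<open>The potential makes distances along the walk add up to
    \<open>d (\<omega> 0) (\<omega> 1)\<close>. This integrable function dominates all partial
    distances, here and in the proof of continuity.\<close>
  have le: "AE \<omega> in Phat. d (\<omega> s) (\<omega> t) \<le> d (\<omega> 0) (\<omega> 1)" if st: "0 \<le> s" "s \<le> t" "t \<le> 1" for s t
  proof -
    have "AE \<omega> in Phat. f (\<omega> 1) - f (\<omega> 0) = d (\<omega> 0) (\<omega> 1)" "AE \<omega> in Phat. f (\<omega> s) - f (\<omega> 0) = d (\<omega> 0) (\<omega> s)"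
      "AE \<omega> in Phat. f (\<omega> t) - f (\<omega> s) = d (\<omega> s) (\<omega> t)" "AE \<omega> in Phat. f (\<omega> 1) - f (\<omega> t) = d (\<omega> t) (\<omega> 1)"
      using st by (auto intro!: pot)
    then show ?thesis
    proof eventually_elim
      case (elim \<omega>)
      then show ?case using dd(1)[of "\<omega> 0" "\<omega> s"] dd(1)[of "\<omega> t" "\<omega> 1"] by linarith
    qed
  qed
  have int: "integrable Phat (\<lambda>\<omega>. d (\<omega> s) (\<omega> t))" if st: "0 \<le> s" "s \<le> t" "t \<le> 1" for s t
    by (rule Bochner_Integration.integrable_bound[OF int01])
      (use le[OF st] measurable_coord_hat_fun2[of s t d] st dd(1) in \<open>auto elim!: eventually_mono\<close>)
  \<comment> \<open>By \<open>diff\<close> this is the arc length of the interpolation; constant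
    speed means that it becomes linear after the change of time.\<close>
  define \<psi> where "\<psi> t = (\<integral>\<omega>. d (\<omega> 0) (\<omega> t) \<partial>Phat)" for t
  have diff: "\<psi> t - \<psi> s = (\<integral>\<omega>. d (\<omega> s) (\<omega> t) \<partial>Phat)" if st: "0 \<le> s" "s \<le> t" "t \<le> 1" for s t
  proof -
    have "\<psi> t - \<psi> s = (\<integral>\<omega>. d (\<omega> 0) (\<omega> t) - d (\<omega> 0) (\<omega> s) \<partial>Phat)"
      unfolding \<psi>_def using int[of 0 t] int[of 0 s] st by simp
    also have "\<dots> = (\<integral>\<omega>. d (\<omega> s) (\<omega> t) \<partial>Phat)"
    proof (rule integral_cong_AE)
      have "AE \<omega> in Phat. f (\<omega> t) - f (\<omega> 0) = d (\<omega> 0) (\<omega> t)" "AE \<omega> in Phat. f (\<omega> s) - f (\<omega> 0) = d (\<omega> 0) (\<omega> s)"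
        "AE \<omega> in Phat. f (\<omega> t) - f (\<omega> s) = d (\<omega> s) (\<omega> t)" using st by (auto intro!: pot)
      then show "AE \<omega> in Phat. d (\<omega> 0) (\<omega> t) - d (\<omega> 0) (\<omega> s) = d (\<omega> s) (\<omega> t)" by eventually_elim linarith
    qed (use int[of 0 t] int[of 0 s] int[of s t] st in auto)
    finally show ?thesis .
  qed
  have W1_\<psi>: "W1 d (\<mu> s) (\<mu> t) = ennreal (\<psi> t - \<psi> s)" if st: "0 \<le> s" "s \<le> t" "t \<le> 1" for s t
    unfolding W1_eq[OF st] diff[OF st] by (rule nn_integral_eq_integral[OF int[OF st]]) (use dd(1) in auto)
  have \<psi>0: "\<psi> 0 = 0" by (simp add: \<psi>_def dd(2))
  have \<psi>_mono: "\<psi> s \<le> \<psi> t" if st: "0 \<le> s" "s \<le> t" "t \<le> 1" for s t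
  proof -
    have "0 \<le> (\<integral>\<omega>. d (\<omega> s) (\<omega> t) \<partial>Phat)" by (rule integral_nonneg_AE) (use dd(1) in auto)
    then show ?thesis using diff[OF st] by simp
  qed
  define W where "W = \<psi> 1"
  have W0: "0 \<le> W" using \<psi>_mono[of 0 1] by (simp add: W_def \<psi>0)
  have W1W: "W1 d \<mu>0 \<mu>1 = ennreal W" using W1_\<psi>[of 0 1] by (simp add: W_def \<psi>0 ends)
  show ?thesis
  proof (cases "W = 0")
    case True
    \<comment> \<open>Nothing is transported: the ends coincide, and the identity serves as change
      of time.\<close>
    have "AE \<omega> in Phat. d (\<omega> 0) (\<omega> 1) = 0"
      using True int01 dd(1) unfolding W_def \<psi>_def by (subst (asm) integral_nonneg_eq_0_iff_AE) auto
    then have "AE \<omega> in Phat. \<omega> 0 = \<omega> 1" by (simp add: dd(3))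
    then have "marginal Phat 0 = marginal Phat 1"
      unfolding marginal_def by (intro distr_cong_AE) (auto intro!: measurable_coord_hat)
    then have "\<mu>0 = \<mu>1" using marginal_hat_ends by simp
    moreover have "\<exists>\<tau>. change_of_time \<tau> \<and> constant_speed d \<mu>0 \<mu>1 (\<lambda>t. \<mu> (\<tau> t))"
    proof (intro exI[of _ "\<lambda>t\<in>{0..1}. t"] conjI)
      show "change_of_time (\<lambda>t\<in>{0..1::real}. t)"
        unfolding change_of_time_def
      proof (intro conjI exI[of _ "\<lambda>_. 1"])
        show "abs_continuous_fun 0 1 (\<lambda>t\<in>{0..1::real}. t)"
          unfolding abs_continuous_fun_def
        proof (intro allI impI)
          fix e :: real assume e: "0 < e"
          show "\<exists>\<delta>>0. \<forall>(n::nat) a b. (\<forall>i<n. 0 \<le> a i \<and> a i \<le> b i \<and> b i \<le> 1) \<and>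
             (\<forall>i<n. \<forall>j<n. i \<noteq> j \<longrightarrow> {a i<..<b i} \<inter> {a j<..<b j} = {}) \<and> (\<Sum>i<n. b i - a i) < \<delta> \<longrightarrow>
             (\<Sum>i<n. \<bar>(\<lambda>t\<in>{0..1::real}. t) (b i) - (\<lambda>t\<in>{0..1}. t) (a i)\<bar>) < e"
          proof (intro exI[of _ e] conjI allI impI; (elim conjE)?)
            fix n :: nat and a b :: "nat \<Rightarrow> real"
            assume ab: "\<forall>i<n. 0 \<le> a i \<and> a i \<le> b i \<and> b i \<le> 1" and s: "(\<Sum>i<n. b i - a i) < e"
            have "(\<Sum>i<n. \<bar>(\<lambda>t\<in>{0..1::real}. t) (b i) - (\<lambda>t\<in>{0..1}. t) (a i)\<bar>) = (\<Sum>i<n. b i - a i)"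
              by (rule sum.cong) (use ab in \<open>force+\<close>)
            then show "(\<Sum>i<n. \<bar>(\<lambda>t\<in>{0..1::real}. t) (b i) - (\<lambda>t\<in>{0..1}. t) (a i)\<bar>) < e" using s by simp
          qed (fact e)
        qed
      qed (auto simp: set_integral_const_Icc)
      show "constant_speed d \<mu>0 \<mu>1 (\<lambda>t. \<mu> ((\<lambda>t\<in>{0..1}. t) t))"
        unfolding constant_speed_def W1W
      proof (intro allI impI; elim conjE)
        fix s t :: real assume st: "0 \<le> s" "s \<le> t" "t \<le> 1"
        have "\<psi> s = 0" "\<psi> t = 0"
          using \<psi>_mono[of 0 s] \<psi>_mono[of s 1] \<psi>_mono[of 0 t] \<psi>_mono[of t 1] st True by (auto simp: W_def \<psi>0)
        then show "W1 d (\<mu> ((\<lambda>t\<in>{0..1}. t) s)) (\<mu> ((\<lambda>t\<in>{0..1}. t) t)) = ennreal (t - s) * ennreal W"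
          using W1_\<psi>[OF st] st True by simp
      qed
    qed
    ultimately show ?thesis by simp
  next
    case False
    then have W: "0 < W" using W0 by simp
    have nt: "\<exists>x y::'a. x \<noteq> y"
    proof (rule ccontr)
      assume "\<nexists>x y::'a. x \<noteq> y"
      then have "d x y = 0" for x y using dd(2)[of x] by metis
      then show False using W by (simp add: W_def \<psi>_def)
    qed
    interpret N: nontrivial_displacement adj d m J lam R P Phat \<mu>0 \<mu>1
      by unfold_locales (rule nt)
    \<comment> \<open>Some mass really moves. A geodesic edge from \<open>x\<close> to
      \<open>v\<close>, out of one such cell, is enough: the rate of this single edge is the
      positive density \<open>j\<close> that the inversion needs.\<close>
    have "\<exists>x y. x \<noteq> y \<and> 0 < measure Phat (two_point x y)"
    proof (rule ccontr)
      assume *: "\<not> ?thesis"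
      have "AE \<omega> in Phat. 0 < measure Phat (four_point (\<omega> 0) 0 (\<omega> 0) 1 (\<omega> 1) (\<omega> 1))"
        by (rule N.AE_four_point) auto
      then have "AE \<omega> in Phat. d (\<omega> 0) (\<omega> 1) = 0"
      proof eventually_elim
        case (elim \<omega>)
        have "four_point (\<omega> 0) 0 (\<omega> 0) 1 (\<omega> 1) (\<omega> 1) = two_point (\<omega> 0) (\<omega> 1)"
          by (auto simp: four_point_def two_point_def)
        then have "\<omega> 0 = \<omega> 1" using elim * by auto
        then show ?case by (simp add: dd(3))
      qed
      then have "W = (\<integral>\<omega>. 0 \<partial>Phat)" unfolding W_def \<psi>_def
        by (intro integral_cong_AE) (use int01 in auto)
      then show False using W by simp
    qed
    then obtain x y where xy: "x \<noteq> y" "0 < measure Phat (two_point x y)" by blast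
    obtain v where v: "adj x v" "d x y = d x v + d v y" using ex_geodesic_neighbour[OF graph dist xy(1)] .
    have xv: "x \<noteq> v" using v(1) graph by (auto simp: good_graph_def)
    define \<Phi> where "\<Phi> t = \<psi> t / W" for t
    define j where "j r = J (clamp01 r) x v" for r
    have \<psi>_cont: "continuous_on {0..1} \<psi>"
      unfolding continuous_on_sequentially comp_def
    proof (intro allI impI ballI; elim conjE)
      fix u :: "nat \<Rightarrow> real" and t assume t: "t \<in> {0..1}" and u: "\<forall>n. u n \<in> {0..1}" "u \<longlonglongrightarrow> t"
      show "(\<lambda>n. \<psi> (u n)) \<longlonglongrightarrow> \<psi> t"
        unfolding \<psi>_def
      proof (rule integral_dominated_convergence[OF _ _ int01])
        show "AE \<omega> in Phat. (\<lambda>n. d (\<omega> 0) (\<omega> (u n))) \<longlonglongrightarrow> d (\<omega> 0) (\<omega> t)"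
          using N.AE_continuous_at[OF t]
        proof eventually_elim
          case (elim \<omega>)
          then have "\<forall>\<^sub>F s in nhds t. s \<noteq> t \<longrightarrow> s \<in> {0..1} \<longrightarrow> \<omega> s = \<omega> t"
            by (simp add: eventually_at_filter)
          then have "\<forall>\<^sub>F n in sequentially. u n \<noteq> t \<longrightarrow> u n \<in> {0..1} \<longrightarrow> \<omega> (u n) = \<omega> t"
            using u(2) by (rule eventually_compose_filterlim)
          then have "\<forall>\<^sub>F n in sequentially. d (\<omega> 0) (\<omega> (u n)) = d (\<omega> 0) (\<omega> t)"
            by eventually_elim (use u(1) in metis)
          then show ?case by (rule tendsto_eventually)
        qed
        show "AE \<omega> in Phat. norm (d (\<omega> 0) (\<omega> (u n))) \<le> d (\<omega> 0) (\<omega> 1)" for n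
          using le[of 0 "u n"] u(1) dd(1) by auto
        show "(\<lambda>\<omega>. d (\<omega> 0) (\<omega> t)) \<in> borel_measurable Phat" using t by (intro measurable_coord_hat_fun2) auto
        show "(\<lambda>\<omega>. d (\<omega> 0) (\<omega> (u n))) \<in> borel_measurable Phat" for n
          using u(1) by (intro measurable_coord_hat_fun2) auto
      qed
    qed
    have \<Phi>_cont: "continuous_on {0..1} \<Phi>" unfolding \<Phi>_def by (intro continuous_intros \<psi>_cont) (use W in auto)
    have \<Phi>_ends: "\<Phi> 0 = 0" "\<Phi> 1 = 1" using W by (auto simp: \<Phi>_def \<psi>0 W_def)
    have \<Phi>_mono: "mono_on {0..1} \<Phi>"
      by (rule mono_onI) (use W \<psi>_mono in \<open>auto simp: \<Phi>_def intro!: divide_right_mono\<close>)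
    have j: "j \<in> borel_measurable borel" by (simp add: j_def[abs_def])
    have jpos: "0 < j t" for t unfolding j_def by (rule J_pos[OF clamp01_in v(1)])
    have lower: "\<exists>c>0. \<forall>a b. 0 \<le> a \<and> a \<le> b \<and> b \<le> 1 - \<eta> \<longrightarrow>
        ennreal c * emeasure (density lborel (\<lambda>t. ennreal (j t))) {a..b} \<le> ennreal (\<Phi> b - \<Phi> a)"
      if \<eta>: "0 < \<eta>" "\<eta> < 1" for \<eta>
    proof -
      obtain c where c: "0 < c" "\<And>a b. 0 \<le> a \<Longrightarrow> a \<le> b \<Longrightarrow> b \<le> 1 - \<eta> \<Longrightarrow>
        c * measure Phat (two_point x y) * (LBINT u:{a..b}. J u x v) \<le> measure Phat (four_point x a x b v y)"
        using N.hat_jump_lower[OF \<eta>(1) less_imp_le[OF \<eta>(2)] v] by blast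
      define c' where "c' = c * measure Phat (two_point x y) / W"
      have c': "0 < c'" using c(1) xy(2) W by (simp add: c'_def)
      show ?thesis
      proof (intro exI[of _ c'] conjI allI impI; (elim conjE)?)
        fix a b :: real assume ab: "0 \<le> a" "a \<le> b" "b \<le> 1 - \<eta>"
        have b1: "b \<le> 1" using ab \<eta> by simp
        have "emeasure (density lborel (\<lambda>t. ennreal (j t))) {a..b} = (\<integral>\<^sup>+r. ennreal (j r) * indicator {a..b} r \<partial>lborel)"
          by (rule emeasure_density) (auto simp: j_def)
        also have "\<dots> = (\<integral>\<^sup>+r. ennreal (indicator {a..b} r *\<^sub>R J (clamp01 r) x v) \<partial>lborel)"
          by (rule nn_integral_cong) (auto simp: j_def split: split_indicator)
        also have "\<dots> = ennreal (LBINT r:{a..b}. J (clamp01 r) x v)"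
          unfolding set_lebesgue_integral_def
          by (rule nn_integral_eq_integral) (use J_integrable[of a b x v] J_nonneg in \<open>auto simp: set_integrable_def\<close>)
        also have "(LBINT r:{a..b}. J (clamp01 r) x v) = (LBINT r:{a..b}. J r x v)"
          by (rule J_integral_clamp[symmetric]) (use ab b1 in auto)
        finally have em: "emeasure (density lborel (\<lambda>t. ennreal (j t))) {a..b} = ennreal (LBINT r:{a..b}. J r x v)" .
        have "c' * (LBINT r:{a..b}. J r x v) \<le> \<Phi> b - \<Phi> a"
        proof -
          have "c * measure Phat (two_point x y) * (LBINT u:{a..b}. J u x v) \<le> measure Phat (four_point x a x b v y)"
            by (rule c(2)[OF ab])
          also have "\<dots> = (\<integral>\<omega>. indicator (four_point x a x b v y) \<omega> \<partial>Phat)"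
          proof -
            have "four_point x a x b v y \<inter> space Phat = four_point x a x b v y" by (auto simp: four_point_def space_hat)
            then show ?thesis by simp
          qed
          \<comment> \<open>On this event the walk covers \<open>d x v\<close>, which is at least
            1.\<close>
          also have "\<dots> \<le> (\<integral>\<omega>. d (\<omega> a) (\<omega> b) \<partial>Phat)"
          proof (rule integral_mono)
            have "four_point x a x b v y \<in> sets Phat" unfolding sets_hat by (rule four_point_sets) (use ab b1 in auto)
            then show "integrable Phat (indicator (four_point x a x b v y) :: _ \<Rightarrow> real)"
              by (simp add: integrable_indicator_iff hat.emeasure_eq_measure)
            show "indicator (four_point x a x b v y) \<omega> \<le> d (\<omega> a) (\<omega> b)" for \<omega>
              using dd(1)[of "\<omega> a" "\<omega> b"] dd(6)[OF xv] by (auto simp: four_point_def split: split_indicator)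
          qed (rule int[OF ab(1,2) b1])
          also have "\<dots> = \<psi> b - \<psi> a" by (rule diff[OF ab(1,2) b1, symmetric])
          finally have "c * measure Phat (two_point x y) * (LBINT u:{a..b}. J u x v) / W \<le> (\<psi> b - \<psi> a) / W"
            using W by (intro divide_right_mono) auto
          then show ?thesis by (simp add: c'_def \<Phi>_def diff_divide_distrib)
        qed
        then have "ennreal (c' * (LBINT r:{a..b}. J r x v)) \<le> ennreal (\<Phi> b - \<Phi> a)" by (rule ennreal_leI)
        then show "ennreal c' * emeasure (density lborel (\<lambda>t. ennreal (j t))) {a..b} \<le> ennreal (\<Phi> b - \<Phi> a)"
          using c' by (simp add: em ennreal_mult')
      qed (rule c')
    qed
    note \<Phi> = inverse_change_of_time[OF \<Phi>_cont \<Phi>_ends \<Phi>_mono j jpos lower]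
    obtain \<tau> where \<tau>: "change_of_time \<tau>" "\<And>t. t \<in> {0..1} \<Longrightarrow> \<Phi> (\<tau> t) = t" using \<Phi>(2) by blast
    have range: "\<sigma> t \<in> {0..1}" if "change_of_time \<sigma>" "t \<in> {0..1}" for \<sigma> t
      using that by (auto simp: change_of_time_def PiE_iff)
    have \<psi>\<Phi>: "\<psi> t = W * \<Phi> t" for t using W by (simp add: \<Phi>_def)
    have speed: "constant_speed d \<mu>0 \<mu>1 (\<lambda>t. \<mu> (\<tau> t))"
      unfolding constant_speed_def
    proof (intro allI impI; elim conjE)
      fix s t :: real assume st: "0 \<le> s" "s \<le> t" "t \<le> 1"
      have r: "\<tau> s \<in> {0..1}" "\<tau> t \<in> {0..1}" using range[OF \<tau>(1)] st by auto
      have "\<tau> s \<le> \<tau> t"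
      proof (rule ccontr)
        assume "\<not> ?thesis"
        then have "\<Phi> (\<tau> t) < \<Phi> (\<tau> s)" using strict_mono_onD[OF \<Phi>(1) r(2,1)] by simp
        then show False using \<tau>(2)[of s] \<tau>(2)[of t] st by simp
      qed
      then have "W1 d (\<mu> (\<tau> s)) (\<mu> (\<tau> t)) = ennreal (\<psi> (\<tau> t) - \<psi> (\<tau> s))" using r by (intro W1_\<psi>) auto
      also have "\<psi> (\<tau> t) - \<psi> (\<tau> s) = (t - s) * W"
        unfolding \<psi>\<Phi> using \<tau>(2)[of s] \<tau>(2)[of t] st by (simp add: algebra_simps)
      finally show "W1 d (\<mu> (\<tau> s)) (\<mu> (\<tau> t)) = ennreal (t - s) * W1 d \<mu>0 \<mu>1"
        using st W by (simp add: W1W ennreal_mult')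
    qed
    have unique: "\<sigma> = \<tau>" if \<sigma>: "change_of_time \<sigma>" "constant_speed d \<mu>0 \<mu>1 (\<lambda>t. \<mu> (\<sigma> t))" for \<sigma>
    proof (rule PiE_ext[of _ "{0..1}" "\<lambda>_. {0..1}"])
      show "\<sigma> \<in> {0..1} \<rightarrow>\<^sub>E {0..1}" "\<tau> \<in> {0..1} \<rightarrow>\<^sub>E {0..1}" using \<sigma>(1) \<tau>(1) by (auto simp: change_of_time_def)
      fix t :: real assume t: "t \<in> {0..1}"
      have r: "\<sigma> t \<in> {0..1}" "\<tau> t \<in> {0..1}" using range \<sigma>(1) \<tau>(1) t by auto
      \<comment> \<open>The distance from time 0 determines \<open>\<psi> (\<sigma> t)\<close>, and
        \<psi> is injective on [0, 1].\<close>
      have "\<sigma> 0 = 0" using \<sigma>(1) by (simp add: change_of_time_def)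
      then have "ennreal (\<psi> (\<sigma> t)) = W1 d (\<mu> (\<sigma> 0)) (\<mu> (\<sigma> t))"
        using W1_\<psi>[of 0 "\<sigma> t"] r by (simp add: \<psi>0)
      also have "\<dots> = ennreal t * W1 d \<mu>0 \<mu>1"
        using \<sigma>(2) t by (auto simp: constant_speed_def)
      also have "\<dots> = ennreal (t * W)" using t by (simp add: W1W ennreal_mult')
      finally have "\<psi> (\<sigma> t) = t * W"
        using \<psi>_mono[of 0 "\<sigma> t"] r t W by (subst (asm) ennreal_inj) (auto simp: \<psi>0)
      then have "\<Phi> (\<sigma> t) = \<Phi> (\<tau> t)" using W \<tau>(2)[OF t] by (simp add: \<Phi>_def)
      then show "\<sigma> t = \<tau> t" using inj_onD[OF strict_mono_on_imp_inj_on[OF \<Phi>(1)]] r by blast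
    qed
    show ?thesis using \<tau>(1) speed unique by blast
  qed
qed

end

theorem proposition3p9:
  fixes adj :: "'a::countable \<Rightarrow> 'a \<Rightarrow> bool"
    and d :: "'a \<Rightarrow> 'a \<Rightarrow> real"
    and m :: "'a \<Rightarrow> real"
    and J :: "real \<Rightarrow> 'a \<Rightarrow> 'a \<Rightarrow> real"
    and R :: "nat \<Rightarrow> (real \<Rightarrow> 'a) measure"
    and \<mu>0 \<mu>1 :: "'a measure"
    and \<mu> :: "real \<Rightarrow> 'a measure"
  assumes "good_graph adj"
    and "good_distance adj d"
    and "\<And>x. 0 < m x"
    and "good_kernel adj J"
    and "\<And>k. k \<ge> 1 \<Longrightarrow> markov_jump_measure adj m (slowed_kernel d J k) (R k)"
    and "good_marginals d (R 1) \<mu>0 \<mu>1"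
    and "displacement_interpolation adj R \<mu>0 \<mu>1 \<mu>"
  shows "(\<exists>\<tau>. change_of_time \<tau> \<and> constant_speed d \<mu>0 \<mu>1 (\<lambda>t. \<mu> (\<tau> t))) \<and>
    (\<mu>0 \<noteq> \<mu>1 \<longrightarrow> (\<exists>!\<tau>. change_of_time \<tau> \<and> constant_speed d \<mu>0 \<mu>1 (\<lambda>t. \<mu> (\<tau> t))))"
proof -
  obtain C where C: "\<And>t x. t \<in> {0..1} \<Longrightarrow> (\<Sum>y | adj x y. J t x y) \<le> C"
    using assms(4) unfolding good_kernel_def by blast
  obtain Phat P where Phat: "Phat \<in> space (prob_algebra (path_space adj))"
    and P: "\<And>k. 2 \<le> k \<Longrightarrow> schrodinger_solution adj (R k) \<mu>0 \<mu>1 (P k)" "narrow_limit adj P Phat"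
    and \<mu>: "\<And>t. t \<in> {0..1} \<Longrightarrow> \<mu> t = marginal Phat t"
    using assms(7) unfolding displacement_interpolation_def displacement_random_walk_def by blast
  \<comment> \<open>The maximum with 1 makes the bound on the rates positive, as
    \<open>lam_pos\<close> asks.\<close>
  interpret displacement adj d m J "max C 1" R P Phat \<mu>0 \<mu>1
  proof
    show "(\<lambda>t. J t x y) \<in> borel_measurable (restrict_space borel {0..1})" for x y
      using assms(4) by (simp add: good_kernel_def)
    show "t \<in> {0..1} \<Longrightarrow> adj x y \<Longrightarrow> 0 < J t x y" "t \<in> {0..1} \<Longrightarrow> \<not> adj x y \<Longrightarrow> J t x y = 0" for t x y
      using assms(4) unfolding good_kernel_def by metis+
    show "t \<in> {0..1} \<Longrightarrow> (\<Sum>y | adj x y. J t x y) \<le> max C 1" for t x using C[of t x] by simp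
  qed (use assms(1-3,5) Phat P in auto)
  show ?thesis by (rule displacement_constant_speed[OF assms(6) \<mu>])
qed

end
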